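(* Let $\vec p=(p_1,1)$ and $\vec q=(q_1,q_2)$ satisfy $1<p_1\le q_-\le q_+<\infty$, and let $\vec a,\vec b,\vec c\in\mathbb{R}^2$, $\vec\alpha,\vec\beta\in(-1,\infty)^2$. Then the following are equivalent: (1) $S_{\vec a,\vec b,\vec c}$ is bounded from $L^{\vec p}_{\vec\alpha}(T_B\times T_B)$ to $L^{\vec q}_{\vec\beta}(T_B\times T_B)$; (2) $T_{\vec a,\vec b,\vec c}$ is bounded from $L^{\vec p}_{\vec\alpha}(T_B\times T_B)$ to $L^{\vec q}_{\vec\beta}(T_B\times T_B)$; (3) $\alpha_1+1<p_1(b_1+1)$, $\alpha_2<b_2$, and for each $i\in\{1,2\}$: $-q_ia_i<\beta_i+1$ and $c_i=n+1+a_i+b_i+\lambda_i$, where $\lambda_1=\frac{n+1+\beta_1}{q_1}-\frac{n+1+\alpha_1}{p_1}$ and $\lambda_2=\frac{n+1+\beta_2}{q_2}-(n+1+\alpha_2)$.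
   Context: Let $n$ be a positive integer. For $z=(z_1,\dots,z_n)\in\mathbb{C}^n$ write $z=x+iy$ with $x,y\in\mathbb{R}^n$, $z'=(z_1,\dots,z_{n-1})$, $y'=(y_1,\dots,y_{n-1})$. Let $B=\{y\in\mathbb{R}^n: |y'|^2<y_n\}$ and $T_B=\{x+iy: x\in\mathbb{R}^n, y\in B\}$. For $z\in T_B$ put $\rho(z)=y_n-|y'|^2>0$, and for $z,u\in T_B$ put $\rho(z,u)=\frac14\big(\sum_{j=1}^{n-1}(z_j-\overline{u_j})^2-2i(z_n-\overline{u_n})\big)$; this has positive real part, and complex powers $\rho(z,u)^c$ are taken with the principal branch. $dV$ is Lebesgue measure on $\mathbb{C}^n$ and $dV_\alpha(z)=\rho(z)^\alpha dV(z)$. For $\vec p=(p_1,p_2)\in[1,\infty]^2$ and $\vec\alpha=(\alpha_1,\alpha_2)$, $L^{\vec p}_{\vec\alpha}(T_B\times T_B)$ is the space of measurable $f$ on $T_B\times T_B$ with finite mixed norm $\|f\|_{\vec p,\vec\alpha}=\big\{\int_{T_B}\big(\int_{T_B}|f(z,w)|^{p_1}dV_{\alpha_1}(z)\big)^{p_2/p_1}dV_{\alpha_2}(w)\big\}^{1/p_2}$, with the inner (resp. outer) integral replaced by an essential supremum in $z$ (resp. $w$) when $p_1=\infty$ (resp. $p_2=\infty$); when $\vec p=(\infty,\infty)$ this is $L^\infty(T_B\times T_B)$. Write $p_-=\min\{p_1,p_2\}$, $p_+=\max\{p_1,p_2\}$, and similarly $q_\pm$. For $\vec a=(a_1,a_2),\vec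 b=(b_1,b_2),\vec c=(c_1,c_2)\in\mathbb{R}^2$, $T_{\vec a,\vec b,\vec c}f(z,w)=\rho(z)^{a_1}\rho(w)^{a_2}\int_{T_B}\int_{T_B}\frac{\rho(u)^{b_1}\rho(\eta)^{b_2}}{\rho(z,u)^{c_1}\rho(w,\eta)^{c_2}}f(u,\eta)\,dV(u)\,dV(\eta)$ and $S_{\vec a,\vec b,\vec c}f(z,w)=\rho(z)^{a_1}\rho(w)^{a_2}\int_{T_B}\int_{T_B}\frac{\rho(u)^{b_1}\rho(\eta)^{b_2}}{|\rho(z,u)|^{c_1}|\rho(w,\eta)|^{c_2}}f(u,\eta)\,dV(u)\,dV(\eta)$. An operator is bounded from $X$ to $Y$ if for every $f\in X$ the defining integral converges for a.e. $(z,w)$ and $\|Tf\|_Y\le C\|f\|_X$ with $C$ independent of $f$. *)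

theory Defs
  imports "HOL-Analysis.Analysis"
begin

text \<open>Points of C^n are vectors z :: complex^'n; the index type 'n has n = CARD('n)
  elements and a distinguished index e plays the role of the last coordinate z_n;
  the remaining indices are the coordinates of z'.\<close>

definition rho1 :: "'n::finite \<Rightarrow> complex^'n \<Rightarrow> real" where
  "rho1 e z = Im (z $ e) - (\<Sum>j\<in>UNIV - {e}. (Im (z $ j))\<^sup>2)"

definition TB :: "'n::finite \<Rightarrow> (complex^'n) set" where
  "TB e = {z. rho1 e z > 0}"

definition rho2 :: "'n::finite \<Rightarrow> complex^'n \<Rightarrow> complex^'n \<Rightarrow> complex" where
  "rho2 e z u = ((\<Sum>j\<in>UNIV - {e}. (z $ j - cnj (u $ j))\<^sup>2) - 2 * \<i> * (z $ e - cnj (u $ e))) / 4"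

definition epow :: "ennreal \<Rightarrow> real \<Rightarrow> ennreal" where
  "epow x r = (if x = \<infinity> then \<infinity> else ennreal (enn2real x powr r))"

definition mixnorm :: "'n::finite \<Rightarrow> real \<Rightarrow> real \<Rightarrow> real \<Rightarrow> real
    \<Rightarrow> ((complex^'n) \<times> (complex^'n) \<Rightarrow> complex) \<Rightarrow> ennreal" where
  "mixnorm e p1 p2 al1 al2 f =
     epow (\<integral>\<^sup>+ w. indicator (TB e) w *
        epow (\<integral>\<^sup>+ z. indicator (TB e) z *
                 ennreal (norm (f (z, w)) powr p1 * rho1 e z powr al1) \<partial>lebesgue) (p2 / p1)
        * ennreal (rho1 e w powr al2) \<partial>lebesgue) (1 / p2)"

definition Lspace :: "'n::finite \<Rightarrow> real \<Rightarrow> real \<Rightarrow> real \<Rightarrow> real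
    \<Rightarrow> ((complex^'n) \<times> (complex^'n) \<Rightarrow> complex) set" where
  "Lspace e p1 p2 al1 al2 =
     {f. f \<in> borel_measurable lebesgue \<and> mixnorm e p1 p2 al1 al2 f < \<infinity>}"

text \<open>Kernels of T and S (without the outer factor rho(z)^a1 rho(w)^a2).\<close>
definition Tkernel :: "'n::finite \<Rightarrow> real \<Rightarrow> real \<Rightarrow> real \<Rightarrow> real
    \<Rightarrow> complex^'n \<Rightarrow> complex^'n \<Rightarrow> (complex^'n) \<times> (complex^'n) \<Rightarrow> complex" where
  "Tkernel e b1 b2 c1 c2 z w x =
     complex_of_real (rho1 e (fst x) powr b1 * rho1 e (snd x) powr b2) /
     (rho2 e z (fst x) powr complex_of_real c1 * rho2 e w (snd x) powr complex_of_real c2)"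

definition Skernel :: "'n::finite \<Rightarrow> real \<Rightarrow> real \<Rightarrow> real \<Rightarrow> real
    \<Rightarrow> complex^'n \<Rightarrow> complex^'n \<Rightarrow> (complex^'n) \<times> (complex^'n) \<Rightarrow> complex" where
  "Skernel e b1 b2 c1 c2 z w x =
     complex_of_real (rho1 e (fst x) powr b1 * rho1 e (snd x) powr b2 /
       (cmod (rho2 e z (fst x)) powr c1 * cmod (rho2 e w (snd x)) powr c2))"

definition intop :: "'n::finite \<Rightarrow> real \<Rightarrow> real
    \<Rightarrow> (complex^'n \<Rightarrow> complex^'n \<Rightarrow> (complex^'n) \<times> (complex^'n) \<Rightarrow> complex)
    \<Rightarrow> ((complex^'n) \<times> (complex^'n) \<Rightarrow> complex) \<Rightarrow> (complex^'n) \<times> (complex^'n) \<Rightarrow> complex" where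
  "intop e a1 a2 K f x =
     complex_of_real (rho1 e (fst x) powr a1 * rho1 e (snd x) powr a2) *
     (LINT y:(TB e \<times> TB e)|lebesgue. K (fst x) (snd x) y * f y)"

definition bounded_op :: "'n::finite \<Rightarrow> real \<Rightarrow> real
    \<Rightarrow> (complex^'n \<Rightarrow> complex^'n \<Rightarrow> (complex^'n) \<times> (complex^'n) \<Rightarrow> complex)
    \<Rightarrow> real \<Rightarrow> real \<Rightarrow> real \<Rightarrow> real \<Rightarrow> real \<Rightarrow> real \<Rightarrow> real \<Rightarrow> real \<Rightarrow> bool" where
  "bounded_op e a1 a2 K p1 p2 al1 al2 q1 q2 be1 be2 \<longleftrightarrow>
     (\<exists>C::real. \<forall>f \<in> Lspace e p1 p2 al1 al2.
        (AE x in lebesgue. x \<in> TB e \<times> TB e \<longrightarrow>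
            set_integrable lebesgue (TB e \<times> TB e) (\<lambda>y. K (fst x) (snd x) y * f y)) \<and>
        (\<lambda>x. indicator (TB e \<times> TB e) x *\<^sub>R intop e a1 a2 K f x) \<in> borel_measurable lebesgue \<and>
        mixnorm e q1 q2 be1 be2 (intop e a1 a2 K f) \<le> ennreal C * mixnorm e p1 p2 al1 al2 f)"

end

theory Submission
  imports Defs "HOL-Complex_Analysis.Cauchy_Integral_Theorem"
begin

text \<open>
  Sufficiency. By dyadic decomposition, \<open>\<integral> \<rho>(u)\<^bsup>t\<^esup> |\<rho>(z,u)|\<^bsup>-s\<^esup> dV(u) \<lesssim> \<rho>(z)\<^bsup>n+1+t-s\<^esup>\<close> for
  \<open>t > -1\<close> and \<open>s > n+1+t\<close>. With this estimate Hoelder's and Minkowski's inequalities bound the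
  one-variable operator in \<open>z\<close> from \<open>L\<^bsup>p\<^sub>1\<^esup>\<close> to \<open>L\<^bsup>q\<^sub>1\<^esup>\<close> and the one in \<open>w\<close> from \<open>L\<^sup>1\<close> to
  \<open>L\<^bsup>q\<^sub>2\<^esup>\<close>; the second index of \<open>p\<close> being 1, a further use of Minkowski's inequality combines them.

  Necessity. On an anisotropic box of size \<open>r\<close> around \<open>(0, i r)\<close> the phase of \<open>\<rho>(z,u)\<^bsup>-c\<^esup>\<close> is nearly
  constant, uniformly in \<open>z\<close>. Testing on indicators of products of two such boxes gives a lower bound with
  explicit powers of the two sizes. Letting the sizes tend to \<open>0\<close> and \<open>\<infinity>\<close> yields the formulas for
  \<open>c\<^sub>i\<close>, and finiteness at size 1 yields the strict inequalities, except for the one on \<open>b\<^sub>1\<close>, which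
  already follows from convergence of the defining integral.
\<close>

section \<open>Powers and weighted norms of extended nonnegative functions\<close>

text \<open>The number n+1 is the homogeneous dimension of the dilations (z', z_n) to (sqrt r z', r
  z_n), which multiply rho by r: the n-1 complex coordinates of z' contribute volume r each and z_n
  contributes r^2. The formula for c_i is a count in these terms. The obstacle is the oscillation of
  the kernel of T. S dominates T, but nothing bounds S by T directly, so necessity must be proved
  for T itself, with test functions on which the kernel cannot cancel. The two variables behave
  differently. With the formula for c_i, finiteness of the test norms gives al_i + n+1 < p_i (b_i +
  n+1). For p_2 = 1 this is al_2 < b_2, but for p_1 > 1 it is weaker than al_1 + 1 < p_1 (b_1 + 1);
  a function with a borderline logarithmic singularity along the boundary has to supply the rest.
  Functions in the source space are only Lebesgue measurable on the product and may have
  nonmeasurable slices, so Tonelli arguments run on Borel representatives.\<close>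

lemma epow_ennreal: "0 \<le> x \<Longrightarrow> epow (ennreal x) r = ennreal (x powr r)"
  by (simp add: epow_def)

lemma epow_top [simp]: "epow top r = top"
  by (simp add: epow_def)

lemma epow_0 [simp]: "epow 0 r = 0"
  by (simp add: epow_def)

lemma epow_1 [simp]: "epow 1 r = 1"
  by (simp add: epow_def)

lemma epow_exp_1 [simp]: "epow x 1 = x"
  by (cases x rule: ennreal_cases) (simp_all add: epow_ennreal)

lemma epow_eq_0_iff [simp]: "epow x r = 0 \<longleftrightarrow> x = 0"
  by (cases x rule: ennreal_cases) (auto simp: epow_ennreal)

lemma epow_eq_top_iff [simp]: "epow x r = top \<longleftrightarrow> x = top"
  by (cases x rule: ennreal_cases) (simp_all add: epow_ennreal)

lemma epow_less_top_iff [simp]: "epow x r < top \<longleftrightarrow> x < top"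
  by (simp add: less_top[symmetric])

text \<open>The conventions \<open>0\<close> to \<open>0\<close> and \<open>top\<close> to
  \<open>top\<close>, for all exponents including zero and negative ones, are compatible with
  \<open>0 * top = 0\<close>. Negative powers can therefore be used as Hoelder weights later; only
  monotonicity depends on the sign of the exponent.\<close>

lemma epow_mult: "epow (x * y) r = epow x r * epow y r"
proof (cases "x = top \<or> y = top")
  case True
  then show ?thesis
    by (cases "x = 0 \<or> y = 0") (auto simp: ennreal_mult_eq_top_iff ennreal_top_mult ennreal_mult_top)
next
  case False
  then obtain a b where "x = ennreal a" "0 \<le> a" "y = ennreal b" "0 \<le> b"
    by (metis ennreal_cases)
  then show ?thesis
    by (simp add: epow_ennreal powr_mult flip: ennreal_mult)
qed

lemma epow_epow: "epow (epow x r) s = epow x (r * s)"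
  by (cases x rule: ennreal_cases) (simp_all add: epow_ennreal powr_powr)

lemma epow_add: "epow x (r + s) = epow x r * epow x s"
  by (cases x rule: ennreal_cases)
    (simp_all add: epow_ennreal powr_add ennreal_mult ennreal_top_mult)

lemma epow_mono: "x \<le> y \<Longrightarrow> 0 \<le> r \<Longrightarrow> epow x r \<le> epow y r"
  by (cases x rule: ennreal_cases; cases y rule: ennreal_cases)
    (auto simp: epow_ennreal powr_mono2 top_unique)

lemma epow_measurable [measurable]:
  assumes [measurable]: "f \<in> borel_measurable M"
  shows "(\<lambda>x. epow (f x) r) \<in> borel_measurable M"
  unfolding epow_def by measurable

section \<open>Norms of extended nonnegative functions; Hoelder and Minkowski\<close>

definition Lnorm :: "'a measure \<Rightarrow> real \<Rightarrow> ('a \<Rightarrow> ennreal) \<Rightarrow> ennreal" where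
  "Lnorm M p f = epow (\<integral>\<^sup>+x. epow (f x) p \<partial>M) (1 / p)"

lemma Lnorm_exp_1: "Lnorm M 1 f = (\<integral>\<^sup>+x. f x \<partial>M)"
  by (simp add: Lnorm_def)

lemma epow_Lnorm: "p \<noteq> 0 \<Longrightarrow> epow (Lnorm M p f) p = (\<integral>\<^sup>+x. epow (f x) p \<partial>M)"
  by (simp add: Lnorm_def epow_epow)

lemma Lnorm_mono_AE:
  assumes "0 < p" "AE x in M. f x \<le> g x"
  shows "Lnorm M p f \<le> Lnorm M p g"
  unfolding Lnorm_def using assms
  by (intro epow_mono nn_integral_mono_AE) (auto elim!: eventually_mono intro: epow_mono)

lemma Lnorm_mono:
  assumes "0 < p" "\<And>x. x \<in> space M \<Longrightarrow> f x \<le> g x"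
  shows "Lnorm M p f \<le> Lnorm M p g"
  using assms by (intro Lnorm_mono_AE) auto

lemma Lnorm_cong: "(\<And>x. x \<in> space M \<Longrightarrow> f x = g x) \<Longrightarrow> Lnorm M p f = Lnorm M p g"
  unfolding Lnorm_def by (auto intro!: arg_cong[where f = "\<lambda>x. epow x _"] nn_integral_cong)

lemma Lnorm_cmult:
  assumes [measurable]: "f \<in> borel_measurable M" and p: "p \<noteq> 0"
  shows "Lnorm M p (\<lambda>x. c * f x) = c * Lnorm M p f"
  using p by (simp add: Lnorm_def epow_mult nn_integral_cmult epow_epow)

lemma Lnorm_multc:
  assumes [measurable]: "f \<in> borel_measurable M" and p: "p \<noteq> 0"
  shows "Lnorm M p (\<lambda>x. f x * c) = Lnorm M p f * c"
  using Lnorm_cmult[OF assms, of c] by (simp add: mult.commute)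

lemma Lnorm_epow:
  assumes "p \<noteq> 0"
  shows "Lnorm M (q / p) (\<lambda>x. epow (f x) p) = epow (Lnorm M q f) p"
  using assms by (simp add: Lnorm_def epow_epow)

lemma Lnorm_measurable [measurable (raw)]:
  assumes "sigma_finite_measure N"
    and [measurable]: "case_prod F \<in> borel_measurable (M \<Otimes>\<^sub>M N)"
  shows "(\<lambda>x. Lnorm N p (F x)) \<in> borel_measurable M"
proof -
  interpret sigma_finite_measure N by fact
  show ?thesis unfolding Lnorm_def by measurable
qed

text \<open>Young's inequality for x/a and y/b, multiplied by a b. With the two norms as a and b,
  integration yields a b (1/p + 1/q) = a b, which is Hoelder without normalising the
  functions.\<close>

lemma Young_ennreal:
  fixes x y :: ennreal and a b :: real
  assumes "1 < p" "1 < q" "1 / p + 1 / q = 1" "0 < a" "0 < b"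
  shows "x * y \<le> ennreal (b * a powr (1 - p) / p) * epow x p + ennreal (a * b powr (1 - q) / q) * epow y q"
proof (cases "x = top \<or> y = top")
  case True
  then show ?thesis using assms by (auto simp: ennreal_mult_top)
next
  case False
  then obtain s t where s: "x = ennreal s" "0 \<le> s" and t: "y = ennreal t" "0 \<le> t"
    by (metis ennreal_cases)
  have "(s / a) * (t / b) \<le> (s / a) powr p / p + (t / b) powr q / q"
    using assms s t by (intro Youngs_inequality) auto
  then have "a * b * ((s / a) * (t / b)) \<le> a * b * ((s / a) powr p / p + (t / b) powr q / q)"
    using assms by (intro mult_left_mono) auto
  also have "a * b * ((s / a) * (t / b)) = s * t"
    using assms by (simp add: field_simps)
  also have "a * b * ((s / a) powr p / p + (t / b) powr q / q)
     = b * a powr (1 - p) / p * s powr p + a * b powr (1 - q) / q * t powr q"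
    using assms by (simp add: powr_divide powr_diff field_simps)
  finally show ?thesis
    using s t assms by (simp add: epow_ennreal ennreal_leI flip: ennreal_mult ennreal_plus)
qed

lemma Holder_nn_integral:
  assumes pq: "1 < p" "1 < q" "1 / p + 1 / q = 1"
    and [measurable]: "f \<in> borel_measurable M" "g \<in> borel_measurable M"
  shows "(\<integral>\<^sup>+x. f x * g x \<partial>M) \<le> Lnorm M p f * Lnorm M q g"
proof -
  consider "Lnorm M p f = 0 \<or> Lnorm M q g = 0" | "Lnorm M p f \<noteq> 0" "Lnorm M q g \<noteq> 0" "Lnorm M p f = top \<or> Lnorm M q g = top"
    | a b where "0 < a" "Lnorm M p f = ennreal a" "0 < b" "Lnorm M q g = ennreal b"
    by (metis ennreal_cases ennreal_0 less_le)
  then show ?thesis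
  proof cases
    case 1
    then have "AE x in M. f x * g x = 0"
      by (auto simp: Lnorm_def nn_integral_0_iff_AE)
    then have "(\<integral>\<^sup>+x. f x * g x \<partial>M) = 0"
      by (subst nn_integral_0_iff_AE) auto
    then show ?thesis by simp
  next
    case 2
    then show ?thesis by (auto simp: ennreal_top_mult ennreal_mult_top)
  next
    case (3 a b)
    have A: "(\<integral>\<^sup>+x. epow (f x) p \<partial>M) = ennreal (a powr p)"
      using epow_Lnorm[of p M f] 3 pq by (simp add: epow_ennreal)
    have B: "(\<integral>\<^sup>+x. epow (g x) q \<partial>M) = ennreal (b powr q)"
      using epow_Lnorm[of q M g] 3 pq by (simp add: epow_ennreal)
    have "(\<integral>\<^sup>+x. f x * g x \<partial>M) \<le> (\<integral>\<^sup>+x. ennreal (b * a powr (1 - p) / p) * epow (f x) p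
        + ennreal (a * b powr (1 - q) / q) * epow (g x) q \<partial>M)"
      using pq 3 by (intro nn_integral_mono Young_ennreal) auto
    also have "\<dots> = ennreal (b * a powr (1 - p) / p) * ennreal (a powr p)
        + ennreal (a * b powr (1 - q) / q) * ennreal (b powr q)"
      by (simp add: nn_integral_add nn_integral_cmult A B)
    also have "\<dots> = ennreal (b * a powr (1 - p) / p * a powr p + a * b powr (1 - q) / q * b powr q)"
      using pq 3 by (simp flip: ennreal_mult ennreal_plus)
    also have "b * a powr (1 - p) / p * a powr p + a * b powr (1 - q) / q * b powr q = a * b * (1 / p + 1 / q)"
      using pq 3 by (simp add: powr_diff field_simps)
    also have "\<dots> = a * b" using pq by simp
    finally show ?thesis using 3 by (simp add: ennreal_mult)
  qed
qed

text \<open>With \<open>A \<eta> = \<parallel>F(\<cdot>, \<eta>)\<parallel>\<close>, Hoelder's inequality applied to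
  \<open>F = (F A\<^bsup>-1/q'\<^esup>) A\<^bsup>1/q'\<^esup>\<close> gives Minkowski's inequality after one use of Tonelli's theorem.\<close>

lemma Minkowski_nn_integral:
  assumes M: "sigma_finite_measure M" and N: "sigma_finite_measure N" and q: "1 \<le> q"
    and F [measurable]: "case_prod F \<in> borel_measurable (M \<Otimes>\<^sub>M N)"
  shows "Lnorm M q (\<lambda>z. \<integral>\<^sup>+\<eta>. F z \<eta> \<partial>N) \<le> (\<integral>\<^sup>+\<eta>. Lnorm M q (\<lambda>z. F z \<eta>) \<partial>N)"
proof -
  interpret M: sigma_finite_measure M by fact
  interpret N: sigma_finite_measure N by fact
  interpret P: pair_sigma_finite M N ..
  interpret P': pair_sigma_finite N M ..
  have F' [measurable]: "(\<lambda>(\<eta>, z). F z \<eta>) \<in> borel_measurable (N \<Otimes>\<^sub>M M)"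
    using measurable_pair_swap[OF F] by (simp add: case_prod_unfold)
  define A where "A \<eta> = Lnorm M q (\<lambda>z. F z \<eta>)" for \<eta>
  have [measurable]: "A \<in> borel_measurable N"
    unfolding A_def by (rule Lnorm_measurable[OF M]) measurable
  define I where "I = (\<integral>\<^sup>+\<eta>. A \<eta> \<partial>N)"
  show ?thesis
  proof (cases "q = 1")
    case True
    show ?thesis unfolding True Lnorm_exp_1
      by (subst P.Fubini') auto
  next
    case q1: False
    show ?thesis
    proof (cases "I = top")
      case True
      then show ?thesis by (simp add: I_def A_def)
    next
      case fin: False
      define q' where "q' = q / (q - 1)"
      have qq: "1 < q" "1 < q'" "1 / q + 1 / q' = 1" "q / q' = q - 1"
        using q q1 by (auto simp: q'_def field_simps)
      have Afin: "AE \<eta> in N. A \<eta> \<noteq> top"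
        using fin nn_integral_PInf_AE[of A N] by (simp add: I_def)
      \<comment> \<open>Where \<open>A\<close> vanishes, its negative power is 0 by convention and
        the factorisation of \<open>F\<close> could fail; it is rescued because \<open>F\<close> is
        then 0 for almost all z.\<close>
      have Azero: "AE \<eta> in N. A \<eta> = 0 \<longrightarrow> (AE z in M. F z \<eta> = 0)"
        by (intro AE_I2) (auto simp: A_def Lnorm_def nn_integral_0_iff_AE)
      define G where "G z \<eta> = epow (A \<eta>) (- 1 / q') * F z \<eta>" for z \<eta>
      have [measurable]: "case_prod G \<in> borel_measurable (M \<Otimes>\<^sub>M N)"
        unfolding G_def by measurable
      have pt: "F z \<eta> = G z \<eta> * epow (A \<eta>) (1 / q')" if "A \<eta> \<noteq> top" "A \<eta> = 0 \<longrightarrow> F z \<eta> = 0" for z \<eta>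
      proof (cases "A \<eta> = 0")
        case False
        then obtain r where "A \<eta> = ennreal r" "0 < r"
          using \<open>A \<eta> \<noteq> top\<close> by (cases "A \<eta>" rule: ennreal_cases) (auto simp: less_le)
        then have "epow (A \<eta>) (- 1 / q') * epow (A \<eta>) (1 / q') = 1"
          by (simp add: epow_ennreal flip: ennreal_mult powr_add)
        then show ?thesis unfolding G_def by (simp add: mult.assoc mult.left_commute)
      qed (use that in auto)
      have "AE \<eta> in N. AE z in M. F z \<eta> = G z \<eta> * epow (A \<eta>) (1 / q')"
        using Afin Azero
      proof eventually_elim
        case (elim \<eta>)
        show ?case
        proof (cases "A \<eta> = 0")
          case True
          with elim have "AE z in M. F z \<eta> = 0" by simp
          then show ?thesis by eventually_elim (use pt elim in auto)
        qed (use pt elim in auto)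
      qed
      then have "AE z in M. AE \<eta> in N. F z \<eta> = G z \<eta> * epow (A \<eta>) (1 / q')"
        by (subst P.AE_commute) measurable
      then have 1: "AE z in M. (\<integral>\<^sup>+\<eta>. F z \<eta> \<partial>N) \<le> Lnorm N q (G z) * epow I (1 / q')"
      proof (rule AE_mp, intro AE_I2 impI)
        fix z assume z: "z \<in> space M" and "AE \<eta> in N. F z \<eta> = G z \<eta> * epow (A \<eta>) (1 / q')"
        then have "(\<integral>\<^sup>+\<eta>. F z \<eta> \<partial>N) = (\<integral>\<^sup>+\<eta>. G z \<eta> * epow (A \<eta>) (1 / q') \<partial>N)"
          by (intro nn_integral_cong_AE)
        also have "\<dots> \<le> Lnorm N q (G z) * Lnorm N q' (\<lambda>\<eta>. epow (A \<eta>) (1 / q'))"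
          using z by (intro Holder_nn_integral qq) measurable
        also have "Lnorm N q' (\<lambda>\<eta>. epow (A \<eta>) (1 / q')) = epow I (1 / q')"
          using qq by (simp add: Lnorm_def I_def epow_epow)
        finally show "(\<integral>\<^sup>+\<eta>. F z \<eta> \<partial>N) \<le> Lnorm N q (G z) * epow I (1 / q')" .
      qed
      have "Lnorm M q (\<lambda>z. \<integral>\<^sup>+\<eta>. F z \<eta> \<partial>N) \<le> Lnorm M q (\<lambda>z. Lnorm N q (G z) * epow I (1 / q'))"
        using qq 1 by (intro Lnorm_mono_AE) auto
      also have "\<dots> = Lnorm M q (\<lambda>z. Lnorm N q (G z)) * epow I (1 / q')"
        using qq by (intro Lnorm_multc Lnorm_measurable[OF N]) auto
      also have "Lnorm M q (\<lambda>z. Lnorm N q (G z)) = epow (\<integral>\<^sup>+z. \<integral>\<^sup>+\<eta>. epow (G z \<eta>) q \<partial>N \<partial>M) (1 / q)"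
        using qq unfolding Lnorm_def[of M] by (simp add: epow_Lnorm)
      also have "(\<integral>\<^sup>+z. \<integral>\<^sup>+\<eta>. epow (G z \<eta>) q \<partial>N \<partial>M) = (\<integral>\<^sup>+\<eta>. \<integral>\<^sup>+z. epow (G z \<eta>) q \<partial>M \<partial>N)"
        by (subst P.Fubini') auto
      \<comment> \<open>The weight contributes A^(-q/q') = A^(1-q), which reduces the A^q from the
        z-integral to A.\<close>
      also have "\<dots> = (\<integral>\<^sup>+\<eta>. epow (A \<eta>) (1 - q) * epow (A \<eta>) q \<partial>N)"
      proof (intro nn_integral_cong)
        fix \<eta> assume [measurable]: "\<eta> \<in> space N"
        have "- 1 / q' * q = 1 - q" using qq by simp
        then have "(\<integral>\<^sup>+z. epow (G z \<eta>) q \<partial>M) = (\<integral>\<^sup>+z. epow (A \<eta>) (1 - q) * epow (F z \<eta>) q \<partial>M)"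
          by (simp only: G_def epow_mult epow_epow)
        also have "\<dots> = epow (A \<eta>) (1 - q) * (\<integral>\<^sup>+z. epow (F z \<eta>) q \<partial>M)"
          by (intro nn_integral_cmult) measurable
        also have "(\<integral>\<^sup>+z. epow (F z \<eta>) q \<partial>M) = epow (A \<eta>) q"
          using qq by (simp add: A_def epow_Lnorm)
        finally show "(\<integral>\<^sup>+z. epow (G z \<eta>) q \<partial>M) = epow (A \<eta>) (1 - q) * epow (A \<eta>) q" .
      qed
      also have "\<dots> = I"
        unfolding I_def epow_add[symmetric] by simp
      also have "epow I (1 / q) * epow I (1 / q') = I"
        using qq by (simp flip: epow_add)
      finally show ?thesis by (simp add: I_def A_def)
    qed
  qed
qed

section \<open>The defining functions of the tube domain\<close>

lemma measurable_vec_nth [measurable]: "(\<lambda>z :: complex^'n. z $ j) \<in> borel_measurable borel"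
  by (intro borel_measurable_continuous_onI continuous_intros)

lemma rho1_measurable [measurable]: "rho1 e \<in> borel_measurable borel"
  unfolding rho1_def by measurable

lemma TB_measurable [measurable]: "TB e \<in> sets borel"
  unfolding TB_def by measurable

lemma rho2_measurable [measurable]:
  assumes [measurable]: "f \<in> borel_measurable M" "g \<in> borel_measurable M"
  shows "(\<lambda>x. rho2 e (f x) (g x)) \<in> borel_measurable M"
proof -
  have 1: "(\<lambda>x. f x $ j) \<in> borel_measurable M" for j
    by (rule measurable_compose[OF assms(1) measurable_vec_nth])
  have 2: "(\<lambda>x. cnj (g x $ j)) \<in> borel_measurable M" for j
    by (rule measurable_compose[OF measurable_compose[OF assms(2) measurable_vec_nth]])
      (intro borel_measurable_continuous_onI continuous_intros)
  show ?thesis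
    unfolding rho2_def using 1 2 by measurable
qed

text \<open>Coordinatewise, Re((z - conj u)^2) = |z - u|^2 - 2 (Im z)^2 - 2 (Im u)^2, and the last
  two terms turn Im z_n and Im u_n into rho(z) and rho(u). The lower bounds for |rho(z,u)| below
  come from this splitting into terms that are nonnegative on \<open>TB\<close>.\<close>

lemma Re_rho2:
  "Re (rho2 e z u) = (\<Sum>j\<in>UNIV - {e}. (cmod (z $ j - u $ j))\<^sup>2) / 4 + (rho1 e z + rho1 e u) / 2"
proof -
  have "4 * Re (rho2 e z u) = (\<Sum>j\<in>UNIV - {e}. Re ((z $ j - cnj (u $ j))\<^sup>2)) + 2 * (Im (z $ e) + Im (u $ e))"
    by (simp add: rho2_def Re_sum)
  also have "(\<Sum>j\<in>UNIV - {e}. Re ((z $ j - cnj (u $ j))\<^sup>2)) =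
      (\<Sum>j\<in>UNIV - {e}. (cmod (z $ j - u $ j))\<^sup>2 - 2 * (Im (z $ j))\<^sup>2 - 2 * (Im (u $ j))\<^sup>2)"
    by (intro sum.cong refl) (simp add: cmod_power2, simp add: power2_eq_square algebra_simps)
  also have "\<dots> = (\<Sum>j\<in>UNIV - {e}. (cmod (z $ j - u $ j))\<^sup>2)
      - 2 * (\<Sum>j\<in>UNIV - {e}. (Im (z $ j))\<^sup>2) - 2 * (\<Sum>j\<in>UNIV - {e}. (Im (u $ j))\<^sup>2)"
    by (simp add: sum_subtractf sum_distrib_left)
  finally show ?thesis
    unfolding rho1_def by argo
qed

text \<open>Affine in Re u_n with slope 1/2 once z and u' are fixed; this confines Re u_n to an
  interval inside sublevel sets of |rho(z,u)|.\<close>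

lemma Im_rho2:
  "Im (rho2 e z u) = ((\<Sum>j\<in>UNIV - {e}. (Re (z $ j) - Re (u $ j)) * (Im (z $ j) + Im (u $ j)))
     - (Re (z $ e) - Re (u $ e))) / 2"
proof -
  have "4 * Im (rho2 e z u) = (\<Sum>j\<in>UNIV - {e}. Im ((z $ j - cnj (u $ j))\<^sup>2)) - 2 * (Re (z $ e) - Re (u $ e))"
    by (simp add: rho2_def Im_sum)
  also have "(\<Sum>j\<in>UNIV - {e}. Im ((z $ j - cnj (u $ j))\<^sup>2)) =
      2 * (\<Sum>j\<in>UNIV - {e}. (Re (z $ j) - Re (u $ j)) * (Im (z $ j) + Im (u $ j)))"
    unfolding sum_distrib_left
    by (intro sum.cong refl) (simp add: power2_eq_square algebra_simps)
  finally show ?thesis by simp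
qed

text \<open>\<open>rho2\<close> is Hermitian: exchanging the arguments conjugates it. Estimates in
  one argument thereby transfer to the other.\<close>

lemma cmod_rho2_commute: "cmod (rho2 e z u) = cmod (rho2 e u z)"
proof -
  have "rho2 e u z = cnj (rho2 e z u)"
  proof (rule complex_eqI)
    show "Re (rho2 e u z) = Re (cnj (rho2 e z u))"
      by (simp add: Re_rho2 norm_minus_commute add.commute)
    have "(\<Sum>j\<in>UNIV - {e}. (Re (u $ j) - Re (z $ j)) * (Im (u $ j) + Im (z $ j))) =
        - (\<Sum>j\<in>UNIV - {e}. (Re (z $ j) - Re (u $ j)) * (Im (z $ j) + Im (u $ j)))"
      unfolding sum_negf[symmetric] by (intro sum.cong refl) (simp add: algebra_simps)
    then show "Im (rho2 e u z) = Im (cnj (rho2 e z u))"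
      using Im_rho2[of e z u] Im_rho2[of e u z] by (simp only: cnj.simps) argo
  qed
  then show ?thesis by simp
qed

lemma rho1_sum_le_Re_rho2: "(rho1 e z + rho1 e u) / 2 \<le> Re (rho2 e z u)"
  unfolding Re_rho2 by (simp add: sum_nonneg)

lemma cmod_diff_le_Re_rho2:
  assumes "z \<in> TB e" "u \<in> TB e" "j \<noteq> e"
  shows "(cmod (z $ j - u $ j))\<^sup>2 \<le> 4 * Re (rho2 e z u)"
proof -
  have "(cmod (z $ j - u $ j))\<^sup>2 \<le> (\<Sum>j\<in>UNIV - {e}. (cmod (z $ j - u $ j))\<^sup>2)"
    using assms by (intro member_le_sum) auto
  moreover have "4 * Re (rho2 e z u) = (\<Sum>j\<in>UNIV - {e}. (cmod (z $ j - u $ j))\<^sup>2) + 2 * (rho1 e z + rho1 e u)"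
    by (simp add: Re_rho2)
  ultimately show ?thesis using assms by (simp add: TB_def)
qed

lemma Re_rho2_pos: "z \<in> TB e \<Longrightarrow> u \<in> TB e \<Longrightarrow> 0 < Re (rho2 e z u)"
  using rho1_sum_le_Re_rho2[of e z u] by (auto simp: TB_def)

lemma rho1_le_cmod_rho2:
  assumes "z \<in> TB e" "u \<in> TB e"
  shows "rho1 e z / 2 \<le> cmod (rho2 e z u)" "rho1 e u / 2 \<le> cmod (rho2 e z u)" "0 < cmod (rho2 e z u)"
  using rho1_sum_le_Re_rho2[of e z u] complex_Re_le_cmod[of "rho2 e z u"] assms
  by (auto simp: TB_def)

section \<open>Integration along a coordinate\<close>

lemma nn_integral_lborel_shift:
  fixes f :: "'a::euclidean_space \<Rightarrow> ennreal"
  assumes [measurable]: "f \<in> borel_measurable borel"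
  shows "(\<integral>\<^sup>+u. f (c + u) \<partial>lborel) = (\<integral>\<^sup>+u. f u \<partial>lborel)"
proof -
  have "(\<integral>\<^sup>+u. f u \<partial>lborel) = (\<integral>\<^sup>+u. f u \<partial>distr lborel borel ((+) c))"
    by (simp add: lborel_distr_plus)
  also have "\<dots> = (\<integral>\<^sup>+u. f (c + u) \<partial>lborel)"
    by (subst nn_integral_distr) auto
  finally show ?thesis by simp
qed

text \<open>Replaces a product decomposition of the space: insert 1 as the t-integral of the
  indicator of [0,1] at u.b - t, exchange the integrals and translate by t b. Line integrals are
  constant along b, so the strip 0 <= u.b <= 1 acts as the cross section orthogonal to b.\<close>

lemma nn_integral_lborel_along:
  fixes f :: "'a::euclidean_space \<Rightarrow> ennreal"
  assumes [measurable]: "f \<in> borel_measurable borel" and b: "b \<in> Basis"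
  shows "(\<integral>\<^sup>+u. f u \<partial>lborel) =
    (\<integral>\<^sup>+u. indicator {0..1::real} (u \<bullet> b) * (\<integral>\<^sup>+t. f (u + t *\<^sub>R b) \<partial>lborel) \<partial>lborel)"
proof -
  have one: "(\<integral>\<^sup>+t. indicator {0..1::real} (u \<bullet> b - t) \<partial>lborel) = 1" for u
  proof -
    have "(\<integral>\<^sup>+t. indicator {0..1::real} (u \<bullet> b - t) \<partial>lborel) = (\<integral>\<^sup>+t. indicator {u \<bullet> b - 1..u \<bullet> b} t \<partial>lborel)"
      by (intro nn_integral_cong) (auto simp: indicator_def)
    then show ?thesis by simp
  qed
  have "(\<integral>\<^sup>+u. f u \<partial>lborel) = (\<integral>\<^sup>+u. f u * (\<integral>\<^sup>+t. indicator {0..1::real} (u \<bullet> b - t) \<partial>lborel) \<partial>lborel)"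
    by (simp add: one)
  also have "\<dots> = (\<integral>\<^sup>+u. (\<integral>\<^sup>+t. f u * indicator {0..1::real} (u \<bullet> b - t) \<partial>lborel) \<partial>lborel)"
    by (intro nn_integral_cong nn_integral_cmult[symmetric]) measurable
  also have "\<dots> = (\<integral>\<^sup>+t. (\<integral>\<^sup>+u. f u * indicator {0..1::real} (u \<bullet> b - t) \<partial>lborel) \<partial>lborel)"
    by (intro lborel_pair.Fubini'[symmetric]) measurable
  also have "\<dots> = (\<integral>\<^sup>+t. (\<integral>\<^sup>+u. f (u + t *\<^sub>R b) * indicator {0..1::real} (u \<bullet> b) \<partial>lborel) \<partial>lborel)"
  proof (rule nn_integral_cong)
    fix t :: real
    have "(\<integral>\<^sup>+u. f u * indicator {0..1::real} (u \<bullet> b - t) \<partial>lborel) =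
       (\<integral>\<^sup>+u. f (t *\<^sub>R b + u) * indicator {0..1::real} ((t *\<^sub>R b + u) \<bullet> b - t) \<partial>lborel)"
      by (rule nn_integral_lborel_shift[symmetric]) measurable
    then show "(\<integral>\<^sup>+u. f u * indicator {0..1::real} (u \<bullet> b - t) \<partial>lborel) =
        (\<integral>\<^sup>+u. f (u + t *\<^sub>R b) * indicator {0..1::real} (u \<bullet> b) \<partial>lborel)"
      using b by (simp add: inner_add_left add.commute)
  qed
  also have "\<dots> = (\<integral>\<^sup>+u. (\<integral>\<^sup>+t. f (u + t *\<^sub>R b) * indicator {0..1::real} (u \<bullet> b) \<partial>lborel) \<partial>lborel)"
    by (intro lborel_pair.Fubini') measurable
  also have "\<dots> = (\<integral>\<^sup>+u. indicator {0..1::real} (u \<bullet> b) * (\<integral>\<^sup>+t. f (u + t *\<^sub>R b) \<partial>lborel) \<partial>lborel)"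
    by (intro nn_integral_cong) (simp add: nn_integral_multc mult.commute)
  finally show ?thesis .
qed

lemma Basis_complex_vec: "axis e \<i> \<in> (Basis :: (complex^'n) set)" "axis e 1 \<in> (Basis :: (complex^'n) set)"
  by (auto simp: Basis_vec_def Basis_complex_def)

lemma inner_axis_complex: "(u :: complex^'n) \<bullet> axis e \<i> = Im (u $ e)" "(u :: complex^'n) \<bullet> axis e 1 = Re (u $ e)"
  by (simp_all add: inner_axis inner_complex_def)

lemma rho1_add_axis: "rho1 e (u + t *\<^sub>R axis e \<i>) = rho1 e u + t"
proof -
  have "(\<Sum>j\<in>UNIV - {e}. (Im ((u + t *\<^sub>R axis e \<i>) $ j))\<^sup>2) = (\<Sum>j\<in>UNIV - {e}. (Im (u $ j))\<^sup>2)"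
    by (intro sum.cong refl) (auto simp: axis_def)
  then show ?thesis unfolding rho1_def by (simp add: axis_def)
qed

text \<open>Moving Im u_n by t moves \<open>rho1\<close> by t and leaves g unchanged, so
  \<open>rho1\<close> replaces Im u_n as coordinate on each fibre with Jacobian 1.\<close>

lemma nn_integral_rho1_fibre:
  fixes e :: "'n::finite"
  assumes [measurable]: "g \<in> borel_measurable borel" "h \<in> borel_measurable borel"
    and inv: "\<And>u t. g (u + t *\<^sub>R axis e \<i>) = g u"
  shows "(\<integral>\<^sup>+u. g u * h (rho1 e u) \<partial>lborel) =
    (\<integral>\<^sup>+u. indicator {0..1} (Im (u $ e)) * g u \<partial>lborel) * (\<integral>\<^sup>+t. h t \<partial>lborel)"
proof -
  have "(\<integral>\<^sup>+t. h (rho1 e u + t) \<partial>lborel) = (\<integral>\<^sup>+t. h t \<partial>lborel)" for u :: "complex^'n"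
    by (intro nn_integral_lborel_shift) measurable
  then have "(\<integral>\<^sup>+u. g u * h (rho1 e u) \<partial>lborel) =
     (\<integral>\<^sup>+u. (indicator {0..1} (Im (u $ e)) * g u) * (\<integral>\<^sup>+t. h t \<partial>lborel) \<partial>lborel)"
    by (subst nn_integral_lborel_along[OF _ Basis_complex_vec(1)[of e]])
      (auto simp: inv rho1_add_axis inner_axis_complex nn_integral_cmult mult.assoc)
  also have "\<dots> = (\<integral>\<^sup>+u. indicator {0..1} (Im (u $ e)) * g u \<partial>lborel) * (\<integral>\<^sup>+t. h t \<partial>lborel)"
    by (intro nn_integral_multc) measurable
  finally show ?thesis .
qed

lemma mem_cbox_complex_vec:
  "(x :: complex^'n) \<in> cbox l u \<longleftrightarrow>
    (\<forall>j. Re (l $ j) \<le> Re (x $ j) \<and> Re (x $ j) \<le> Re (u $ j) \<and> Im (l $ j) \<le> Im (x $ j) \<and> Im (x $ j) \<le> Im (u $ j))"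
  by (auto simp: mem_box Basis_vec_def Basis_complex_def inner_axis_complex)

lemma emeasure_cbox_complex_vec:
  fixes l u :: "complex^'n"
  assumes "\<And>j. Re (l $ j) \<le> Re (u $ j)" "\<And>j. Im (l $ j) \<le> Im (u $ j)"
  shows "emeasure lborel (cbox l u) =
    ennreal (\<Prod>j\<in>UNIV. (Re (u $ j) - Re (l $ j)) * (Im (u $ j) - Im (l $ j)))"
proof -
  have B: "(Basis :: (complex^'n) set) = (\<lambda>(j, k). axis j k) ` (UNIV \<times> {1, \<i>})"
    by (auto simp: Basis_vec_def Basis_complex_def)
  have inj: "inj_on (\<lambda>(j, k). axis j k :: complex^'n) (UNIV \<times> {1, \<i>})"
    by (auto simp: inj_on_def axis_eq_axis)
  have "emeasure lborel (cbox l u) = ennreal (\<Prod>b\<in>Basis. (u - l) \<bullet> b)"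
    using assms by (intro emeasure_lborel_cbox) (auto simp: Basis_vec_def Basis_complex_def inner_axis_complex)
  also have "(\<Prod>b\<in>Basis. (u - l) \<bullet> b) = (\<Prod>j\<in>UNIV. \<Prod>k\<in>{1, \<i>}. (u - l) \<bullet> axis j k)"
    unfolding B prod.reindex[OF inj] prod.cartesian_product
    by (simp add: case_prod_unfold)
  also have "\<dots> = (\<Prod>j\<in>UNIV. (Re (u $ j) - Re (l $ j)) * (Im (u $ j) - Im (l $ j)))"
    by (intro prod.cong refl) (simp add: inner_axis_complex inner_diff_left complex_eq_iff)
  finally show ?thesis .
qed

section \<open>One-dimensional integrals\<close>

lemma nn_integral_powr_interval:
  assumes "-1 < t" "0 \<le> R"
  shows "(\<integral>\<^sup>+r. indicator {0..R} r * ennreal (r powr t) \<partial>lborel) = ennreal (R powr (t + 1) / (t + 1))"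
  using nn_integral_has_integral_lebesgue'[OF _ has_integral_powr_from_0[OF assms]]
  by (simp add: mult.commute)

text \<open>Substitution y = -ln r. G = ln will show divergence for s = 1, a power convergence for s
  > 1; the endpoint exp(-1) keeps -ln r at least 1.\<close>

lemma nn_integral_inverse_ln_powr:
  fixes s :: real
  assumes "0 < d" "d \<le> exp (-1)"
    and G: "\<And>y. 1 \<le> y \<Longrightarrow> (G has_real_derivative y powr (-s)) (at y)"
  shows "(\<integral>\<^sup>+r. indicator {d..exp (-1)} r * ennreal (inverse r * (- ln r) powr (-s)) \<partial>lborel) =
     ennreal (G (- ln d) - G 1)"
proof -
  have "(\<integral>\<^sup>+r. ennreal (inverse r * (- ln r) powr (-s)) * indicator {d..exp (-1)} r \<partial>lborel) =
     - G (- ln (exp (-1))) - - G (- ln d)"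
  proof (rule nn_integral_FTC_Icc)
    fix x assume x: "x \<in> {d..exp (-1)}"
    then have "0 < x" using assms by auto
    then have "ln x \<le> -1" using x by (metis atLeastAtMost_iff ln_exp ln_mono)
    have "((\<lambda>x. G (- ln x)) has_real_derivative (- ln x) powr - s * (- inverse x)) (at x)"
      using \<open>0 < x\<close> \<open>ln x \<le> -1\<close>
      by (intro DERIV_chain2[where f = G and g = "\<lambda>x. - ln x"] G)
        (auto intro!: derivative_eq_intros simp: inverse_eq_divide)
    from DERIV_minus[OF this]
    show "((\<lambda>x. - G (- ln x)) has_real_derivative inverse x * (- ln x) powr - s) (at x)"
      by (simp add: mult.commute)
    show "0 \<le> inverse x * (- ln x) powr - s" using \<open>0 < x\<close> by simp
  qed (use assms in auto)
  then show ?thesis by (simp add: mult.commute)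
qed

lemma ennreal_top_unique_nat:
  assumes "\<And>k::nat. ennreal (real k) \<le> x"
  shows "x = top"
proof (rule ccontr)
  assume "x \<noteq> top"
  then obtain r where r: "x = ennreal r" "0 \<le> r" by (metis ennreal_cases)
  obtain k :: nat where "r < real k" using reals_Archimedean2 by blast
  then show False using assms[of k] r by simp
qed

lemma nn_integral_inverse_ln_top:
  "(\<integral>\<^sup>+r. indicator {0<..exp (-1)} r * ennreal (inverse r * (- ln r) powr (-1)) \<partial>lborel) = top"
proof -
  have "ennreal (real k) \<le> (\<integral>\<^sup>+r. indicator {0<..exp (-1)} r * ennreal (inverse r * (- ln r) powr (-1)) \<partial>lborel)" for k
  proof -
    \<comment> \<open>Doubly exponential, so that ln (- ln d) = k.\<close>
    define d where "d = exp (- exp (real k))"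
    have d: "0 < d" "d \<le> exp (-1)" by (simp_all add: d_def)
    have "ennreal (real k) = ennreal (ln (- ln d) - ln 1)" by (simp add: d_def)
    also have "\<dots> = (\<integral>\<^sup>+r. indicator {d..exp (-1)} r * ennreal (inverse r * (- ln r) powr (-1)) \<partial>lborel)"
      using d by (intro nn_integral_inverse_ln_powr[symmetric])
        (auto intro!: derivative_eq_intros simp: powr_minus field_simps)
    also have "\<dots> \<le> (\<integral>\<^sup>+r. indicator {0<..exp (-1)} r * ennreal (inverse r * (- ln r) powr (-1)) \<partial>lborel)"
      using d by (intro nn_integral_mono mult_right_mono) (auto simp: indicator_def)
    finally show ?thesis .
  qed
  then show ?thesis
    by (intro ennreal_top_unique_nat)
qed

lemma nn_integral_inverse_ln_powr_finite:
  assumes "1 < p"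
  shows "(\<integral>\<^sup>+r. indicator {0<..exp (-1)} r * ennreal (inverse r * (- ln r) powr (-p)) \<partial>lborel) < top"
proof -
  let ?h = "\<lambda>r. ennreal (inverse r * (- ln r) powr (-p))"
  define A where "A k = {exp (- (1 + real k))..exp (-1)}" for k
  have A: "incseq A"
    by (auto simp: incseq_def A_def elim!: order_trans[rotated])
  have U: "(\<Union>k. A k) = {0<..exp (-1)}"
  proof (intro equalityI subsetI)
    fix r :: real assume r: "r \<in> {0<..exp (-1)}"
    obtain k where "- ln r \<le> real k" using real_arch_simple by blast
    then have "exp (- (1 + real k)) \<le> exp (ln r)" by (subst exp_le_cancel_iff) simp
    also have "exp (ln r) = r" using r by simp
    finally have "r \<in> A k" using r by (simp add: A_def)
    then show "r \<in> (\<Union>k. A k)" by blast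
  next
    fix r assume "r \<in> (\<Union>k. A k)"
    then show "r \<in> {0<..exp (-1)}"
      by (auto simp: A_def intro: less_le_trans[OF exp_gt_zero])
  qed
  have "(\<integral>\<^sup>+r. indicator {0<..exp (-1)} r * ?h r \<partial>lborel) = emeasure (density lborel ?h) (\<Union>k. A k)"
    unfolding U by (subst emeasure_density) (auto simp: mult.commute)
  also have "\<dots> = (SUP k. emeasure (density lborel ?h) (A k))"
    by (intro SUP_emeasure_incseq[symmetric] A) (auto simp: A_def)
  also have "\<dots> \<le> ennreal (1 / (p - 1))"
  proof (rule SUP_least)
    fix k
    have "emeasure (density lborel ?h) (A k) = (\<integral>\<^sup>+r. indicator {exp (- (1 + real k))..exp (-1)} r * ?h r \<partial>lborel)"
      by (subst emeasure_density) (auto simp: A_def mult.commute)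
    also have "\<dots> = ennreal ((- ln (exp (- (1 + real k)))) powr (1 - p) / (1 - p) - 1 powr (1 - p) / (1 - p))"
    proof (rule nn_integral_inverse_ln_powr[where G = "\<lambda>y. y powr (1 - p) / (1 - p)"])
      fix y :: real assume "1 \<le> y"
      then have "((\<lambda>y. y powr (1 - p)) has_real_derivative (1 - p) * y powr (1 - p - 1)) (at y)"
        by (intro has_real_derivative_powr) auto
      from DERIV_cdivide[OF this, of "1 - p"]
      show "((\<lambda>y. y powr (1 - p) / (1 - p)) has_real_derivative y powr - p) (at y)"
        using assms by simp
    qed auto
    also have "\<dots> \<le> ennreal (1 / (p - 1))"
    proof (rule ennreal_leI)
      have "(- ln (exp (- (1 + real k)))) powr (1 - p) / (1 - p) \<le> 0"
        using assms by (intro divide_nonneg_neg) auto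
      moreover have "- (1 powr (1 - p) / (1 - p)) = 1 / (p - 1)"
        using assms by (simp add: field_simps)
      ultimately show "(- ln (exp (- (1 + real k)))) powr (1 - p) / (1 - p) - 1 powr (1 - p) / (1 - p) \<le> 1 / (p - 1)"
        by linarith
    qed
    finally show "emeasure (density lborel ?h) (A k) \<le> ennreal (1 / (p - 1))" .
  qed
  finally show ?thesis by (simp add: le_less_trans)
qed

section \<open>Volumes of anisotropic boxes\<close>

lemma prod_UNIV_if:
  fixes e :: "'n::finite" and A B :: real
  shows "(\<Prod>j\<in>UNIV. if j = e then A else B) = A * B ^ (CARD('n) - 1)"
proof -
  have "(\<Prod>j\<in>UNIV. if j = e then A else B) = A * (\<Prod>j\<in>UNIV - {e}. if j = e then A else B)"
    by (subst prod.remove[of UNIV e]) auto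
  also have "(\<Prod>j\<in>UNIV - {e}. if j = e then A else B) = (\<Prod>j\<in>UNIV - {e}. B)"
    by (intro prod.cong) auto
  finally show ?thesis by simp
qed

text \<open>Im u_n is left free because \<open>rho1\<close> takes its place as a coordinate; the
  remaining coordinates are merely kept bounded.\<close>

definition slab :: "'n::finite \<Rightarrow> (complex^'n) set" where
  "slab e = {u. \<forall>j. \<bar>Re (u $ j)\<bar> \<le> 1 \<and> (j \<noteq> e \<longrightarrow> \<bar>Im (u $ j)\<bar> \<le> 1)}"

lemma slab_measurable [measurable]: "slab e \<in> sets borel"
  unfolding slab_def by measurable

lemma nn_integral_slab:
  fixes e :: "'n::finite"
  obtains V where "0 < V"
    "\<And>h. h \<in> borel_measurable borel \<Longrightarrow>
      (\<integral>\<^sup>+u. indicator (slab e) u * h (rho1 e u) \<partial>lborel) = ennreal V * (\<integral>\<^sup>+r. h r \<partial>lborel)"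
proof
  define l u :: "complex^'n" where "l = (\<chi> j. Complex (-1) (if j = e then 0 else -1))" and "u = (\<chi> j. Complex 1 1)"
  define V :: real where "V = 2 * 4 ^ (CARD('n) - 1)"
  show "0 < V" by (simp add: V_def)
  fix h :: "real \<Rightarrow> ennreal" assume [measurable]: "h \<in> borel_measurable borel"
  have "(\<integral>\<^sup>+u. indicator (slab e) u * h (rho1 e u) \<partial>lborel) =
      (\<integral>\<^sup>+u. indicator {0..1} (Im (u $ e)) * indicator (slab e) u \<partial>lborel) * (\<integral>\<^sup>+r. h r \<partial>lborel)"
    by (rule nn_integral_rho1_fibre) (auto simp: slab_def indicator_def axis_def)
  also have "(\<integral>\<^sup>+u. indicator {0..1} (Im (u $ e)) * indicator (slab e) u \<partial>lborel) = (\<integral>\<^sup>+x. indicator (cbox l u) x \<partial>lborel)"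
    by (intro nn_integral_cong)
      (auto simp: indicator_def slab_def mem_cbox_complex_vec l_def u_def abs_le_iff split: if_splits)
  also have "\<dots> = ennreal (\<Prod>j\<in>UNIV. (Re (u $ j) - Re (l $ j)) * (Im (u $ j) - Im (l $ j)))"
    by (simp add: emeasure_cbox_complex_vec l_def u_def)
  also have "(\<Prod>j\<in>UNIV. (Re (u $ j) - Re (l $ j)) * (Im (u $ j) - Im (l $ j))) = (\<Prod>j\<in>UNIV. if j = e then 2 else 4)"
    by (intro prod.cong) (auto simp: l_def u_def)
  finally show "(\<integral>\<^sup>+u. indicator (slab e) u * h (rho1 e u) \<partial>lborel) = ennreal V * (\<integral>\<^sup>+r. h r \<partial>lborel)"
    by (simp add: prod_UNIV_if V_def)
qed

section \<open>The Forelli--Rudin estimate\<close>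

text \<open>The sublevel set lies in a sheared anisotropic box: u_j is within 2 sqrt R of z_j by the
  real part of rho(z,u), Re u_n is within 2R of a function of u' by the imaginary part, and 0 <=
  rho(u) <= 2R. The factors 16R for each of n-1 coordinates, 4R, and the integral of r^t over [0,2R]
  multiply to a constant times R^(n+1+t).\<close>

lemma nn_integral_rho1_sublevel:
  fixes e :: "'n::finite"
  assumes t: "-1 < t"
  obtains C where "0 < C"
    "\<And>z R. z \<in> TB e \<Longrightarrow> 0 < R \<Longrightarrow>
      (\<integral>\<^sup>+u. indicator {u \<in> TB e. cmod (rho2 e z u) < R} u * ennreal (rho1 e u powr t) \<partial>lborel)
        \<le> ennreal (C * R powr (real CARD('n) + 1 + t))"
proof
  define N where "N = CARD('n) - 1"
  have N: "real CARD('n) = real N + 1" using zero_less_card_finite[where 'a = 'n] by (simp add: N_def)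
  define C where "C = 16 ^ N * 4 * (2 powr (t + 1) / (t + 1))"
  show "0 < C" using t by (simp add: C_def)
  fix z :: "complex^'n" and R :: real assume z: "z \<in> TB e" and R: "0 < R"
  define B where "B = {u :: complex^'n. \<forall>j. j \<noteq> e \<longrightarrow>
    \<bar>Re (u $ j) - Re (z $ j)\<bar> \<le> 2 * sqrt R \<and> \<bar>Im (u $ j) - Im (z $ j)\<bar> \<le> 2 * sqrt R}"
  \<comment> \<open>Chosen so that 2 Im rho(z,u) = Re u_n - G u. It depends on u' only, so
    integrating along Re u_n straightens the box.\<close>
  define G where "G u = Re (z $ e) - (\<Sum>j\<in>UNIV - {e}. (Re (z $ j) - Re (u $ j)) * (Im (z $ j) + Im (u $ j)))" for u :: "complex^'n"
  define h where "h r = indicator {0..2*R} r * ennreal (r powr t)" for r :: real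
  have [measurable]: "B \<in> sets borel" "G \<in> borel_measurable borel" "h \<in> borel_measurable borel"
    unfolding B_def G_def h_def by measurable
  have Ginv: "G (u + s *\<^sub>R axis e c) = G u" for u s c
    unfolding G_def by (intro arg_cong2[where f = "(-)"] refl sum.cong) (auto simp: axis_def)
  have Binv: "u + s *\<^sub>R axis e c \<in> B \<longleftrightarrow> u \<in> B" for u s c
    unfolding B_def by (auto simp: axis_def)
  have ax: "(u + s *\<^sub>R axis e c) $ e = u $ e + s *\<^sub>R c" for u :: "complex^'n" and s c
    by (simp add: axis_def)
  have pt: "u \<in> B \<and> \<bar>Re (u $ e) - G u\<bar> \<le> 2 * R \<and> rho1 e u \<in> {0..2*R}"
    if u: "u \<in> TB e" "cmod (rho2 e z u) < R" for u
  proof (intro conjI)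
    show "u \<in> B" unfolding B_def
    proof (clarify, intro conjI)
      fix j assume "j \<noteq> e"
      then have "(cmod (z $ j - u $ j))\<^sup>2 \<le> 4 * R"
        using cmod_diff_le_Re_rho2[OF z u(1)] complex_Re_le_cmod[of "rho2 e z u"] u(2) by fastforce
      then have "cmod (u $ j - z $ j) \<le> 2 * sqrt R"
        by (metis norm_minus_commute real_le_rsqrt real_sqrt_four real_sqrt_mult)
      then show "\<bar>Re (u $ j) - Re (z $ j)\<bar> \<le> 2 * sqrt R" "\<bar>Im (u $ j) - Im (z $ j)\<bar> \<le> 2 * sqrt R"
        using abs_Re_le_cmod[of "u $ j - z $ j"] abs_Im_le_cmod[of "u $ j - z $ j"] by auto
    qed
    have "2 * Im (rho2 e z u) = Re (u $ e) - G u" by (simp add: Im_rho2 G_def)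
    then show "\<bar>Re (u $ e) - G u\<bar> \<le> 2 * R"
      using abs_Im_le_cmod[of "rho2 e z u"] u(2) by linarith
    show "rho1 e u \<in> {0..2*R}"
      using rho1_le_cmod_rho2[OF z u(1)] u by (auto simp: TB_def)
  qed
  define g where "g u = indicator B u * (indicator {-2*R..2*R} (Re (u $ e) - G u) :: ennreal)" for u
  have [measurable]: "g \<in> borel_measurable borel" unfolding g_def by measurable
  have "(\<integral>\<^sup>+u. indicator {u \<in> TB e. cmod (rho2 e z u) < R} u * ennreal (rho1 e u powr t) \<partial>lborel)
     \<le> (\<integral>\<^sup>+u. g u * h (rho1 e u) \<partial>lborel)"
    by (intro nn_integral_mono) (use pt in \<open>force simp: indicator_def g_def h_def\<close>)
  also have "\<dots> = (\<integral>\<^sup>+u. indicator {0..1} (Im (u $ e)) * g u \<partial>lborel) * (\<integral>\<^sup>+r. h r \<partial>lborel)"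
    by (rule nn_integral_rho1_fibre) (auto simp: g_def Ginv Binv indicator_def ax)
  also have "(\<integral>\<^sup>+r. h r \<partial>lborel) = ennreal ((2 * R) powr (t + 1) / (t + 1))"
    unfolding h_def using t R by (intro nn_integral_powr_interval) auto
  also have "(\<integral>\<^sup>+u. indicator {0..1} (Im (u $ e)) * g u \<partial>lborel) =
     (\<integral>\<^sup>+u. indicator {0..1} (Re (u $ e)) * (\<integral>\<^sup>+s. (indicator {0..1} (Im (u $ e)) * indicator B u)
        * indicator {-2*R..2*R} ((Re (u $ e) - G u) + s) \<partial>lborel) \<partial>lborel)"
    by (subst nn_integral_lborel_along[OF _ Basis_complex_vec(2)[of e]])
      (auto intro!: nn_integral_cong simp: g_def inner_axis_complex Ginv Binv indicator_def ax)
  also have "\<dots> = (\<integral>\<^sup>+u. (indicator {0..1} (Re (u $ e)) * (indicator {0..1} (Im (u $ e)) * indicator B u)) * ennreal (4 * R) \<partial>lborel)"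
  proof -
    have "(\<integral>\<^sup>+s. indicator {-2*R..2*R} (c + s) \<partial>lborel) = ennreal (4 * R)" for c
      using nn_integral_lborel_shift[of "indicator {-2*R..2*R}" c] R by simp
    then show ?thesis
      by (intro nn_integral_cong) (simp add: nn_integral_cmult mult.assoc)
  qed
  also have "\<dots> = (\<integral>\<^sup>+u. indicator {0..1} (Re (u $ e)) * (indicator {0..1} (Im (u $ e)) * indicator B u) \<partial>lborel) * ennreal (4 * R)"
    by (intro nn_integral_multc) measurable
  also have "(\<integral>\<^sup>+u. indicator {0..1} (Re (u $ e)) * (indicator {0..1} (Im (u $ e)) * indicator B u) \<partial>lborel) = ennreal ((16 * R) ^ N)"
  proof -
    define l u :: "complex^'n"
      where "l = (\<chi> j. if j = e then 0 else z $ j - Complex (2 * sqrt R) (2 * sqrt R))"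
        and "u = (\<chi> j. if j = e then Complex 1 1 else z $ j + Complex (2 * sqrt R) (2 * sqrt R))"
    have "(\<integral>\<^sup>+u. indicator {0..1} (Re (u $ e)) * (indicator {0..1} (Im (u $ e)) * indicator B u) \<partial>lborel) = (\<integral>\<^sup>+x. indicator (cbox l u) x \<partial>lborel)"
      by (intro nn_integral_cong)
        (auto simp: indicator_def B_def mem_cbox_complex_vec l_def u_def abs_le_iff algebra_simps split: if_splits)
    also have "\<dots> = ennreal (\<Prod>j\<in>UNIV. (Re (u $ j) - Re (l $ j)) * (Im (u $ j) - Im (l $ j)))"
      using R by (simp add: emeasure_cbox_complex_vec l_def u_def)
    also have "(\<Prod>j\<in>UNIV. (Re (u $ j) - Re (l $ j)) * (Im (u $ j) - Im (l $ j))) = (\<Prod>j\<in>UNIV. if j = e then 1 else 16 * R)"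
      using R by (intro prod.cong) (auto simp: l_def u_def)
    finally show ?thesis by (simp add: prod_UNIV_if N_def)
  qed
  also have "ennreal ((16 * R) ^ N) * ennreal (4 * R) * ennreal ((2 * R) powr (t + 1) / (t + 1)) =
      ennreal (C * R powr (real CARD('n) + 1 + t))"
  proof -
    have "R powr (real CARD('n) + 1 + t) = R powr (real N + 1 + (t + 1))" by (simp add: N algebra_simps)
    also have "\<dots> = R ^ N * R * R powr (t + 1)"
      using R by (simp add: powr_add powr_realpow power2_eq_square)
    finally show ?thesis
      using R t by (simp add: C_def powr_mult power_mult_distrib power2_eq_square flip: ennreal_mult)
  qed
  finally show "(\<integral>\<^sup>+u. indicator {u \<in> TB e. cmod (rho2 e z u) < R} u * ennreal (rho1 e u powr t) \<partial>lborel)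
        \<le> ennreal (C * R powr (real CARD('n) + 1 + t))" .
qed

lemma dyadic_shell:
  fixes x m :: real
  assumes "0 < m" "m \<le> x"
  obtains k :: nat where "2 ^ k * m \<le> x" "x < 2 ^ Suc k * m"
proof -
  define k where "k = nat \<lfloor>log 2 (x / m)\<rfloor>"
  have nn: "0 \<le> log 2 (x / m)" using assms by simp
  have "real k \<le> log 2 (x / m)" "log 2 (x / m) < real k + 1"
    using nn by (auto simp: k_def)
  then have "2 powr real k \<le> x / m" "x / m < 2 powr real (Suc k)"
    using assms by (auto simp: le_log_iff log_less_iff add.commute)
  then show ?thesis
    using assms by (intro that[of k]) (auto simp: powr_add powr_realpow field_simps)
qed

theorem Forelli_Rudin:
  fixes e :: "'n::finite"
  assumes t: "-1 < t" and s: "real CARD('n) + 1 + t < s"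
  obtains C where "0 < C"
    "\<And>z. z \<in> TB e \<Longrightarrow>
      (\<integral>\<^sup>+u. indicator (TB e) u * ennreal (rho1 e u powr t * cmod (rho2 e z u) powr (-s)) \<partial>lborel)
        \<le> ennreal (C * rho1 e z powr (real CARD('n) + 1 + t - s))"
proof -
  define N where "N = real CARD('n) + 1 + t"
  have N: "0 < N" "N < s" using t s by (auto simp: N_def)
  obtain D where D: "0 < D" "\<And>z R. z \<in> TB e \<Longrightarrow> 0 < R \<Longrightarrow>
      (\<integral>\<^sup>+u. indicator {u \<in> TB e. cmod (rho2 e z u) < R} u * ennreal (rho1 e u powr t) \<partial>lborel)
        \<le> ennreal (D * R powr N)"
    using nn_integral_rho1_sublevel[OF t] unfolding N_def by blast
  \<comment> \<open>Ratio of the geometric series over the dyadic scales; it is below 1 because s >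
    n+1+t.\<close>
  define q where "q = 2 powr (N - s)"
  have q: "0 < q" "q < 1" using N by (auto simp: q_def intro: powr_less_one)
  define C where "C = D * 2 powr N * (1/2) powr (N - s) / (1 - q)"
  show ?thesis
  proof (rule that)
    show "0 < C" using D q by (simp add: C_def)
    fix z assume z: "z \<in> TB e"
    \<comment> \<open>A lower bound for |rho(z,u)| over all u in \<open>TB\<close>, hence the
      smallest scale; it produces the power of rho(z) in the result.\<close>
    define m where "m = rho1 e z / 2"
    have m: "0 < m" using z by (simp add: m_def TB_def)
    let ?I = "\<lambda>k. indicator {u \<in> TB e. cmod (rho2 e z u) < 2 ^ Suc k * m} :: _ \<Rightarrow> ennreal"
    have pt: "indicator (TB e) u * ennreal (rho1 e u powr t * cmod (rho2 e z u) powr (-s)) \<le>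
        (\<Sum>k. ennreal ((2 ^ k * m) powr (-s)) * (?I k u * ennreal (rho1 e u powr t)))" for u
    proof (cases "u \<in> TB e")
      case True
      obtain k where k: "2 ^ k * m \<le> cmod (rho2 e z u)" "cmod (rho2 e z u) < 2 ^ Suc k * m"
        using dyadic_shell[OF m] rho1_le_cmod_rho2(1)[OF z True] unfolding m_def by blast
      have "cmod (rho2 e z u) powr (-s) \<le> (2 ^ k * m) powr (-s)"
        using k m N by (intro powr_mono2') auto
      then have "indicator (TB e) u * ennreal (rho1 e u powr t * cmod (rho2 e z u) powr (-s)) \<le>
         ennreal ((2 ^ k * m) powr (-s)) * (?I k u * ennreal (rho1 e u powr t))"
        using True k by (simp add: mult.commute mult_left_mono ennreal_leI flip: ennreal_mult)
      also have "\<dots> \<le> (\<Sum>k. ennreal ((2 ^ k * m) powr (-s)) * (?I k u * ennreal (rho1 e u powr t)))"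
        using sum_le_suminf[OF summableI, of "{k}" "\<lambda>k. ennreal ((2 ^ k * m) powr (-s)) * (?I k u * ennreal (rho1 e u powr t))"] by simp
      finally show ?thesis .
    qed simp
    have "(\<integral>\<^sup>+u. indicator (TB e) u * ennreal (rho1 e u powr t * cmod (rho2 e z u) powr (-s)) \<partial>lborel)
      \<le> (\<integral>\<^sup>+u. (\<Sum>k. ennreal ((2 ^ k * m) powr (-s)) * (?I k u * ennreal (rho1 e u powr t))) \<partial>lborel)"
      by (intro nn_integral_mono pt)
    also have "\<dots> = (\<Sum>k. ennreal ((2 ^ k * m) powr (-s)) * (\<integral>\<^sup>+u. ?I k u * ennreal (rho1 e u powr t) \<partial>lborel))"
      by (subst nn_integral_suminf) (auto simp: nn_integral_cmult)
    also have "\<dots> \<le> (\<Sum>k. ennreal ((2 ^ k * m) powr (-s)) * ennreal (D * (2 ^ Suc k * m) powr N))"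
      using m z by (intro suminf_le summableI mult_left_mono D) auto
    also have "\<dots> = (\<Sum>k. ennreal (D * 2 powr N * m powr (N - s) * q ^ k))"
    proof (intro suminf_cong)
      fix k :: nat
      have "q ^ k = (2 ^ k) powr (N - s)"
        by (simp add: q_def powr_power flip: powr_realpow) (simp add: powr_powr mult.commute)
      then have "(2 ^ k * m) powr (-s) * (D * (2 ^ Suc k * m) powr N) = D * 2 powr N * m powr (N - s) * q ^ k"
        using m by (simp add: powr_mult powr_diff powr_minus field_simps)
      then show "ennreal ((2 ^ k * m) powr (-s)) * ennreal (D * (2 ^ Suc k * m) powr N) = ennreal (D * 2 powr N * m powr (N - s) * q ^ k)"
        using D by (simp only: ennreal_mult[symmetric] mult_nonneg_nonneg less_imp_le powr_ge_zero)
    qed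
    also have "\<dots> = ennreal (\<Sum>k. D * 2 powr N * m powr (N - s) * q ^ k)"
      using D q by (intro suminf_ennreal2 summable_mult summable_geometric) auto
    also have "(\<Sum>k. D * 2 powr N * m powr (N - s) * q ^ k) = D * 2 powr N * m powr (N - s) * (1 / (1 - q))"
      using q by (subst suminf_mult) (auto intro: summable_geometric simp: suminf_geometric)
    also have "\<dots> = C * rho1 e z powr (N - s)"
      using z by (simp add: C_def m_def powr_divide powr_one_eq_one TB_def field_simps)
    finally show "(\<integral>\<^sup>+u. indicator (TB e) u * ennreal (rho1 e u powr t * cmod (rho2 e z u) powr (-s)) \<partial>lborel)
        \<le> ennreal (C * rho1 e z powr (real CARD('n) + 1 + t - s))"
      by (simp add: N_def)
  qed
qed

section \<open>Weighted measures and positive kernels\<close>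

text \<open>The measure dV_alpha, extended by zero to the whole space and based on
  \<open>lborel\<close>: domains disappear from the estimates and Tonelli applies to Borel
  functions.\<close>

definition wmeas :: "'n::finite \<Rightarrow> real \<Rightarrow> (complex^'n) measure" where
  "wmeas e al = density lborel (\<lambda>z. indicator (TB e) z * ennreal (rho1 e z powr al))"

lemma sets_wmeas [measurable_cong, simp]: "sets (wmeas e al) = sets borel"
  by (simp add: wmeas_def)

lemma space_wmeas [simp]: "space (wmeas e al) = UNIV"
  by (simp add: wmeas_def)

lemma sigma_finite_wmeas: "sigma_finite_measure (wmeas e al)"
  unfolding wmeas_def
  by (subst sigma_finite_measure.sigma_finite_iff_density_finite[OF sigma_finite_lborel]) (auto simp: indicator_def)

lemma nn_integral_wmeas:
  assumes [measurable]: "f \<in> borel_measurable borel"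
  shows "(\<integral>\<^sup>+z. f z \<partial>wmeas e al) = (\<integral>\<^sup>+z. indicator (TB e) z * ennreal (rho1 e z powr al) * f z \<partial>lborel)"
  unfolding wmeas_def by (subst nn_integral_density) auto

lemma AE_wmeas_iff: "(AE z in wmeas e al. P z) \<longleftrightarrow> (AE z in lborel. z \<in> TB e \<longrightarrow> P z)"
  unfolding wmeas_def by (subst AE_density) (auto simp: indicator_def TB_def intro!: AE_cong)

text \<open>The outer weight and both domains are built in, so that S becomes an iterated integral
  over the whole space and the power of rho(z) can be shared out in the Hoelder splitting.\<close>

definition Pker :: "'n::finite \<Rightarrow> real \<Rightarrow> real \<Rightarrow> real \<Rightarrow> complex^'n \<Rightarrow> complex^'n \<Rightarrow> ennreal" where
  "Pker e a b c z u = indicator (TB e) z * indicator (TB e) u *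
     ennreal (rho1 e z powr a * rho1 e u powr b * cmod (rho2 e z u) powr (-c))"

lemma Pker_measurable [measurable]:
  assumes [measurable]: "f \<in> borel_measurable M" "g \<in> borel_measurable M"
  shows "(\<lambda>x. Pker e a b c (f x) (g x)) \<in> borel_measurable M"
  unfolding Pker_def by measurable

lemma nn_integral_epow_Pker:
  assumes "u \<in> TB e"
  shows "(\<integral>\<^sup>+z. epow (Pker e a b c z u) q \<partial>wmeas e be) = ennreal (rho1 e u powr (b * q)) *
    (\<integral>\<^sup>+z. indicator (TB e) z * ennreal (rho1 e z powr (q * a + be) * cmod (rho2 e u z) powr (- (c * q))) \<partial>lborel)"
proof -
  have "(\<integral>\<^sup>+z. epow (Pker e a b c z u) q \<partial>wmeas e be) =
     (\<integral>\<^sup>+z. ennreal (rho1 e u powr (b * q)) * (indicator (TB e) z * ennreal (rho1 e z powr (q * a + be) * cmod (rho2 e u z) powr (- (c * q)))) \<partial>lborel)"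
    using assms
    by (subst nn_integral_wmeas) (auto intro!: nn_integral_cong simp: Pker_def epow_ennreal indicator_def powr_mult powr_powr powr_add
          cmod_rho2_commute[of e _ u] mult_ac simp flip: ennreal_mult)
  also have "\<dots> = ennreal (rho1 e u powr (b * q)) *
      (\<integral>\<^sup>+z. indicator (TB e) z * ennreal (rho1 e z powr (q * a + be) * cmod (rho2 e u z) powr (- (c * q))) \<partial>lborel)"
    by (intro nn_integral_cmult) measurable
  finally show ?thesis .
qed

text \<open>Forelli-Rudin in the first argument, by symmetry of |rho(z,u)|, with weight exponent q a
  + be and kernel exponent c q. Combined with Minkowski it is the whole one-variable bound out of
  L^1, and it is the second half of the Schur test.\<close>

lemma Lnorm_Pker:
  fixes e :: "'n::finite"
  assumes q: "0 < q" and t: "-1 < q * a + be" and s: "real CARD('n) + 1 + (q * a + be) < c * q"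
  obtains C where "0 < C"
    "\<And>u. Lnorm (wmeas e be) q (\<lambda>z. Pker e a b c z u) \<le>
       indicator (TB e) u * ennreal (C * rho1 e u powr (a + b - c + (real CARD('n) + 1 + be) / q))"
proof -
  obtain D where D: "0 < D" "\<And>u. u \<in> TB e \<Longrightarrow>
      (\<integral>\<^sup>+z. indicator (TB e) z * ennreal (rho1 e z powr (q * a + be) * cmod (rho2 e u z) powr (- (c * q))) \<partial>lborel)
        \<le> ennreal (D * rho1 e u powr (real CARD('n) + 1 + (q * a + be) - c * q))"
    using Forelli_Rudin[OF t s] by blast
  show ?thesis
  proof (rule that)
    show "0 < D powr (1 / q)" using D by simp
    fix u
    show "Lnorm (wmeas e be) q (\<lambda>z. Pker e a b c z u) \<le>
       indicator (TB e) u * ennreal (D powr (1 / q) * rho1 e u powr (a + b - c + (real CARD('n) + 1 + be) / q))"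
    proof (cases "u \<in> TB e")
      case True
      then have u: "0 < rho1 e u" by (simp add: TB_def)
      have "(\<integral>\<^sup>+z. epow (Pker e a b c z u) q \<partial>wmeas e be) =
          ennreal (rho1 e u powr (b * q)) * (\<integral>\<^sup>+z. (indicator (TB e) z * ennreal (rho1 e z powr (q * a + be) * cmod (rho2 e u z) powr (- (c * q)))) \<partial>lborel)"
        by (rule nn_integral_epow_Pker[OF True])
      also have "\<dots> \<le> ennreal (rho1 e u powr (b * q)) * ennreal (D * rho1 e u powr (real CARD('n) + 1 + (q * a + be) - c * q))"
        using True by (intro mult_left_mono D) auto
      also have "\<dots> = ennreal (D * rho1 e u powr ((a + b - c + (real CARD('n) + 1 + be) / q) * q))"
      proof -
        have "(a + b - c + (real CARD('n) + 1 + be) / q) * q = b * q + (real CARD('n) + 1 + (q * a + be) - c * q)"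
          using q by (simp add: field_simps)
        then show ?thesis
          using D by (simp add: powr_add mult_ac flip: ennreal_mult)
      qed
      finally have "Lnorm (wmeas e be) q (\<lambda>z. Pker e a b c z u) \<le>
          epow (ennreal (D * rho1 e u powr ((a + b - c + (real CARD('n) + 1 + be) / q) * q))) (1 / q)"
        unfolding Lnorm_def using q by (intro epow_mono) auto
      also have "\<dots> = ennreal (D powr (1 / q) * rho1 e u powr (a + b - c + (real CARD('n) + 1 + be) / q))"
        using D q by (simp add: epow_ennreal powr_mult powr_powr)
      finally show ?thesis using True by simp
    qed (simp add: Pker_def Lnorm_def)
  qed
qed

text \<open>Minkowski with exponent q/p >= 1, applied to F^p: moving the larger exponent inside can
  only increase the norm.\<close>

lemma Minkowski_mixed_Lnorm:
  assumes M: "sigma_finite_measure M" and N: "sigma_finite_measure N" and pq: "0 < p" "p \<le> q"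
    and F [measurable]: "case_prod F \<in> borel_measurable (M \<Otimes>\<^sub>M N)"
  shows "Lnorm M q (\<lambda>z. Lnorm N p (F z)) \<le> Lnorm N p (\<lambda>u. Lnorm M q (\<lambda>z. F z u))"
proof -
  have "epow (Lnorm M q (\<lambda>z. Lnorm N p (F z))) p = Lnorm M (q / p) (\<lambda>z. \<integral>\<^sup>+u. epow (F z u) p \<partial>N)"
    using pq by (subst Lnorm_epow[symmetric]) (auto simp: epow_Lnorm)
  also have "\<dots> \<le> (\<integral>\<^sup>+u. Lnorm M (q / p) (\<lambda>z. epow (F z u) p) \<partial>N)"
    using pq by (intro Minkowski_nn_integral M N) auto
  also have "\<dots> = (\<integral>\<^sup>+u. epow (Lnorm M q (\<lambda>z. F z u)) p \<partial>N)"
    using pq by (simp add: Lnorm_epow)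
  finally have "epow (epow (Lnorm M q (\<lambda>z. Lnorm N p (F z))) p) (1 / p) \<le> Lnorm N p (\<lambda>u. Lnorm M q (\<lambda>z. F z u))"
    unfolding Lnorm_def[of N] using pq by (intro epow_mono) auto
  then show ?thesis using pq by (simp add: epow_epow)
qed

text \<open>An off-diagonal Schur test. The Hoelder weight \<open>\<rho>(u)\<^bsup>\<tau>/p'\<^esup> |\<rho>(z,u)|\<^bsup>-g\<^esup>\<close> is chosen so that both
  factors of the kernel satisfy the hypotheses of the Forelli--Rudin estimate; homogeneity then makes
  the exponents match.\<close>

lemma Pker_Lp_Lq_bound:
  fixes e :: "'n::finite" and p q a b c al be :: real
  defines "n \<equiv> real CARD('n)"
  assumes p: "1 < p" "p \<le> q" and al: "al + 1 < p * (b + 1)" and be: "- q * a < be + 1"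
    and c: "c = n + 1 + a + b + ((n + 1 + be) / q - (n + 1 + al) / p)"
  obtains C where "0 < C"
    "\<And>F. F \<in> borel_measurable borel \<Longrightarrow>
      Lnorm (wmeas e be) q (\<lambda>z. \<integral>\<^sup>+u. Pker e a b c z u * F u \<partial>lborel) \<le> ennreal C * Lnorm (wmeas e al) p F"
proof -
  define p' where "p' = p / (p - 1)"
  have p': "1 < p'" "1 / p + 1 / p' = 1" using p by (auto simp: p'_def field_simps)
  have inv_p': "1 / p' = 1 - 1 / p" using p' by simp
  have "-1 / p' < b - al / p" using p al inv_p' by (simp add: field_simps)
  then have "-1 < p' * (b - al / p)" using p' by (simp add: field_simps)
  \<comment> \<open>tau > -1 is needed for Forelli-Rudin in u; the upper bound leaves enough decay
    to the second factor. The interval is nonempty by the hypothesis on \<open>al\<close>.\<close>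
  then obtain tau where tau: "-1 < tau" "tau < p' * (b - al / p)" using dense by blast
  have tau': "tau / p' < b - al / p" using tau p' by (simp add: field_simps)
  have "0 < a + (be + 1) / q" using be p by (simp add: field_simps)
  \<comment> \<open>X is the power of rho(z) lost in Hoelder's inequality: X > 0 gives the decay in
    the first Forelli-Rudin estimate, the upper bound keeps q (a - X) + be above -1. The hypothesis
    on \<open>be\<close> provides the room.\<close>
  then obtain X where X: "0 < X" "X < a + (be + 1) / q" using dense by blast
  define g where "g = X + (n + 1 + tau) / p'"
  define d where "d = c - g"
  define b' where "b' = b - tau / p'"
  have gp: "n + 1 + tau < g * p'" using X p' by (simp add: g_def field_simps)
  obtain D where D: "0 < D" "\<And>z. z \<in> TB e \<Longrightarrow>
      (\<integral>\<^sup>+u. indicator (TB e) u * ennreal (rho1 e u powr tau * cmod (rho2 e z u) powr (- (g * p'))) \<partial>lborel)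
        \<le> ennreal (D * rho1 e z powr (n + 1 + tau - g * p'))"
    using Forelli_Rudin[OF tau(1) gp[unfolded n_def]] unfolding n_def by blast
  have q0: "0 < q" using p by simp
  have t2: "-1 < q * (a - X) + be" using X q0 by (simp add: field_simps)
  have ci: "c = (n + 1) / p' + b - al / p + a + (n + 1 + be) / q"
    using p by (simp add: c p'_def field_simps)
  have "(n + 1 + be) / q + (a - X) < d"
    using tau' unfolding d_def g_def ci by (simp add: add_divide_distrib)
  then have "((n + 1 + be) / q + (a - X)) * q < d * q" using q0 by (intro mult_strict_right_mono)
  moreover have "((n + 1 + be) / q + (a - X)) * q = n + 1 + (q * (a - X) + be)"
    using q0 by (simp add: field_simps)
  ultimately have s2: "n + 1 + (q * (a - X) + be) < d * q" by simp
  obtain E where E: "0 < E" "\<And>u. Lnorm (wmeas e be) q (\<lambda>z. Pker e (a - X) b' d z u) \<le>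
       indicator (TB e) u * ennreal (E * rho1 e u powr ((a - X) + b' - d + (n + 1 + be) / q))"
    using Lnorm_Pker[OF q0 t2 s2[unfolded n_def], of e b'] unfolding n_def by blast
  \<comment> \<open>tau and X cancel, and the formula for c makes the remaining power of rho(u)
    equal to al/p, the weight of the source norm.\<close>
  have ex: "(a - X) + b' - d + (n + 1 + be) / q = al / p"
    unfolding d_def g_def ci b'_def by (simp add: add_divide_distrib)
  define C1 where "C1 = D powr (1 / p')"
  have C1: "0 < C1" using D by (simp add: C1_def)
  show ?thesis
  proof (rule that)
    show "0 < C1 * E" using C1 E by simp
    fix F :: "complex^'n \<Rightarrow> ennreal" assume [measurable]: "F \<in> borel_measurable borel"
    have H: "(\<integral>\<^sup>+u. Pker e a b c z u * F u \<partial>lborel) \<le>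
        ennreal C1 * Lnorm lborel p (\<lambda>u. Pker e (a - X) b' d z u * F u)" for z
    proof (cases "z \<in> TB e")
      case True
      then have z: "0 < rho1 e z" by (simp add: TB_def)
      define A where "A u = indicator (TB e) u * ennreal (rho1 e u powr (tau / p') * cmod (rho2 e z u) powr (- g))" for u
      have [measurable]: "A \<in> borel_measurable borel" unfolding A_def by measurable
      have split: "Pker e a b c z u = A u * Pker e a b' d z u" for u
      proof (cases "u \<in> TB e")
        case uTB: True
        have "rho1 e u powr b = rho1 e u powr (tau / p') * rho1 e u powr b'"
          by (simp add: b'_def flip: powr_add)
        moreover have "cmod (rho2 e z u) powr (-c) = cmod (rho2 e z u) powr (-g) * cmod (rho2 e z u) powr (-d)"
          by (simp add: d_def flip: powr_add)
        ultimately show ?thesis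
          using True uTB by (simp add: A_def Pker_def mult_ac flip: ennreal_mult)
      qed (simp add: Pker_def)
      have "(\<integral>\<^sup>+u. Pker e a b c z u * F u \<partial>lborel) = (\<integral>\<^sup>+u. A u * (Pker e a b' d z u * F u) \<partial>lborel)"
        by (simp add: split mult.assoc)
      also have "\<dots> \<le> Lnorm lborel p' A * Lnorm lborel p (\<lambda>u. Pker e a b' d z u * F u)"
        using p p' by (intro Holder_nn_integral) (auto simp: add.commute)
      also have "Lnorm lborel p' A \<le> ennreal (C1 * rho1 e z powr (-X))"
      proof -
        have "(\<integral>\<^sup>+u. epow (A u) p' \<partial>lborel) =
          (\<integral>\<^sup>+u. indicator (TB e) u * ennreal (rho1 e u powr tau * cmod (rho2 e z u) powr (- (g * p'))) \<partial>lborel)"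
          using p' by (intro nn_integral_cong) (auto simp: A_def indicator_def epow_ennreal powr_mult powr_powr)
        also have "\<dots> \<le> ennreal (D * rho1 e z powr (n + 1 + tau - g * p'))" by (intro D True)
        finally have "Lnorm lborel p' A \<le> epow (ennreal (D * rho1 e z powr (n + 1 + tau - g * p'))) (1 / p')"
          unfolding Lnorm_def using p' by (intro epow_mono) auto
        also have "\<dots> = ennreal (C1 * rho1 e z powr ((n + 1 + tau - g * p') * (1 / p')))"
          using D p' by (simp add: epow_ennreal powr_mult powr_powr C1_def)
        also have "(n + 1 + tau - g * p') * (1 / p') = - X"
          using p' by (simp add: g_def field_simps)
        finally show ?thesis .
      qed
      also have "ennreal (C1 * rho1 e z powr (-X)) * Lnorm lborel p (\<lambda>u. Pker e a b' d z u * F u) =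
         ennreal C1 * Lnorm lborel p (\<lambda>u. ennreal (rho1 e z powr (-X)) * (Pker e a b' d z u * F u))"
        using C1 p by (subst Lnorm_cmult) (auto simp: ennreal_mult mult.assoc)
      also have "(\<lambda>u. ennreal (rho1 e z powr (-X)) * (Pker e a b' d z u * F u)) = (\<lambda>u. Pker e (a - X) b' d z u * F u)"
      proof
        fix u
        have "rho1 e z powr (a - X) = rho1 e z powr (-X) * rho1 e z powr a" by (simp flip: powr_add)
        then have "ennreal (rho1 e z powr (-X)) * Pker e a b' d z u = Pker e (a - X) b' d z u"
          by (auto simp: Pker_def indicator_def ennreal_mult mult.assoc)
        then show "ennreal (rho1 e z powr (-X)) * (Pker e a b' d z u * F u) = Pker e (a - X) b' d z u * F u"
          by (simp flip: mult.assoc)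
      qed
      finally show ?thesis by (simp add: mult_right_mono)
    qed (simp add: Pker_def)
    have "Lnorm (wmeas e be) q (\<lambda>z. \<integral>\<^sup>+u. Pker e a b c z u * F u \<partial>lborel) \<le>
       Lnorm (wmeas e be) q (\<lambda>z. ennreal C1 * Lnorm lborel p (\<lambda>u. Pker e (a - X) b' d z u * F u))"
      by (intro Lnorm_mono q0 H)
    also have "\<dots> = ennreal C1 * Lnorm (wmeas e be) q (\<lambda>z. Lnorm lborel p (\<lambda>u. Pker e (a - X) b' d z u * F u))"
      using q0 by (intro Lnorm_cmult Lnorm_measurable) (auto intro: sigma_finite_lborel)
    \<comment> \<open>p <= q allows the exchange of the two norms, after which only the kernel
      depends on z.\<close>
    also have "Lnorm (wmeas e be) q (\<lambda>z. Lnorm lborel p (\<lambda>u. Pker e (a - X) b' d z u * F u)) \<le>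
       Lnorm lborel p (\<lambda>u. Lnorm (wmeas e be) q (\<lambda>z. Pker e (a - X) b' d z u * F u))"
      using p by (intro Minkowski_mixed_Lnorm sigma_finite_wmeas) (auto intro: sigma_finite_lborel)
    also have "\<dots> = Lnorm lborel p (\<lambda>u. Lnorm (wmeas e be) q (\<lambda>z. Pker e (a - X) b' d z u) * F u)"
      using q0 by (intro Lnorm_cong Lnorm_multc) auto
    also have "\<dots> \<le> Lnorm lborel p (\<lambda>u. ennreal E * (indicator (TB e) u * ennreal (rho1 e u powr (al / p)) * F u))"
    proof (rule Lnorm_mono)
      fix u
      have "Lnorm (wmeas e be) q (\<lambda>z. Pker e (a - X) b' d z u) * F u \<le> indicator (TB e) u * ennreal (E * rho1 e u powr (al / p)) * F u"
        using E(2)[of u] unfolding ex by (intro mult_right_mono) auto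
      then show "Lnorm (wmeas e be) q (\<lambda>z. Pker e (a - X) b' d z u) * F u \<le> ennreal E * (indicator (TB e) u * ennreal (rho1 e u powr (al / p)) * F u)"
        using E(1) by (simp add: ennreal_mult mult_ac)
    qed (use p in auto)
    also have "\<dots> = ennreal E * Lnorm lborel p (\<lambda>u. indicator (TB e) u * ennreal (rho1 e u powr (al / p)) * F u)"
      using p by (intro Lnorm_cmult) auto
    also have "Lnorm lborel p (\<lambda>u. indicator (TB e) u * ennreal (rho1 e u powr (al / p)) * F u) = Lnorm (wmeas e al) p F"
      using p unfolding Lnorm_def
      by (subst nn_integral_wmeas)
        (auto intro!: arg_cong[where f = "\<lambda>x. epow x _"] nn_integral_cong simp: epow_mult epow_ennreal powr_powr indicator_def)
    finally show "Lnorm (wmeas e be) q (\<lambda>z. \<integral>\<^sup>+u. Pker e a b c z u * F u \<partial>lborel) \<le> ennreal (C1 * E) * Lnorm (wmeas e al) p F"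
      using C1 E(1) by (simp add: ennreal_mult mult.assoc mult_left_mono)
  qed
qed

section \<open>Reduction to Borel functions\<close>

text \<open>A slice of a Lebesgue measurable function on a product need not be measurable. A Borel
  version has Borel slices, and neither the mixed norm nor the operator notices the change.\<close>

lemma lebesgue_measurable_borel_version:
  fixes f :: "'a::euclidean_space \<Rightarrow> complex"
  assumes [measurable]: "f \<in> borel_measurable lebesgue"
  obtains g where "g \<in> borel_measurable borel" "AE x in lborel. f x = g x"
proof -
  have "(\<lambda>x. Re (f x)) \<in> borel_measurable lebesgue" "(\<lambda>x. Im (f x)) \<in> borel_measurable lebesgue"
    by measurable
  then obtain g1 g2 where g: "g1 \<in> borel_measurable lborel" "g2 \<in> borel_measurable lborel"
      "AE x in lborel. Re (f x) = g1 x" "AE x in lborel. Im (f x) = g2 x"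
    using completion_ex_borel_measurable_real[of "\<lambda>x. Re (f x)" lborel]
      completion_ex_borel_measurable_real[of "\<lambda>x. Im (f x)" lborel] by blast
  show ?thesis
  proof (rule that)
    have [measurable]: "g1 \<in> borel_measurable borel" "g2 \<in> borel_measurable borel" using g by simp_all
    show "(\<lambda>x. complex_of_real (g1 x) + \<i> * complex_of_real (g2 x)) \<in> borel_measurable borel"
      by measurable
    show "AE x in lborel. f x = complex_of_real (g1 x) + \<i> * complex_of_real (g2 x)"
      using g(3,4) by eventually_elim (metis complex_eq)
  qed
qed

text \<open>P may be nonmeasurable, so the exceptional set is first enclosed in a Borel null set,
  for which the order of the quantifiers can be exchanged. The order with w outside is that of
  \<open>mixnorm\<close>.\<close>

lemma AE_lborel_prod_swap:
  fixes P :: "'a::euclidean_space \<times> 'b::euclidean_space \<Rightarrow> bool"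
  assumes "AE x in lborel. P x"
  shows "AE w in lborel. AE z in lborel. P (z, w)"
proof -
  obtain N where N: "{x \<in> space lborel. \<not> P x} \<subseteq> N" "N \<in> sets lborel" "emeasure lborel N = 0"
    using AE_E[OF assms] by metis
  have [measurable]: "N \<in> sets (lborel \<Otimes>\<^sub>M lborel)" using N(2) by (simp only: lborel_prod)
  have "AE x in lborel \<Otimes>\<^sub>M lborel. x \<notin> N"
    using N by (intro AE_not_in) (auto simp: null_sets_def lborel_prod)
  from lborel_pair.AE_pair[OF this]
  have "AE z in lborel. AE w in lborel. (z, w) \<notin> N" .
  then have "AE w in lborel. AE z in lborel. (z, w) \<notin> N"
    by (subst (asm) lborel_pair.AE_commute) measurable
  then show ?thesis
    by eventually_elim (use N(1) in \<open>auto elim!: eventually_mono\<close>)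
qed

lemma AE_lborel_prodI:
  fixes P :: "'a::euclidean_space \<times> 'b::euclidean_space \<Rightarrow> bool"
  assumes [measurable]: "Measurable.pred borel P" and "AE w in lborel. AE z in lborel. P (z, w)"
  shows "AE x in lborel. P x"
proof -
  have [measurable]: "Measurable.pred (lborel \<Otimes>\<^sub>M lborel) P"
    unfolding lborel_prod by simp
  have "AE z in lborel. AE w in lborel. P (z, w)"
    using assms(2) by (subst lborel_pair.AE_commute) measurable
  then have "AE x in lborel \<Otimes>\<^sub>M lborel. P x"
    by (intro lborel_pair.AE_pair_measure) measurable
  then show ?thesis by (simp only: lborel_prod)
qed

lemma mixnorm_cong_AE:
  assumes "AE x in lborel. f x = g x"
  shows "mixnorm e p1 p2 al1 al2 f = mixnorm e p1 p2 al1 al2 g"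
  unfolding mixnorm_def nn_integral_completion
proof (intro arg_cong[where f = "\<lambda>x. epow x _"] nn_integral_cong_AE)
  let ?I = "\<lambda>f w. epow (\<integral>\<^sup>+ z. indicator (TB e) z * ennreal (norm (f (z, w)) powr p1 * rho1 e z powr al1) \<partial>lborel) (p2 / p1)"
  have "AE w in lborel. ?I f w = ?I g w"
    using AE_lborel_prod_swap[OF assms]
  proof eventually_elim
    case (elim w)
    show ?case
      by (intro arg_cong[where f = "\<lambda>x. epow x _"] nn_integral_cong_AE, use elim in eventually_elim) simp
  qed
  then show "AE w in lborel. indicator (TB e) w * ?I f w * ennreal (rho1 e w powr al2) =
      indicator (TB e) w * ?I g w * ennreal (rho1 e w powr al2)"
    by eventually_elim simp
qed

lemma mixnorm_eq_Lnorm: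
  assumes [measurable]: "f \<in> borel_measurable borel" and p: "0 < p1" "0 < p2"
  shows "mixnorm e p1 p2 al1 al2 f =
    Lnorm (wmeas e al2) p2 (\<lambda>w. Lnorm (wmeas e al1) p1 (\<lambda>z. ennreal (norm (f (z, w)))))"
proof -
  have [measurable]: "(\<lambda>w. Lnorm (wmeas e al1) p1 (\<lambda>z. ennreal (norm (f (z, w))))) \<in> borel_measurable borel"
    by (intro Lnorm_measurable sigma_finite_wmeas) measurable
  have in_eq: "(\<integral>\<^sup>+ z. indicator (TB e) z * ennreal (norm (f (z, w)) powr p1 * rho1 e z powr al1) \<partial>lborel) =
     epow (Lnorm (wmeas e al1) p1 (\<lambda>z. ennreal (norm (f (z, w))))) p1" for w
    using p by (simp add: epow_Lnorm nn_integral_wmeas)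
      (auto intro!: nn_integral_cong simp: epow_ennreal ennreal_mult mult_ac)
  show ?thesis
    using p unfolding mixnorm_def nn_integral_completion in_eq epow_epow
    by (subst (2) Lnorm_def) (simp add: nn_integral_wmeas mult_ac)
qed

section \<open>Product kernels\<close>

text \<open>Both \<open>x\<^bsup>-c\<^esup>\<close> and \<open>|x|\<^bsup>-c\<^esup>\<close> are power kernels of order \<open>c\<close>, so \<open>S\<close> and \<open>T\<close> are treated together.
  The last condition says that the phase varies slowly.\<close>

definition pow_kernel :: "real \<Rightarrow> (complex \<Rightarrow> complex) \<Rightarrow> bool" where
  "pow_kernel c k \<longleftrightarrow> k \<in> borel_measurable borel \<and> (\<forall>x. 0 < Re x \<longrightarrow> cmod (k x) = cmod x powr (-c)) \<and>
     (\<exists>eps>0. \<forall>x y. 0 < Re x \<longrightarrow> 0 < Re y \<longrightarrow> cmod (x - y) \<le> eps * cmod y \<longrightarrow> cmod (k x - k y) \<le> cmod (k y) / 4)"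

definition Gker :: "'n::finite \<Rightarrow> real \<Rightarrow> real \<Rightarrow> (complex \<Rightarrow> complex) \<Rightarrow> (complex \<Rightarrow> complex)
    \<Rightarrow> complex^'n \<Rightarrow> complex^'n \<Rightarrow> (complex^'n) \<times> (complex^'n) \<Rightarrow> complex" where
  "Gker e b1 b2 k1 k2 z w x =
     complex_of_real (rho1 e (fst x) powr b1 * rho1 e (snd x) powr b2) * (k1 (rho2 e z (fst x)) * k2 (rho2 e w (snd x)))"

lemma pow_kernel_measurable: "pow_kernel c k \<Longrightarrow> k \<in> borel_measurable borel"
  by (simp add: pow_kernel_def)

lemma cmod_pow_kernel: "pow_kernel c k \<Longrightarrow> 0 < Re x \<Longrightarrow> cmod (k x) = cmod x powr (-c)"
  by (simp add: pow_kernel_def)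

lemma Gker_measurable:
  assumes [measurable]: "k1 \<in> borel_measurable borel" "k2 \<in> borel_measurable borel"
    and [measurable]: "f \<in> borel_measurable M" "g \<in> borel_measurable M" "h \<in> M \<rightarrow>\<^sub>M borel"
  shows "(\<lambda>x. Gker e b1 b2 k1 k2 (f x) (g x) (h x)) \<in> borel_measurable M"
proof -
  have [measurable]: "(\<lambda>x. fst (h x)) \<in> borel_measurable M" "(\<lambda>x. snd (h x)) \<in> borel_measurable M"
    using measurable_compose[OF assms(5), of fst borel] measurable_compose[OF assms(5), of snd borel]
    by (auto simp: borel_prod[symmetric])
  show ?thesis unfolding Gker_def by measurable
qed

lemma TB_Times_measurable [measurable]: "TB e \<times> TB e \<in> sets borel"
  using pair_measureI[OF TB_measurable TB_measurable, of e e] by (simp only: borel_prod)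

text \<open>Only the moduli of k1 and k2 enter, so S and T have the same absolute integrals. The
  identity allows the value \<open>top\<close> and therefore also decides convergence.\<close>

lemma nn_integral_Gker:
  assumes k: "pow_kernel c1 k1" "pow_kernel c2 k2" and z: "z \<in> TB e" and w: "w \<in> TB e"
    and [measurable]: "g \<in> borel_measurable borel"
  shows "ennreal (rho1 e z powr a1 * rho1 e w powr a2) *
      (\<integral>\<^sup>+y. ennreal (norm (indicator (TB e \<times> TB e) y *\<^sub>R (Gker e b1 b2 k1 k2 z w y * g y))) \<partial>lborel) =
    (\<integral>\<^sup>+\<eta>. Pker e a2 b2 c2 w \<eta> * (\<integral>\<^sup>+u. Pker e a1 b1 c1 z u * ennreal (norm (g (u, \<eta>))) \<partial>lborel) \<partial>lborel)"
proof -
  note [measurable] = pow_kernel_measurable[OF k(1)] pow_kernel_measurable[OF k(2)] Gker_measurable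
  define h where "h y = ennreal (rho1 e z powr a1 * rho1 e w powr a2) *
     ennreal (norm (indicator (TB e \<times> TB e) y *\<^sub>R (Gker e b1 b2 k1 k2 z w y * g y)))" for y
  have [measurable]: "h \<in> borel_measurable borel" unfolding h_def by measurable
  have eq: "h (u, \<eta>) = Pker e a2 b2 c2 w \<eta> * (Pker e a1 b1 c1 z u * ennreal (norm (g (u, \<eta>))))" for u \<eta>
    using z w unfolding h_def Pker_def
    by (auto simp: indicator_def Gker_def norm_mult cmod_pow_kernel[OF k(1)] cmod_pow_kernel[OF k(2)] Re_rho2_pos mult_ac
        simp flip: ennreal_mult)
  have "ennreal (rho1 e z powr a1 * rho1 e w powr a2) *
      (\<integral>\<^sup>+y. ennreal (norm (indicator (TB e \<times> TB e) y *\<^sub>R (Gker e b1 b2 k1 k2 z w y * g y))) \<partial>lborel) = (\<integral>\<^sup>+y. h y \<partial>lborel)"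
    unfolding h_def by (intro nn_integral_cmult[symmetric]) measurable
  also have "\<dots> = (\<integral>\<^sup>+y. h y \<partial>(lborel \<Otimes>\<^sub>M lborel))" by (simp add: lborel_prod)
  also have "\<dots> = (\<integral>\<^sup>+\<eta>. \<integral>\<^sup>+u. h (u, \<eta>) \<partial>lborel \<partial>lborel)"
    by (subst lborel_pair.nn_integral_snd) (auto simp: lborel_prod)
  also have "\<dots> = (\<integral>\<^sup>+\<eta>. Pker e a2 b2 c2 w \<eta> * (\<integral>\<^sup>+u. Pker e a1 b1 c1 z u * ennreal (norm (g (u, \<eta>))) \<partial>lborel) \<partial>lborel)"
    unfolding eq by (intro nn_integral_cong nn_integral_cmult) measurable
  finally show ?thesis .
qed

text \<open>The Bochner integral of a nonintegrable function is 0 by default, which settles the case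
  outside the standard bound.\<close>

lemma norm_integral_le_nn_integral:
  fixes f :: "'a \<Rightarrow> 'b::{banach, second_countable_topology}"
  shows "ennreal (norm (integral\<^sup>L M f)) \<le> (\<integral>\<^sup>+x. ennreal (norm (f x)) \<partial>M)"
  by (cases "integrable M f") (auto simp: integral_norm_bound_ennreal not_integrable_integral_eq)

lemma Lnorm_finite_AE:
  assumes [measurable]: "f \<in> borel_measurable M" and "Lnorm M p f < top"
  shows "AE x in M. f x < top"
  using nn_integral_PInf_AE[of "\<lambda>x. epow (f x) p" M] assms(2)
  by (simp add: Lnorm_def less_top)

text \<open>Minkowski moves both target norms inside the eta-integral, first q1 in z, then q2 in w.
  For fixed eta the z-part is the L^p1 to L^q1 bound, and the w-part is the norm of a single kernel,
  at most a multiple of rho(eta)^al2. What is left is the L^1 source norm in eta.\<close>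

lemma Lnorm_product_Pker_bound:
  fixes e :: "'n::finite" and p1 q1 q2 a1 a2 b1 b2 c1 c2 al1 al2 be1 be2 :: real
  defines "n \<equiv> real CARD('n)"
  assumes p: "1 < p1" "p1 \<le> q1" "1 \<le> q2"
    and al: "al1 + 1 < p1 * (b1 + 1)" "al2 < b2"
    and be: "- q1 * a1 < be1 + 1" "- q2 * a2 < be2 + 1"
    and c: "c1 = n + 1 + a1 + b1 + ((n + 1 + be1) / q1 - (n + 1 + al1) / p1)"
       "c2 = n + 1 + a2 + b2 + ((n + 1 + be2) / q2 - (n + 1 + al2))"
  obtains C where "\<And>G. G \<in> borel_measurable borel \<Longrightarrow>
    Lnorm (wmeas e be2) q2 (\<lambda>w. Lnorm (wmeas e be1) q1 (\<lambda>z. \<integral>\<^sup>+\<eta>. Pker e a2 b2 c2 w \<eta> * (\<integral>\<^sup>+u. Pker e a1 b1 c1 z u * G (u, \<eta>) \<partial>lborel) \<partial>lborel))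
    \<le> ennreal C * Lnorm (wmeas e al2) 1 (\<lambda>\<eta>. Lnorm (wmeas e al1) p1 (\<lambda>u. G (u, \<eta>)))"
proof -
  obtain C1 where C1: "0 < C1" "\<And>F. F \<in> borel_measurable borel \<Longrightarrow>
      Lnorm (wmeas e be1) q1 (\<lambda>z. \<integral>\<^sup>+u. Pker e a1 b1 c1 z u * F u \<partial>lborel) \<le> ennreal C1 * Lnorm (wmeas e al1) p1 F"
    using Pker_Lp_Lq_bound[OF p(1,2) al(1) be(1) c(1)[unfolded n_def]] by blast
  have q2: "0 < q2" using p by simp
  have t: "-1 < q2 * a2 + be2" using be(2) by linarith
  \<comment> \<open>With the formula for c2, the decay condition of Forelli-Rudin amounts to al2 <
    b2.\<close>
  have "c2 * q2 = n + 1 + (q2 * a2 + be2) + (b2 - al2) * q2" using q2 by (simp add: c(2) field_simps)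
  then have s: "n + 1 + (q2 * a2 + be2) < c2 * q2" using al(2) q2 by simp
  have ex: "a2 + b2 - c2 + (n + 1 + be2) / q2 = al2" by (simp add: c(2))
  obtain C2 where C2: "0 < C2" "\<And>\<eta>. Lnorm (wmeas e be2) q2 (\<lambda>w. Pker e a2 b2 c2 w \<eta>) \<le>
       indicator (TB e) \<eta> * ennreal (C2 * rho1 e \<eta> powr al2)"
    using Lnorm_Pker[OF q2 t s[unfolded n_def], of e b2] ex unfolding n_def by metis
  show ?thesis
  proof (rule that)
    fix G :: "(complex^'n) \<times> (complex^'n) \<Rightarrow> ennreal" assume [measurable]: "G \<in> borel_measurable borel"
    define H where "H z \<eta> = (\<integral>\<^sup>+u. Pker e a1 b1 c1 z u * G (u, \<eta>) \<partial>lborel)" for z \<eta>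
    define L where "L \<eta> = Lnorm (wmeas e al1) p1 (\<lambda>u. G (u, \<eta>))" for \<eta>
    have H [measurable]: "(\<lambda>x. H (f x) (g x)) \<in> borel_measurable M"
      if [measurable]: "f \<in> borel_measurable M" "g \<in> borel_measurable M" for f g and M :: "'b measure"
      unfolding H_def by measurable
    have [measurable]: "L \<in> borel_measurable borel"
      unfolding L_def by (intro Lnorm_measurable sigma_finite_wmeas) measurable
    have inner: "Lnorm (wmeas e be1) q1 (\<lambda>z. \<integral>\<^sup>+\<eta>. Pker e a2 b2 c2 w \<eta> * H z \<eta> \<partial>lborel)
        \<le> (\<integral>\<^sup>+\<eta>. Pker e a2 b2 c2 w \<eta> * (ennreal C1 * L \<eta>) \<partial>lborel)" for w
    proof -
      have "Lnorm (wmeas e be1) q1 (\<lambda>z. \<integral>\<^sup>+\<eta>. Pker e a2 b2 c2 w \<eta> * H z \<eta> \<partial>lborel)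
        \<le> (\<integral>\<^sup>+\<eta>. Lnorm (wmeas e be1) q1 (\<lambda>z. Pker e a2 b2 c2 w \<eta> * H z \<eta>) \<partial>lborel)"
        using p by (intro Minkowski_nn_integral sigma_finite_wmeas sigma_finite_lborel) auto
      also have "\<dots> = (\<integral>\<^sup>+\<eta>. Pker e a2 b2 c2 w \<eta> * Lnorm (wmeas e be1) q1 (\<lambda>z. H z \<eta>) \<partial>lborel)"
        using p by (intro nn_integral_cong Lnorm_cmult) auto
      also have "\<dots> \<le> (\<integral>\<^sup>+\<eta>. Pker e a2 b2 c2 w \<eta> * (ennreal C1 * L \<eta>) \<partial>lborel)"
        unfolding H_def L_def by (intro nn_integral_mono mult_left_mono C1) auto
      finally show ?thesis .
    qed
    have "Lnorm (wmeas e be2) q2 (\<lambda>w. Lnorm (wmeas e be1) q1 (\<lambda>z. \<integral>\<^sup>+\<eta>. Pker e a2 b2 c2 w \<eta> * H z \<eta> \<partial>lborel))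
       \<le> Lnorm (wmeas e be2) q2 (\<lambda>w. \<integral>\<^sup>+\<eta>. Pker e a2 b2 c2 w \<eta> * (ennreal C1 * L \<eta>) \<partial>lborel)"
      by (intro Lnorm_mono q2 inner)
    also have "\<dots> \<le> (\<integral>\<^sup>+\<eta>. Lnorm (wmeas e be2) q2 (\<lambda>w. Pker e a2 b2 c2 w \<eta> * (ennreal C1 * L \<eta>)) \<partial>lborel)"
      using p by (intro Minkowski_nn_integral sigma_finite_wmeas sigma_finite_lborel) auto
    also have "\<dots> = (\<integral>\<^sup>+\<eta>. Lnorm (wmeas e be2) q2 (\<lambda>w. Pker e a2 b2 c2 w \<eta>) * (ennreal C1 * L \<eta>) \<partial>lborel)"
      using q2 by (intro nn_integral_cong Lnorm_multc) auto
    also have "\<dots> \<le> (\<integral>\<^sup>+\<eta>. ennreal (C1 * C2) * (indicator (TB e) \<eta> * ennreal (rho1 e \<eta> powr al2) * L \<eta>) \<partial>lborel)"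
    proof (rule nn_integral_mono)
      fix \<eta>
      have "Lnorm (wmeas e be2) q2 (\<lambda>w. Pker e a2 b2 c2 w \<eta>) * (ennreal C1 * L \<eta>) \<le>
          indicator (TB e) \<eta> * ennreal (C2 * rho1 e \<eta> powr al2) * (ennreal C1 * L \<eta>)"
        by (intro mult_right_mono C2) auto
      then show "Lnorm (wmeas e be2) q2 (\<lambda>w. Pker e a2 b2 c2 w \<eta>) * (ennreal C1 * L \<eta>) \<le>
          ennreal (C1 * C2) * (indicator (TB e) \<eta> * ennreal (rho1 e \<eta> powr al2) * L \<eta>)"
        using C1(1) C2(1) by (simp add: ennreal_mult mult_ac)
    qed
    also have "\<dots> = ennreal (C1 * C2) * (\<integral>\<^sup>+\<eta>. indicator (TB e) \<eta> * ennreal (rho1 e \<eta> powr al2) * L \<eta> \<partial>lborel)"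
      by (intro nn_integral_cmult) measurable
    also have "(\<integral>\<^sup>+\<eta>. indicator (TB e) \<eta> * ennreal (rho1 e \<eta> powr al2) * L \<eta> \<partial>lborel) = Lnorm (wmeas e al2) 1 L"
      by (simp add: Lnorm_exp_1 nn_integral_wmeas)
    finally show "Lnorm (wmeas e be2) q2 (\<lambda>w. Lnorm (wmeas e be1) q1 (\<lambda>z. \<integral>\<^sup>+\<eta>. Pker e a2 b2 c2 w \<eta> * (\<integral>\<^sup>+u. Pker e a1 b1 c1 z u * G (u, \<eta>) \<partial>lborel) \<partial>lborel))
    \<le> ennreal (C1 * C2) * Lnorm (wmeas e al2) 1 (\<lambda>\<eta>. Lnorm (wmeas e al1) p1 (\<lambda>u. G (u, \<eta>)))"
      by (simp only: H_def L_def[abs_def])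
  qed
qed

section \<open>Sufficiency\<close>

text \<open>For every z and w the two integrands differ only on a null set in y. Hence the operator
  takes the same values everywhere on f and on its Borel version.\<close>

lemma Gker_integral_borel_version:
  fixes e :: "'n::finite"
  assumes k: "k1 \<in> borel_measurable borel" "k2 \<in> borel_measurable borel"
    and f [measurable]: "f \<in> borel_measurable lebesgue" and g [measurable]: "g \<in> borel_measurable borel"
    and fg: "AE x in lborel. f x = g x"
  shows "set_integrable lebesgue (TB e \<times> TB e) (\<lambda>y. Gker e b1 b2 k1 k2 z w y * f y) \<longleftrightarrow>
      integrable lborel (\<lambda>y. indicator (TB e \<times> TB e) y *\<^sub>R (Gker e b1 b2 k1 k2 z w y * g y))" (is ?A)
    and "(LINT y:(TB e \<times> TB e)|lebesgue. Gker e b1 b2 k1 k2 z w y * f y) =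
      (LINT y|lborel. indicator (TB e \<times> TB e) y *\<^sub>R (Gker e b1 b2 k1 k2 z w y * g y))" (is ?B)
proof -
  define F where "F = (\<lambda>y. indicator (TB e \<times> TB e) y *\<^sub>R (Gker e b1 b2 k1 k2 z w y * f y))"
  define G where "G = (\<lambda>y. indicator (TB e \<times> TB e) y *\<^sub>R (Gker e b1 b2 k1 k2 z w y * g y))"
  have K [measurable]: "(\<lambda>y. Gker e b1 b2 k1 k2 z w y) \<in> borel_measurable borel"
    by (rule Gker_measurable[OF k]) auto
  have KL: "(\<lambda>y. indicator (TB e \<times> TB e) y *\<^sub>R Gker e b1 b2 k1 k2 z w y) \<in> borel_measurable lebesgue"
    by (intro measurable_completion) measurable
  have "F = (\<lambda>y. (indicator (TB e \<times> TB e) y *\<^sub>R Gker e b1 b2 k1 k2 z w y) * f y)"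
    by (auto simp: F_def)
  with borel_measurable_times[OF KL f] have F: "F \<in> borel_measurable lebesgue" by (simp only:)
  have G: "G \<in> borel_measurable lborel" unfolding G_def by measurable
  have G': "G \<in> borel_measurable lebesgue" using G by (rule measurable_completion)
  have FG: "AE y in lebesgue. F y = G y"
    using AE_completion[OF fg] by eventually_elim (simp add: F_def G_def)
  have "integrable lebesgue F \<longleftrightarrow> integrable lborel G"
    using integrable_cong_AE[OF F G' FG] integrable_completion[OF G] by simp
  then show ?A by (simp add: set_integrable_def F_def G_def)
  have "integral\<^sup>L lebesgue F = integral\<^sup>L lborel G"
    using integral_cong_AE[OF F G' FG] integral_completion[OF G] by simp
  then show ?B by (simp add: set_lebesgue_integral_def F_def G_def)
qed

lemma intop_Gker_measurable:
  fixes e :: "'n::finite"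
  assumes k [measurable]: "k1 \<in> borel_measurable borel" "k2 \<in> borel_measurable borel"
    and g [measurable]: "g \<in> borel_measurable borel"
  shows "intop e a1 a2 (Gker e b1 b2 k1 k2) g \<in> borel_measurable borel"
proof -
  have g': "g \<in> borel_measurable lebesgue" using g by (intro measurable_completion) simp
  note [measurable] = Gker_measurable
  have [measurable]: "(\<lambda>x :: (complex^'n) \<times> (complex^'n). fst x) \<in> borel_measurable borel"
     "(\<lambda>x :: (complex^'n) \<times> (complex^'n). snd x) \<in> borel_measurable borel"
    by (auto simp: borel_prod[symmetric])
  have [measurable]: "(\<lambda>x. LINT y|lborel. indicator (TB e \<times> TB e) y *\<^sub>R (Gker e b1 b2 k1 k2 (fst x) (snd x) y * g y)) \<in> borel_measurable borel"
    by (intro lborel.borel_measurable_lebesgue_integral) measurable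
  show ?thesis
    unfolding intop_def Gker_integral_borel_version(2)[OF k g' g AE_I2[OF refl]] by measurable
qed

text \<open>One bound for the positive majorant \<open>S\<close> serves twice: having finite norm it
  is finite almost everywhere, which gives convergence, and it dominates the modulus of
  \<open>intop\<close> on \<open>TB e \<times> TB e\<close>, which gives the norm estimate.\<close>

theorem bounded_op_Gker:
  fixes e :: "'n::finite" and p1 q1 q2 a1 a2 b1 b2 c1 c2 al1 al2 be1 be2 :: real
  defines "n \<equiv> real CARD('n)"
  assumes k: "pow_kernel c1 k1" "pow_kernel c2 k2"
    and p: "1 < p1" "p1 \<le> q1" "1 \<le> q2"
    and al: "al1 + 1 < p1 * (b1 + 1)" "al2 < b2"
    and be: "- q1 * a1 < be1 + 1" "- q2 * a2 < be2 + 1"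
    and c: "c1 = n + 1 + a1 + b1 + ((n + 1 + be1) / q1 - (n + 1 + al1) / p1)"
       "c2 = n + 1 + a2 + b2 + ((n + 1 + be2) / q2 - (n + 1 + al2))"
  shows "bounded_op e a1 a2 (Gker e b1 b2 k1 k2) p1 1 al1 al2 q1 q2 be1 be2"
proof -
  define S where "S G z w = (\<integral>\<^sup>+\<eta>. Pker e a2 b2 c2 w \<eta> * (\<integral>\<^sup>+u. Pker e a1 b1 c1 z u * G (u, \<eta>) \<partial>lborel) \<partial>lborel)"
    for G :: "(complex^'n) \<times> (complex^'n) \<Rightarrow> ennreal" and z w
  obtain C where C: "\<And>G. G \<in> borel_measurable borel \<Longrightarrow>
    Lnorm (wmeas e be2) q2 (\<lambda>w. Lnorm (wmeas e be1) q1 (\<lambda>z. S G z w))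
    \<le> ennreal C * Lnorm (wmeas e al2) 1 (\<lambda>\<eta>. Lnorm (wmeas e al1) p1 (\<lambda>u. G (u, \<eta>)))"
    unfolding S_def
    using Lnorm_product_Pker_bound[OF p al be c[unfolded n_def], of e] by blast
  note km = pow_kernel_measurable[OF k(1)] pow_kernel_measurable[OF k(2)]
  let ?K = "Gker e b1 b2 k1 k2"
  show ?thesis unfolding bounded_op_def
  proof (intro exI ballI)
    fix f assume "f \<in> Lspace e p1 1 al1 al2"
    then have f: "f \<in> borel_measurable lebesgue" and fin: "mixnorm e p1 1 al1 al2 f < top"
      by (auto simp: Lspace_def)
    from f obtain g where g [measurable]: "g \<in> borel_measurable borel" and fg: "AE x in lborel. f x = g x"
      by (rule lebesgue_measurable_borel_version)
    have g': "g \<in> borel_measurable lebesgue" using g by (intro measurable_completion) simp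
    note vf = Gker_integral_borel_version[OF km f g fg, of e b1 b2]
    note vg = Gker_integral_borel_version[OF km g' g AE_I2[OF refl], of e b1 b2]
    have op_eq: "intop e a1 a2 ?K f = intop e a1 a2 ?K g"
      unfolding intop_def vf(2) vg(2) by (rule refl)
    have op_meas [measurable]: "intop e a1 a2 ?K g \<in> borel_measurable borel"
      by (rule intop_Gker_measurable[OF km g])
    define G where "G x = ennreal (norm (g x))" for x
    have [measurable]: "G \<in> borel_measurable borel" unfolding G_def by measurable
    have S_meas [measurable]: "(\<lambda>x. S G (s x) (t x)) \<in> borel_measurable M"
      if [measurable]: "s \<in> borel_measurable M" "t \<in> borel_measurable M" for s t and M :: "'b measure"
      unfolding S_def by measurable
    have L_meas [measurable]: "(\<lambda>w. Lnorm (wmeas e be1) q1 (\<lambda>z. S G z w)) \<in> borel_measurable borel"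
      by (intro Lnorm_measurable sigma_finite_wmeas) measurable
    have mg: "mixnorm e p1 1 al1 al2 f = Lnorm (wmeas e al2) 1 (\<lambda>\<eta>. Lnorm (wmeas e al1) p1 (\<lambda>u. G (u, \<eta>)))"
      using p unfolding mixnorm_cong_AE[OF fg] G_def by (subst mixnorm_eq_Lnorm) auto
    have SG: "ennreal (rho1 e z powr a1 * rho1 e w powr a2) *
        (\<integral>\<^sup>+y. ennreal (norm (indicator (TB e \<times> TB e) y *\<^sub>R (?K z w y * g y))) \<partial>lborel) = S G z w"
      if "z \<in> TB e" "w \<in> TB e" for z w
      unfolding S_def G_def by (rule nn_integral_Gker[OF k that g])
    have bound: "Lnorm (wmeas e be2) q2 (\<lambda>w. Lnorm (wmeas e be1) q1 (\<lambda>z. S G z w)) \<le> ennreal C * mixnorm e p1 1 al1 al2 f"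
      unfolding mg by (rule C) measurable
    also have "\<dots> < top" using fin by (simp add: ennreal_mult_less_top)
    finally have "AE w in wmeas e be2. Lnorm (wmeas e be1) q1 (\<lambda>z. S G z w) < top"
      by (intro Lnorm_finite_AE) measurable
    then have "AE w in wmeas e be2. AE z in wmeas e be1. S G z w < top"
      by eventually_elim (rule Lnorm_finite_AE, measurable)
    then have "AE w in lborel. w \<in> TB e \<longrightarrow> (AE z in lborel. z \<in> TB e \<longrightarrow> S G z w < top)"
      by (simp add: AE_wmeas_iff)
    then have "AE w in lborel. AE z in lborel. (z, w) \<in> TB e \<times> TB e \<longrightarrow> S G (fst (z, w)) (snd (z, w)) < top"
      by eventually_elim (auto elim!: eventually_mono)
    then have fin_AE: "AE x in lborel. x \<in> TB e \<times> TB e \<longrightarrow> S G (fst x) (snd x) < top"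
      by (intro AE_lborel_prodI) (auto simp: borel_prod[symmetric])
    have "AE x in lebesgue. x \<in> TB e \<times> TB e \<longrightarrow> set_integrable lebesgue (TB e \<times> TB e) (\<lambda>y. ?K (fst x) (snd x) y * f y)"
      using AE_completion[OF fin_AE]
    proof eventually_elim
      case (elim x)
      show ?case
      proof
        assume x: "x \<in> TB e \<times> TB e"
        then have TBx: "fst x \<in> TB e" "snd x \<in> TB e" by auto
        have "ennreal (rho1 e (fst x) powr a1 * rho1 e (snd x) powr a2) *
            (\<integral>\<^sup>+y. ennreal (norm (indicator (TB e \<times> TB e) y *\<^sub>R (?K (fst x) (snd x) y * g y))) \<partial>lborel) < top"
          using elim x unfolding SG[OF TBx] by simp
        \<comment> \<open>The outer weight is positive on the domain, so finiteness of the product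
          passes to the integral.\<close>
        moreover have "rho1 e (fst x) powr a1 * rho1 e (snd x) powr a2 > 0"
          using TBx by (simp add: TB_def)
        ultimately have "(\<integral>\<^sup>+y. ennreal (norm (indicator (TB e \<times> TB e) y *\<^sub>R (?K (fst x) (snd x) y * g y))) \<partial>lborel) < top"
          by (auto simp: ennreal_mult_less_top)
        then show "set_integrable lebesgue (TB e \<times> TB e) (\<lambda>y. ?K (fst x) (snd x) y * f y)"
          unfolding vf(1) using Gker_measurable[OF km, of "\<lambda>_. fst x" borel "\<lambda>_. snd x" "\<lambda>y. y" e b1 b2]
          by (intro integrableI_bounded) auto
      qed
    qed
    moreover have "(\<lambda>x. indicator (TB e \<times> TB e) x *\<^sub>R intop e a1 a2 ?K f x) \<in> borel_measurable lebesgue"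
      unfolding op_eq by (intro measurable_completion) measurable
    moreover have "mixnorm e q1 q2 be1 be2 (intop e a1 a2 ?K f) \<le> ennreal C * mixnorm e p1 1 al1 al2 f"
    proof -
      have pt: "ennreal (norm (intop e a1 a2 ?K g (z, w))) \<le> S G z w" if "z \<in> TB e" "w \<in> TB e" for z w
      proof -
        have "ennreal (norm (intop e a1 a2 ?K g (z, w))) = ennreal (rho1 e z powr a1 * rho1 e w powr a2) *
           ennreal (norm (LINT y|lborel. indicator (TB e \<times> TB e) y *\<^sub>R (?K z w y * g y)))"
          unfolding intop_def vg(2) by (simp add: norm_mult flip: ennreal_mult)
        also have "\<dots> \<le> S G z w"
          unfolding SG[OF that, symmetric] by (intro mult_left_mono norm_integral_le_nn_integral) auto
        finally show ?thesis .
      qed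
      have "mixnorm e q1 q2 be1 be2 (intop e a1 a2 ?K f) =
         Lnorm (wmeas e be2) q2 (\<lambda>w. Lnorm (wmeas e be1) q1 (\<lambda>z. ennreal (norm (intop e a1 a2 ?K g (z, w)))))"
        using p unfolding op_eq by (intro mixnorm_eq_Lnorm) auto
      also have "\<dots> \<le> Lnorm (wmeas e be2) q2 (\<lambda>w. Lnorm (wmeas e be1) q1 (\<lambda>z. S G z w))"
      proof (rule Lnorm_mono_AE)
        have "Lnorm (wmeas e be1) q1 (\<lambda>z. ennreal (norm (intop e a1 a2 ?K g (z, w)))) \<le> Lnorm (wmeas e be1) q1 (\<lambda>z. S G z w)"
          if "w \<in> TB e" for w
          using p that by (intro Lnorm_mono_AE) (auto simp: AE_wmeas_iff pt)
        then show "AE w in wmeas e be2. Lnorm (wmeas e be1) q1 (\<lambda>z. ennreal (norm (intop e a1 a2 ?K g (z, w)))) \<le> Lnorm (wmeas e be1) q1 (\<lambda>z. S G z w)"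
          by (simp add: AE_wmeas_iff)
      qed (use p in simp)
      also note bound
      finally show ?thesis .
    qed
    ultimately show "(AE x in lebesgue. x \<in> TB e \<times> TB e \<longrightarrow> set_integrable lebesgue (TB e \<times> TB e) (\<lambda>y. ?K (fst x) (snd x) y * f y)) \<and>
        (\<lambda>x. indicator (TB e \<times> TB e) x *\<^sub>R intop e a1 a2 ?K f x) \<in> borel_measurable lebesgue \<and>
        mixnorm e q1 q2 be1 be2 (intop e a1 a2 ?K f) \<le> ennreal C * mixnorm e p1 1 al1 al2 f"
      by blast
  qed
qed

section \<open>Anisotropic boxes around the points \<open>(0, i r)\<close>\<close>

definition ctr :: "'n::finite \<Rightarrow> real \<Rightarrow> complex^'n" where
  "ctr e r = (\<chi> j. if j = e then Complex 0 r else 0)"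

text \<open>The sides d r and d sqrt r follow the dilations under which rho scales by r; d fixes the
  shape and is chosen once, independently of the size r.\<close>

definition Ebox :: "'n::finite \<Rightarrow> real \<Rightarrow> real \<Rightarrow> (complex^'n) set" where
  "Ebox e d r = cbox (\<chi> j. if j = e then Complex (- (d * r)) (r - d * r) else Complex (- (d * sqrt r)) (- (d * sqrt r)))
     (\<chi> j. if j = e then Complex (d * r) (r + d * r) else Complex (d * sqrt r) (d * sqrt r))"

lemma Ebox_measurable [measurable]: "Ebox e d r \<in> sets borel"
  by (simp add: Ebox_def)

lemma mem_Ebox:
  "u \<in> Ebox e d r \<longleftrightarrow> \<bar>Re (u $ e)\<bar> \<le> d * r \<and> \<bar>Im (u $ e) - r\<bar> \<le> d * r \<and>
    (\<forall>j. j \<noteq> e \<longrightarrow> \<bar>Re (u $ j)\<bar> \<le> d * sqrt r \<and> \<bar>Im (u $ j)\<bar> \<le> d * sqrt r)"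
proof -
  have "\<bar>x\<bar> \<le> b \<longleftrightarrow> -b \<le> x \<and> x \<le> b" for x b :: real by auto
  then show ?thesis
    unfolding Ebox_def mem_cbox_complex_vec by (auto split: if_splits)
qed

lemma ctr_nth: "ctr e r $ j = (if j = e then Complex 0 r else 0)"
  by (simp add: ctr_def)

lemma rho1_ctr [simp]: "rho1 e (ctr e r) = r"
  by (simp add: rho1_def ctr_def)

lemma ctr_in_TB: "0 < r \<Longrightarrow> ctr e r \<in> TB e"
  by (simp add: TB_def)

lemma emeasure_Ebox:
  fixes e :: "'n::finite"
  assumes "0 < d" "0 < r"
  shows "emeasure lborel (Ebox e d r) = ennreal ((2 * d) ^ (2 * CARD('n)) * r powr (real CARD('n) + 1))"
proof -
  define N where "N = CARD('n) - 1"
  have N: "CARD('n) = Suc N" using zero_less_card_finite[where 'a = 'n] by (simp add: N_def)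
  have four: "(4::real) ^ N = 2 ^ N * 2 ^ N" by (simp flip: power_mult_distrib)
  have "emeasure lborel (Ebox e d r) = ennreal (\<Prod>j\<in>UNIV. if j = e then (2 * d * r) * (2 * d * r) else (2 * d * sqrt r) * (2 * d * sqrt r))"
    unfolding Ebox_def using assms
    by (subst emeasure_cbox_complex_vec) (auto intro!: arg_cong[where f = ennreal] prod.cong)
  also have "(2 * d * sqrt r) * (2 * d * sqrt r) = 4 * d\<^sup>2 * r"
    using assms by (simp add: power2_eq_square)
  also have "ennreal (\<Prod>j\<in>UNIV. if j = e then (2 * d * r) * (2 * d * r) else 4 * d\<^sup>2 * r) =
      ennreal ((2 * d * r) * (2 * d * r) * (4 * d\<^sup>2 * r) ^ N)"
    by (simp add: prod_UNIV_if N_def)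
  also have "(2 * d * r) * (2 * d * r) * (4 * d\<^sup>2 * r) ^ N = (2 * d) ^ (2 * CARD('n)) * r powr (real CARD('n) + 1)"
    using assms four by (simp add: N powr_add powr_realpow power_mult power2_eq_square power_mult_distrib mult_ac)
  finally show ?thesis .
qed

lemma powr_comparable:
  fixes x r t :: real
  assumes "0 < r" "r / 4 \<le> x" "x \<le> 4 * r"
  shows "4 powr (- \<bar>t\<bar>) * r powr t \<le> x powr t" "x powr t \<le> 4 powr \<bar>t\<bar> * r powr t"
proof -
  have x: "0 < x" using assms by linarith
  have "x powr t \<le> 4 powr \<bar>t\<bar> * r powr t \<and> 4 powr (- \<bar>t\<bar>) * r powr t \<le> x powr t"
  proof (cases "0 \<le> t")
    case True
    have "x powr t \<le> (4 * r) powr t" "(r / 4) powr t \<le> x powr t"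
      using assms x True by (auto intro!: powr_mono2)
    then show ?thesis using True assms by (simp add: powr_mult powr_divide powr_minus field_simps)
  next
    case False
    have "(4 * r) powr t \<le> x powr t" "x powr t \<le> (r / 4) powr t"
      using assms x False by (auto intro!: powr_mono2')
    then show ?thesis using False assms by (simp add: powr_mult powr_divide powr_minus field_simps)
  qed
  then show "4 powr (- \<bar>t\<bar>) * r powr t \<le> x powr t" "x powr t \<le> 4 powr \<bar>t\<bar> * r powr t" by auto
qed

text \<open>The squares subtracted in \<open>rho1\<close> sum to at most n d^2 r <= r/9 and Im u_n
  deviates from r by at most r/3, so \<open>rho1\<close> stays between 5r/9 and 4r/3.\<close>

lemma Ebox_rho1:
  fixes e :: "'n::finite"
  assumes d: "0 < d" "3 * real CARD('n) * d \<le> 1" and r: "0 < r" and u: "u \<in> Ebox e d r"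
  shows "r / 2 \<le> rho1 e u" "rho1 e u \<le> 2 * r" "u \<in> TB e"
proof -
  have n1: "1 \<le> real CARD('n)" using zero_less_card_finite[where 'a = 'n] by linarith
  have "1 * d \<le> real CARD('n) * d" using n1 d by (intro mult_right_mono) auto
  then have d3: "d \<le> 1 / 3" using d by linarith
  define S where "S = (\<Sum>j\<in>UNIV - {e}. (Im (u $ j))\<^sup>2)"
  have S0: "0 \<le> S" by (simp add: S_def sum_nonneg)
  have "S \<le> (\<Sum>j\<in>UNIV - {e}. d\<^sup>2 * r)"
    unfolding S_def
  proof (rule sum_mono)
    fix j assume "j \<in> UNIV - {e}"
    then have "\<bar>Im (u $ j)\<bar> \<le> \<bar>d * sqrt r\<bar>" using u d r by (auto simp: mem_Ebox)
    then have "(Im (u $ j))\<^sup>2 \<le> (d * sqrt r)\<^sup>2" by (simp only: abs_le_square_iff)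
    then show "(Im (u $ j))\<^sup>2 \<le> d\<^sup>2 * r" using r by (simp add: power_mult_distrib)
  qed
  also have "\<dots> \<le> real CARD('n) * (d\<^sup>2 * r)"
    using d r by (auto intro!: mult_right_mono)
  also have "\<dots> = (real CARD('n) * d) * d * r" by (simp add: power2_eq_square)
  also have "\<dots> \<le> 1/3 * (1/3) * r"
    using d d3 r by (intro mult_right_mono mult_mono) auto
  finally have S1: "S \<le> r / 9" by simp
  have "d * r \<le> 1/3 * r" using d3 r by (intro mult_right_mono) auto
  moreover have "\<bar>Im (u $ e) - r\<bar> \<le> d * r" using u by (simp add: mem_Ebox)
  moreover have "rho1 e u = Im (u $ e) - S" by (simp add: rho1_def S_def)
  ultimately show "r / 2 \<le> rho1 e u" "rho1 e u \<le> 2 * r" using S0 S1 r by linarith+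
  then show "u \<in> TB e" using r by (simp add: TB_def)
qed

text \<open>The point is uniformity, also for z far from the box. P = |rho(z,(0,ir))| controls both
  r <= 2P and |z_j|^2 <= 4P, so even the cross terms z_j conj(u_j) are of order d P.\<close>

lemma rho2_ctr_perturb:
  fixes e :: "'n::finite"
  assumes d: "0 < d" "3 * real CARD('n) * d \<le> 1" and r: "0 < r" and u: "u \<in> Ebox e d r" and z: "z \<in> TB e"
  shows "cmod (rho2 e z u - rho2 e z (ctr e r)) \<le> 3 * real CARD('n) * d * cmod (rho2 e z (ctr e r))"
proof -
  define P where "P = cmod (rho2 e z (ctr e r))"
  have n1: "1 \<le> real CARD('n)" using zero_less_card_finite[where 'a = 'n] by linarith
  have "1 * d \<le> real CARD('n) * d" using n1 d by (intro mult_right_mono) auto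
  then have d3: "d \<le> 1" using d by linarith
  have rP: "r \<le> 2 * P" using rho1_le_cmod_rho2(2)[OF z ctr_in_TB[OF r]] by (simp add: P_def)
  have zP: "(cmod (z $ j))\<^sup>2 \<le> 4 * P" if "j \<noteq> e" for j
    using cmod_diff_le_Re_rho2[OF z ctr_in_TB[OF r] that] complex_Re_le_cmod[of "rho2 e z (ctr e r)"] that
    by (auto simp: ctr_def P_def)
  have drP: "d * r \<le> 2 * (d * P)" using rP d by simp
  have uj: "(cmod (u $ j))\<^sup>2 \<le> d * (2 * (d * r))" if "j \<noteq> e" for j
  proof -
    have "\<bar>Re (u $ j)\<bar> \<le> \<bar>d * sqrt r\<bar>" "\<bar>Im (u $ j)\<bar> \<le> \<bar>d * sqrt r\<bar>" using u d r that by (auto simp: mem_Ebox)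
    then have "(Re (u $ j))\<^sup>2 \<le> (d * sqrt r)\<^sup>2" "(Im (u $ j))\<^sup>2 \<le> (d * sqrt r)\<^sup>2" by (simp_all only: abs_le_square_iff)
    moreover have "(d * sqrt r)\<^sup>2 = d * (d * r)" using r by (simp add: power2_eq_square)
    ultimately show ?thesis by (simp add: cmod_power2)
  qed
  have summand: "cmod ((z $ j - cnj (u $ j))\<^sup>2 - (z $ j)\<^sup>2) \<le> 12 * (d * P)" if "j \<noteq> e" for j
  proof -
    define x where "x = cmod (z $ j)"
    define y where "y = cmod (u $ j)"
    have xy: "0 \<le> x" "0 \<le> y" "x\<^sup>2 \<le> 4 * P" "y\<^sup>2 \<le> d * (2 * (d * r))"
      using zP[OF that] uj[OF that] by (auto simp: x_def y_def)
    have y2: "y\<^sup>2 \<le> d * (4 * (d * P))"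
    proof -
      have "d * (2 * (d * r)) \<le> d * (4 * (d * P))"
        by (rule mult_left_mono) (use drP d in linarith)+
      with xy(4) show ?thesis by (rule order_trans)
    qed
    \<comment> \<open>Weighted AM-GM: x is of order sqrt P and y of order d sqrt P, so the weight d
      balances them and the bound is linear in d.\<close>
    have "0 \<le> (d * x - y)\<^sup>2" by simp
    then have "d * (2 * (x * y)) \<le> d * (d * x\<^sup>2) + y\<^sup>2" by (simp add: power2_eq_square algebra_simps)
    also have "\<dots> \<le> d * (d * (4 * P)) + d * (4 * (d * P))"
      using xy(3) y2 d by (intro add_mono mult_left_mono) auto
    finally have "d * (2 * (x * y)) \<le> d * (8 * (d * P))" by (simp add: algebra_simps)
    then have 1: "2 * (x * y) \<le> 8 * (d * P)" using d by simp
    have "d * (4 * (d * P)) \<le> 1 * (4 * (d * P))" using d3 d by (intro mult_right_mono) (auto simp: P_def)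
    with y2 have 2: "y\<^sup>2 \<le> 4 * (d * P)" by (metis mult_1 order_trans)
    have "(z $ j - cnj (u $ j))\<^sup>2 - (z $ j)\<^sup>2 = (cnj (u $ j))\<^sup>2 - 2 * (z $ j * cnj (u $ j))"
      by (simp add: power2_eq_square algebra_simps)
    then have "cmod ((z $ j - cnj (u $ j))\<^sup>2 - (z $ j)\<^sup>2) \<le> cmod ((cnj (u $ j))\<^sup>2) + cmod (2 * (z $ j * cnj (u $ j)))"
      by (simp only: norm_triangle_ineq4)
    also have "\<dots> = y\<^sup>2 + 2 * (x * y)" by (simp add: norm_mult norm_power x_def y_def)
    finally show ?thesis using 1 2 by linarith
  qed
  have "\<bar>Re (u $ e)\<bar> \<le> d * r" "\<bar>Im (u $ e) - r\<bar> \<le> d * r" using u by (auto simp: mem_Ebox)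
  then have ue: "cmod (u $ e - Complex 0 r) \<le> 4 * (d * P)"
    using cmod_le[of "u $ e - Complex 0 r"] drP by simp
  have "4 * (rho2 e z u - rho2 e z (ctr e r)) =
      (\<Sum>j\<in>UNIV - {e}. (z $ j - cnj (u $ j))\<^sup>2 - (z $ j)\<^sup>2) + 2 * \<i> * cnj (u $ e - Complex 0 r)"
  proof -
    have four: "4 * rho2 e z v = (\<Sum>j\<in>UNIV - {e}. (z $ j - cnj (v $ j))\<^sup>2) - 2 * \<i> * (z $ e - cnj (v $ e))" for v
      by (simp add: rho2_def)
    show ?thesis
      unfolding right_diff_distrib four by (simp add: ctr_nth sum_subtractf algebra_simps)
  qed
  then have "cmod (4 * (rho2 e z u - rho2 e z (ctr e r))) \<le>
      cmod (\<Sum>j\<in>UNIV - {e}. (z $ j - cnj (u $ j))\<^sup>2 - (z $ j)\<^sup>2) + cmod (2 * \<i> * cnj (u $ e - Complex 0 r))"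
    by (simp only: norm_triangle_ineq)
  also have "\<dots> \<le> (\<Sum>j\<in>UNIV - {e}. 12 * (d * P)) + 2 * (4 * (d * P))"
  proof (rule add_mono)
    show "cmod (\<Sum>j\<in>UNIV - {e}. (z $ j - cnj (u $ j))\<^sup>2 - (z $ j)\<^sup>2) \<le> (\<Sum>j\<in>UNIV - {e}. 12 * (d * P))"
      by (rule sum_norm_le) (use summand in auto)
    have "cmod (2 * \<i> * cnj (u $ e - Complex 0 r)) = 2 * cmod (u $ e - Complex 0 r)"
      by (simp only: norm_mult complex_mod_cnj) simp
    then show "cmod (2 * \<i> * cnj (u $ e - Complex 0 r)) \<le> 2 * (4 * (d * P))" using ue by linarith
  qed
  also have "\<dots> = (real CARD('n) - 1) * (12 * (d * P)) + 2 * (4 * (d * P))"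
    using n1 by (simp add: of_nat_diff)
  \<comment> \<open>12 d P from each of n-1 coordinates and 8 d P from the last one; division by 4
    yields the constant 3n.\<close>
  also have "\<dots> \<le> 12 * (real CARD('n) * d * P)"
    using d by (simp add: algebra_simps P_def)
  finally have "4 * cmod (rho2 e z u - rho2 e z (ctr e r)) \<le> 12 * (real CARD('n) * d * P)"
    by (simp only: norm_mult norm_numeral)
  then show ?thesis by (simp add: P_def mult_ac)
qed

lemma rho2_ctr_ctr: "rho2 e (ctr e r) (ctr e r) = complex_of_real r"
  by (intro complex_eqI) (simp_all add: Re_rho2 Im_rho2)

text \<open>The reference point (0, i s) may lie far below the box of size r. The case s = r serves
  the scaling bound, and s = 1 with r = 4^k the divergence at infinity.\<close>

lemma cmod_rho2_Ebox:
  fixes e :: "'n::finite"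
  assumes d: "0 < d" "3 * real CARD('n) * d \<le> 1" and r: "0 < s" "s \<le> r" and z: "z \<in> Ebox e d r"
  shows "r / 4 \<le> cmod (rho2 e z (ctr e s))" "cmod (rho2 e z (ctr e s)) \<le> 4 * r"
proof -
  have r0: "0 < r" using r by simp
  note zE = Ebox_rho1[OF d r0 z]
  show "r / 4 \<le> cmod (rho2 e z (ctr e s))"
    using rho1_le_cmod_rho2(1)[OF zE(3) ctr_in_TB[OF r(1)]] zE(1) by linarith
  have "cmod (rho2 e (ctr e r) z - rho2 e (ctr e r) (ctr e r)) \<le> 3 * real CARD('n) * d * cmod (rho2 e (ctr e r) (ctr e r))"
    by (rule rho2_ctr_perturb[OF d r0 z ctr_in_TB[OF r0]])
  also have "\<dots> \<le> 1 * r" using d r0 by (intro mult_mono) (auto simp: rho2_ctr_ctr)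
  finally have "cmod (rho2 e (ctr e r) z) \<le> 2 * r"
    using norm_triangle_ineq2[of "rho2 e (ctr e r) z" "rho2 e (ctr e r) (ctr e r)"] r0 by (simp add: rho2_ctr_ctr)
  then have 1: "cmod (rho2 e z (ctr e r)) \<le> 2 * r" by (simp add: cmod_rho2_commute[of e z])
  have "rho2 e z (ctr e s) - rho2 e z (ctr e r) = complex_of_real ((s - r) / 2)"
    by (intro complex_eqI) (simp_all add: Re_rho2 Im_rho2 ctr_nth diff_divide_distrib add_divide_distrib cong: sum.cong_simp)
  then have "cmod (rho2 e z (ctr e s) - rho2 e z (ctr e r)) \<le> r"
    using r by (simp del: of_real_divide of_real_diff)
  then show "cmod (rho2 e z (ctr e s)) \<le> 4 * r"
    using 1 norm_triangle_ineq2[of "rho2 e z (ctr e s)" "rho2 e z (ctr e r)"] r0 by linarith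
qed

section \<open>Lower bounds from test functions\<close>

lemma nn_integral_Ebox_ge:
  fixes e :: "'n::finite" and t x :: real
  assumes d: "0 < d" "3 * real CARD('n) * d \<le> 1"
  obtains K where "0 < K" "\<And>r s. 0 < s \<Longrightarrow> s \<le> r \<Longrightarrow> ennreal (K * r powr (real CARD('n) + 1 + t - x)) \<le>
    (\<integral>\<^sup>+z. indicator (Ebox e d r) z * ennreal (rho1 e z powr t * cmod (rho2 e (ctr e s) z) powr (-x)) \<partial>lborel)"
proof -
  define k where "k = 4 powr (-\<bar>t\<bar>) * 4 powr (-\<bar>-x\<bar>)"
  define v where "v = (2 * d) ^ (2 * CARD('n))"
  have kv: "0 < k" "0 < v" using d by (auto simp: k_def v_def)
  show ?thesis
  proof (rule that)
    show "0 < k * v" using kv by simp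
    fix r s :: real assume s: "0 < s" "s \<le> r"
    have r: "0 < r" using s by simp
    have "ennreal (k * v * r powr (real CARD('n) + 1 + t - x)) = ennreal (k * r powr (t - x)) * emeasure lborel (Ebox e d r)"
      using r kv d by (simp add: emeasure_Ebox v_def powr_add[symmetric] mult_ac flip: ennreal_mult)
        (simp add: algebra_simps flip: powr_add)
    also have "\<dots> = (\<integral>\<^sup>+z. ennreal (k * r powr (t - x)) * indicator (Ebox e d r) z \<partial>lborel)"
      by (simp add: nn_integral_cmult)
    also have "\<dots> \<le> (\<integral>\<^sup>+z. indicator (Ebox e d r) z * ennreal (rho1 e z powr t * cmod (rho2 e (ctr e s) z) powr (-x)) \<partial>lborel)"
    proof (rule nn_integral_mono)
      fix z
      have "k * r powr (t - x) \<le> rho1 e z powr t * cmod (rho2 e (ctr e s) z) powr (-x)" if z: "z \<in> Ebox e d r"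
      proof -
        have "4 powr (-\<bar>t\<bar>) * r powr t \<le> rho1 e z powr t"
          using Ebox_rho1[OF d r z] r by (intro powr_comparable) auto
        moreover have "4 powr (-\<bar>-x\<bar>) * r powr (-x) \<le> cmod (rho2 e (ctr e s) z) powr (-x)"
          using cmod_rho2_Ebox[OF d s z] r unfolding cmod_rho2_commute[of e z] by (intro powr_comparable) auto
        ultimately have "(4 powr (-\<bar>t\<bar>) * r powr t) * (4 powr (-\<bar>-x\<bar>) * r powr (-x)) \<le> rho1 e z powr t * cmod (rho2 e (ctr e s) z) powr (-x)"
          by (intro mult_mono) auto
        moreover have "r powr (t - x) = r powr t * r powr (-x)" by (simp flip: powr_add)
        ultimately show ?thesis by (simp add: k_def mult_ac)
      qed
      then show "ennreal (k * r powr (t - x)) * indicator (Ebox e d r) z \<le>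
          indicator (Ebox e d r) z * ennreal (rho1 e z powr t * cmod (rho2 e (ctr e s) z) powr (-x))"
        by (auto simp: indicator_def ennreal_leI)
    qed
    finally show "ennreal (k * v * r powr (real CARD('n) + 1 + t - x)) \<le>
      (\<integral>\<^sup>+z. indicator (Ebox e d r) z * ennreal (rho1 e z powr t * cmod (rho2 e (ctr e s) z) powr (-x)) \<partial>lborel)" .
  qed
qed

text \<open>Target norm, in one variable, of the kernel frozen at the centre of a box of size r,
  which is the profile of the image of the indicator of that box. The exponent 0 leaves the weight
  in u to be counted separately.\<close>

definition Nctr :: "'n::finite \<Rightarrow> real \<Rightarrow> real \<Rightarrow> real \<Rightarrow> real \<Rightarrow> real \<Rightarrow> ennreal" where
  "Nctr e be q a c r = Lnorm (wmeas e be) q (\<lambda>z. Pker e a 0 c z (ctr e r))"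

lemma epow_Nctr:
  assumes "q \<noteq> 0" "0 < r"
  shows "epow (Nctr e be q a c r) q =
    (\<integral>\<^sup>+z. indicator (TB e) z * ennreal (rho1 e z powr (q * a + be) * cmod (rho2 e (ctr e r) z) powr (- (c * q))) \<partial>lborel)"
  using assms by (simp add: Nctr_def epow_Lnorm nn_integral_epow_Pker ctr_in_TB)

lemma Nctr_ge:
  fixes e :: "'n::finite"
  assumes d: "0 < d" "3 * real CARD('n) * d \<le> 1" and q: "0 < q"
  obtains K where "0 < K" "\<And>r. 0 < r \<Longrightarrow> ennreal (K * r powr (a - c + (real CARD('n) + 1 + be) / q)) \<le> Nctr e be q a c r"
proof -
  obtain K where K: "0 < K" "\<And>r s. 0 < s \<Longrightarrow> s \<le> r \<Longrightarrow> ennreal (K * r powr (real CARD('n) + 1 + (q * a + be) - c * q)) \<le>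
    (\<integral>\<^sup>+z. indicator (Ebox e d r) z * ennreal (rho1 e z powr (q * a + be) * cmod (rho2 e (ctr e s) z) powr (-(c * q))) \<partial>lborel)"
    using nn_integral_Ebox_ge[OF d] by blast
  show ?thesis
  proof (rule that)
    show "0 < K powr (1 / q)" using K by simp
    fix r :: real assume r: "0 < r"
    have "ennreal (K * r powr (real CARD('n) + 1 + (q * a + be) - c * q)) \<le> epow (Nctr e be q a c r) q"
      unfolding epow_Nctr[OF less_imp_neq[OF q, symmetric] r]
      by (rule order_trans[OF K(2)[OF r order_refl]])
        (use Ebox_rho1(3)[OF d r] in \<open>auto intro!: nn_integral_mono simp: indicator_def\<close>)
    then have "epow (ennreal (K * r powr (real CARD('n) + 1 + (q * a + be) - c * q))) (1 / q) \<le> epow (epow (Nctr e be q a c r) q) (1 / q)"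
      using q by (intro epow_mono) auto
    moreover have "(real CARD('n) + 1 + (q * a + be) - c * q) * (1 / q) = a - c + (real CARD('n) + 1 + be) / q"
      using q by (simp add: field_simps)
    ultimately show "ennreal (K powr (1 / q) * r powr (a - c + (real CARD('n) + 1 + be) / q)) \<le> Nctr e be q a c r"
      using q K(1) by (simp add: epow_epow epow_ennreal powr_mult powr_powr)
  qed
qed

lemma Lnorm_indicator_Ebox_le:
  fixes e :: "'n::finite"
  assumes d: "0 < d" "3 * real CARD('n) * d \<le> 1" and p: "0 < p"
  obtains K where "0 < K" "\<And>r. 0 < r \<Longrightarrow> Lnorm (wmeas e al) p (indicator (Ebox e d r)) \<le> ennreal (K * r powr ((real CARD('n) + 1 + al) / p))"
proof -
  define K where "K = 4 powr \<bar>al\<bar> * (2 * d) ^ (2 * CARD('n))"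
  have K: "0 < K" using d by (simp add: K_def)
  show ?thesis
  proof (rule that)
    show "0 < K powr (1 / p)" using K by simp
    fix r :: real assume r: "0 < r"
    have "(\<integral>\<^sup>+z. epow (indicator (Ebox e d r) z) p \<partial>wmeas e al) \<le> (\<integral>\<^sup>+z. ennreal (4 powr \<bar>al\<bar> * r powr al) * indicator (Ebox e d r) z \<partial>lborel)"
    proof (subst nn_integral_wmeas)
      have "ennreal (rho1 e z powr al) \<le> ennreal (4 powr \<bar>al\<bar> * r powr al)" if "z \<in> Ebox e d r" for z
        using Ebox_rho1[OF d r that] r by (intro ennreal_leI powr_comparable) auto
      then show "(\<integral>\<^sup>+z. indicator (TB e) z * ennreal (rho1 e z powr al) * epow (indicator (Ebox e d r) z) p \<partial>lborel) \<le>
          (\<integral>\<^sup>+z. ennreal (4 powr \<bar>al\<bar> * r powr al) * indicator (Ebox e d r) z \<partial>lborel)"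
        by (intro nn_integral_mono) (auto simp: indicator_def)
    qed measurable
    also have "\<dots> = ennreal (4 powr \<bar>al\<bar> * r powr al) * emeasure lborel (Ebox e d r)"
      by (simp add: nn_integral_cmult)
    also have "\<dots> = ennreal (K * r powr (real CARD('n) + 1 + al))"
      using r d by (simp add: emeasure_Ebox K_def powr_add mult_ac flip: ennreal_mult)
    finally have "Lnorm (wmeas e al) p (indicator (Ebox e d r)) \<le> epow (ennreal (K * r powr (real CARD('n) + 1 + al))) (1 / p)"
      unfolding Lnorm_def using p by (intro epow_mono) auto
    also have "\<dots> = ennreal (K powr (1 / p) * r powr ((real CARD('n) + 1 + al) / p))"
      using K by (simp add: epow_ennreal powr_mult powr_powr)
    finally show "Lnorm (wmeas e al) p (indicator (Ebox e d r)) \<le> ennreal (K powr (1 / p) * r powr ((real CARD('n) + 1 + al) / p))" .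
  qed
qed

section \<open>Test functions without cancellation\<close>

lemma Lnorm_product:
  assumes [measurable]: "F \<in> borel_measurable M" "G \<in> borel_measurable N" and "p \<noteq> 0" "q \<noteq> 0"
  shows "Lnorm N q (\<lambda>w. Lnorm M p (\<lambda>z. F z * G w)) = Lnorm M p F * Lnorm N q G"
  using assms by (simp add: Lnorm_multc Lnorm_cmult)

text \<open>Freezing k at k0 gives |k0| times the integral of the positive weight over E, and the
  error is at most \<open>th\<close> times this. An oscillating kernel is thus treated like a
  positive one.\<close>

lemma norm_integral_ge:
  fixes k :: "'a \<Rightarrow> complex" and \<phi> :: "'a \<Rightarrow> real"
  assumes [measurable]: "E \<in> sets M" "\<phi> \<in> borel_measurable M" "k \<in> borel_measurable M"
    and fin: "emeasure M E < \<infinity>" and m: "0 \<le> m" and th: "0 \<le> th" "th \<le> 1"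
    and phi: "\<And>y. y \<in> E \<Longrightarrow> m \<le> \<phi> y \<and> \<phi> y \<le> m'"
    and k: "\<And>y. y \<in> E \<Longrightarrow> cmod (k y - k0) \<le> th * cmod k0"
  shows "(1 - th) * cmod k0 * (m * measure M E) \<le> cmod (LINT y|M. indicator E y *\<^sub>R (complex_of_real (\<phi> y) * k y))"
proof -
  have "\<bar>\<phi> y\<bar> \<le> m'" if "y \<in> E" for y using phi[OF that] m by linarith
  then have int1: "integrable M (\<lambda>y. indicator E y *\<^sub>R \<phi> y)"
    by (intro integrableI_bounded_set_indicator[where B = m'] fin) (auto intro!: AE_I2)
  have int2: "integrable M (\<lambda>y. indicator E y *\<^sub>R (complex_of_real (\<phi> y) * (k y - k0)))"
  proof (intro integrableI_bounded_set_indicator[where B = "m' * (th * cmod k0)"] fin AE_I2 impI)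
    fix y assume "y \<in> E"
    then show "norm (complex_of_real (\<phi> y) * (k y - k0)) \<le> m' * (th * cmod k0)"
      using phi[of y] k[of y] m by (auto simp: norm_mult intro!: mult_mono)
  qed measurable
  define J where "J = (LINT y|M. indicator E y *\<^sub>R \<phi> y)"
  have "m * measure M E = (LINT y|M. indicator E y *\<^sub>R m)"
    using fin by (simp add: mult.commute less_top[symmetric])
  also have "\<dots> \<le> J"
    unfolding J_def
    by (intro integral_mono int1 integrableI_bounded_set_indicator[where B = m] fin) (use phi m in \<open>auto simp: indicator_def\<close>)
  finally have J: "m * measure M E \<le> J" .
  have "(LINT y|M. indicator E y *\<^sub>R (complex_of_real (\<phi> y) * k y)) =
     (LINT y|M. complex_of_real (indicator E y *\<^sub>R \<phi> y) * k0 + indicator E y *\<^sub>R (complex_of_real (\<phi> y) * (k y - k0)))"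
    by (intro Bochner_Integration.integral_cong) (auto simp: indicator_def algebra_simps)
  also have "\<dots> = (LINT y|M. complex_of_real (indicator E y *\<^sub>R \<phi> y) * k0) + (LINT y|M. indicator E y *\<^sub>R (complex_of_real (\<phi> y) * (k y - k0)))"
    using int1 by (intro Bochner_Integration.integral_add int2 integrable_mult_left integrable_of_real)
  also have "(LINT y|M. complex_of_real (indicator E y *\<^sub>R \<phi> y) * k0) = complex_of_real J * k0"
    unfolding J_def by (simp only: integral_mult_left_zero integral_complex_of_real)
  finally have eq: "(LINT y|M. indicator E y *\<^sub>R (complex_of_real (\<phi> y) * k y)) =
      complex_of_real J * k0 + (LINT y|M. indicator E y *\<^sub>R (complex_of_real (\<phi> y) * (k y - k0)))" .
  have "cmod (LINT y|M. indicator E y *\<^sub>R (complex_of_real (\<phi> y) * (k y - k0))) \<le>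
      (LINT y|M. norm (indicator E y *\<^sub>R (complex_of_real (\<phi> y) * (k y - k0))))"
    by (rule integral_norm_bound)
  also have "\<dots> \<le> (LINT y|M. (indicator E y *\<^sub>R \<phi> y) * (th * cmod k0))"
  proof (rule integral_mono)
    fix y
    show "norm (indicator E y *\<^sub>R (complex_of_real (\<phi> y) * (k y - k0))) \<le> (indicator E y *\<^sub>R \<phi> y) * (th * cmod k0)"
      using phi[of y] k[of y] m by (cases "y \<in> E") (auto simp: norm_mult intro!: mult_mono)
  qed (intro integrable_norm integrable_mult_left int1 int2)+
  also have "\<dots> = J * (th * cmod k0)" unfolding J_def by (simp only: integral_mult_left_zero)
  finally have err: "cmod (LINT y|M. indicator E y *\<^sub>R (complex_of_real (\<phi> y) * (k y - k0))) \<le> J * (th * cmod k0)" .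
  have J0: "0 \<le> J" by (rule order_trans[OF mult_nonneg_nonneg[OF m measure_nonneg] J])
  have "(1 - th) * cmod k0 * (m * measure M E) \<le> (1 - th) * cmod k0 * J"
    using J th by (intro mult_left_mono) auto
  also have "\<dots> = cmod (complex_of_real J * k0) - J * (th * cmod k0)"
    using J0 by (simp add: norm_mult algebra_simps)
  also have "\<dots> \<le> cmod (complex_of_real J * k0) - cmod (LINT y|M. indicator E y *\<^sub>R (complex_of_real (\<phi> y) * (k y - k0)))"
    using err by simp
  also have "\<dots> \<le> cmod (LINT y|M. indicator E y *\<^sub>R (complex_of_real (\<phi> y) * k y))"
    unfolding eq by (rule norm_diff_ineq)
  finally show ?thesis .
qed

lemma Ebox_Times_measurable [measurable]: "Ebox e d r \<times> Ebox e d s \<in> sets borel"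
  using pair_measureI[OF Ebox_measurable Ebox_measurable, of e d r e d s] by (simp only: borel_prod)

lemma emeasure_Ebox_Times:
  fixes e :: "'n::finite"
  assumes "0 < d" "0 < r" "0 < s"
  shows "emeasure lborel (Ebox e d r \<times> Ebox e d s) =
    ennreal (((2 * d) ^ (2 * CARD('n)))\<^sup>2 * (r powr (real CARD('n) + 1) * s powr (real CARD('n) + 1)))"
proof -
  have "emeasure lborel (Ebox e d r \<times> Ebox e d s) = emeasure (lborel \<Otimes>\<^sub>M lborel) (Ebox e d r \<times> Ebox e d s)"
    by (simp only: lborel_prod)
  also have "\<dots> = emeasure lborel (Ebox e d r) * emeasure lborel (Ebox e d s)"
    by (rule lborel.emeasure_pair_measure_Times) auto
  finally show ?thesis
    using assms by (simp add: emeasure_Ebox power2_eq_square mult_ac flip: ennreal_mult)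
qed

text \<open>1/16 + 1/4 + 1/4 = 9/16 is still below 1; the remaining 7/16 is the loss in the test
  inequality.\<close>

lemma cmod_mult_perturb:
  assumes "cmod (x - x0) \<le> cmod x0 / 4" "cmod (y - y0) \<le> cmod y0 / 4"
  shows "cmod (x * y - x0 * y0) \<le> 9 / 16 * cmod (x0 * y0)"
proof -
  have eq: "x * y - x0 * y0 = (x - x0) * (y - y0) + ((x - x0) * y0 + x0 * (y - y0))"
    by (simp add: algebra_simps)
  have "cmod (x * y - x0 * y0) \<le> cmod ((x - x0) * (y - y0)) + (cmod ((x - x0) * y0) + cmod (x0 * (y - y0)))"
    unfolding eq by (intro norm_triangle_le add_left_mono norm_triangle_ineq)
  also have "\<dots> \<le> cmod x0 / 4 * (cmod y0 / 4) + (cmod x0 / 4 * cmod y0 + cmod x0 * (cmod y0 / 4))"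
    unfolding norm_mult using assms by (intro add_mono mult_mono) auto
  finally show ?thesis by (simp add: norm_mult)
qed

lemma bounded_op_test_inequality:
  fixes e :: "'n::finite" and p1 p2 q1 q2 a1 a2 b1 b2 c1 c2 al1 al2 be1 be2 :: real
  defines "n \<equiv> real CARD('n)"
  assumes k: "pow_kernel c1 k1" "pow_kernel c2 k2" and pos: "0 < p1" "0 < p2" "0 < q1" "0 < q2"
    and bd: "bounded_op e a1 a2 (Gker e b1 b2 k1 k2) p1 p2 al1 al2 q1 q2 be1 be2"
  obtains C where "0 < C" "\<And>r s. 0 < r \<Longrightarrow> 0 < s \<Longrightarrow>
    ennreal (r powr (b1 + (n + 1)) * s powr (b2 + (n + 1))) * (Nctr e be1 q1 a1 c1 r * Nctr e be2 q2 a2 c2 s)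
      \<le> ennreal (C * (r powr ((n + 1 + al1) / p1) * s powr ((n + 1 + al2) / p2)))"
proof -
  have n1: "1 \<le> n" using zero_less_card_finite[where 'a = 'n] unfolding n_def by linarith
  obtain ep1 where ep1: "0 < ep1" "\<And>x y. 0 < Re x \<Longrightarrow> 0 < Re y \<Longrightarrow> cmod (x - y) \<le> ep1 * cmod y \<Longrightarrow> cmod (k1 x - k1 y) \<le> cmod (k1 y) / 4"
    using k(1) unfolding pow_kernel_def by blast
  obtain ep2 where ep2: "0 < ep2" "\<And>x y. 0 < Re x \<Longrightarrow> 0 < Re y \<Longrightarrow> cmod (x - y) \<le> ep2 * cmod y \<Longrightarrow> cmod (k2 x - k2 y) \<le> cmod (k2 y) / 4"
    using k(2) unfolding pow_kernel_def by blast
  \<comment> \<open>Makes 3 n d at most 1, as the box estimates require, and at most both tolerances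
    for slow variation of the kernels.\<close>
  define d where "d = min 1 (min ep1 ep2) / (3 * n)"
  have d: "0 < d" using ep1 ep2 n1 by (simp add: d_def)
  have "3 * n * d = min 1 (min ep1 ep2)" using n1 by (simp add: d_def)
  then have d1: "3 * real CARD('n) * d \<le> 1" "3 * real CARD('n) * d \<le> ep1" "3 * real CARD('n) * d \<le> ep2"
    by (auto simp: n_def)
  note km = pow_kernel_measurable[OF k(1)] pow_kernel_measurable[OF k(2)]
  let ?K = "Gker e b1 b2 k1 k2"
  obtain K1 where K1: "0 < K1" "\<And>r. 0 < r \<Longrightarrow> Lnorm (wmeas e al1) p1 (indicator (Ebox e d r)) \<le> ennreal (K1 * r powr ((n + 1 + al1) / p1))"
    using Lnorm_indicator_Ebox_le[OF d d1(1) pos(1)] unfolding n_def by blast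
  obtain K2 where K2: "0 < K2" "\<And>r. 0 < r \<Longrightarrow> Lnorm (wmeas e al2) p2 (indicator (Ebox e d r)) \<le> ennreal (K2 * r powr ((n + 1 + al2) / p2))"
    using Lnorm_indicator_Ebox_le[OF d d1(1) pos(2)] unfolding n_def by blast
  obtain C0 where C0: "\<And>f. f \<in> Lspace e p1 p2 al1 al2 \<Longrightarrow> mixnorm e q1 q2 be1 be2 (intop e a1 a2 ?K f) \<le> ennreal C0 * mixnorm e p1 p2 al1 al2 f"
    using bd unfolding bounded_op_def by blast
  define C1 where "C1 = max C0 1"
  have C1: "0 < C1" "ennreal C0 \<le> ennreal C1" by (auto simp: C1_def intro: ennreal_leI)
  define v where "v = ((2 * d) ^ (2 * CARD('n)))\<^sup>2"
  define \<kappa> where "\<kappa> = 7 / 16 * (4 powr (-\<bar>b1\<bar>) * 4 powr (-\<bar>b2\<bar>) * v)"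
  have v: "0 < v" using d by (simp add: v_def)
  have \<kappa>: "0 < \<kappa>" using v by (simp add: \<kappa>_def)
  show ?thesis
  proof (rule that)
    show "0 < C1 * (K1 * K2) / \<kappa>" using C1 K1 K2 \<kappa> by simp
    fix r s :: real assume r: "0 < r" and s: "0 < s"
    define E where "E = Ebox e d r \<times> Ebox e d s"
    have [measurable]: "E \<in> sets borel" by (simp add: E_def)
    have E_TB: "E \<subseteq> TB e \<times> TB e" using Ebox_rho1(3)[OF d d1(1)] r s by (auto simp: E_def)
    define f where "f x = complex_of_real (indicator E x)" for x
    have f [measurable]: "f \<in> borel_measurable borel" unfolding f_def by measurable
    have f': "f \<in> borel_measurable lebesgue" using f by (intro measurable_completion) simp
    have "mixnorm e p1 p2 al1 al2 f = Lnorm (wmeas e al2) p2 (\<lambda>w. Lnorm (wmeas e al1) p1 (\<lambda>z. indicator (Ebox e d r) z * indicator (Ebox e d s) w))"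
      using pos by (subst mixnorm_eq_Lnorm) (auto intro!: Lnorm_cong simp: f_def E_def indicator_def)
    also have "\<dots> = Lnorm (wmeas e al1) p1 (indicator (Ebox e d r)) * Lnorm (wmeas e al2) p2 (indicator (Ebox e d s))"
      using pos by (intro Lnorm_product) auto
    also have "\<dots> \<le> ennreal (K1 * r powr ((n + 1 + al1) / p1)) * ennreal (K2 * s powr ((n + 1 + al2) / p2))"
      using r s by (intro mult_mono K1 K2) auto
    also have "\<dots> = ennreal (K1 * K2 * (r powr ((n + 1 + al1) / p1) * s powr ((n + 1 + al2) / p2)))"
      using K1 K2 by (simp add: mult_ac flip: ennreal_mult)
    finally have f_norm: "mixnorm e p1 p2 al1 al2 f \<le> ennreal (K1 * K2 * (r powr ((n + 1 + al1) / p1) * s powr ((n + 1 + al2) / p2)))" .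
    then have "f \<in> Lspace e p1 p2 al1 al2"
      using f' by (auto simp: Lspace_def intro: le_less_trans)
    from C0[OF this] have up: "mixnorm e q1 q2 be1 be2 (intop e a1 a2 ?K f) \<le>
        ennreal C1 * ennreal (K1 * K2 * (r powr ((n + 1 + al1) / p1) * s powr ((n + 1 + al2) / p2)))"
      by (rule order_trans[OF _ mult_mono[OF C1(2) f_norm]]) auto
    have op_meas [measurable]: "intop e a1 a2 ?K f \<in> borel_measurable borel"
      by (rule intop_Gker_measurable[OF km f])
    define R where "R = r powr (b1 + (n + 1)) * s powr (b2 + (n + 1))"
    have pt: "ennreal (\<kappa> * R) * (Pker e a1 0 c1 z (ctr e r) * Pker e a2 0 c2 w (ctr e s)) \<le> ennreal (norm (intop e a1 a2 ?K f (z, w)))"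
      if z: "z \<in> TB e" and w: "w \<in> TB e" for z w
    proof -
      note cz = Re_rho2_pos[OF z ctr_in_TB[OF r]] and cw = Re_rho2_pos[OF w ctr_in_TB[OF s]]
      define k0 where "k0 = k1 (rho2 e z (ctr e r)) * k2 (rho2 e w (ctr e s))"
      define \<phi> where "\<phi> y = rho1 e (fst y) powr b1 * rho1 e (snd y) powr b2" for y :: "(complex^'n) \<times> (complex^'n)"
      define kk where "kk y = k1 (rho2 e z (fst y)) * k2 (rho2 e w (snd y))" for y
      have [measurable]: "(\<lambda>x :: (complex^'n) \<times> (complex^'n). fst x) \<in> borel_measurable borel"
         "(\<lambda>x :: (complex^'n) \<times> (complex^'n). snd x) \<in> borel_measurable borel"
        by (auto simp: borel_prod[symmetric])
      note [measurable] = km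
      have [measurable]: "\<phi> \<in> borel_measurable borel" "kk \<in> borel_measurable borel"
        unfolding \<phi>_def kk_def by measurable
      define m where "m = (4 powr (-\<bar>b1\<bar>) * r powr b1) * (4 powr (-\<bar>b2\<bar>) * s powr b2)"
      define m' where "m' = (4 powr \<bar>b1\<bar> * r powr b1) * (4 powr \<bar>b2\<bar> * s powr b2)"
      have phi: "m \<le> \<phi> y \<and> \<phi> y \<le> m'" if "y \<in> E" for y
      proof -
        have y: "fst y \<in> Ebox e d r" "snd y \<in> Ebox e d s" using that by (auto simp: E_def)
        note b1 = powr_comparable[OF r, of "rho1 e (fst y)" b1] and b2 = powr_comparable[OF s, of "rho1 e (snd y)" b2]
        show ?thesis
          unfolding m_def m'_def \<phi>_def
          using Ebox_rho1[OF d d1(1) r y(1)] Ebox_rho1[OF d d1(1) s y(2)] r s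
          by (intro conjI mult_mono b1 b2) auto
      qed
      have kk: "cmod (kk y - k0) \<le> 9 / 16 * cmod k0" if "y \<in> E" for y
      proof -
        have y: "fst y \<in> Ebox e d r" "snd y \<in> Ebox e d s" using that by (auto simp: E_def)
        have yTB: "fst y \<in> TB e" "snd y \<in> TB e" using that E_TB by auto
        have "cmod (rho2 e z (fst y) - rho2 e z (ctr e r)) \<le> ep1 * cmod (rho2 e z (ctr e r))"
          by (rule order_trans[OF rho2_ctr_perturb[OF d d1(1) r y(1) z]]) (intro mult_right_mono d1 norm_ge_zero)
        moreover have "cmod (rho2 e w (snd y) - rho2 e w (ctr e s)) \<le> ep2 * cmod (rho2 e w (ctr e s))"
          by (rule order_trans[OF rho2_ctr_perturb[OF d d1(1) s y(2) w]]) (intro mult_right_mono d1 norm_ge_zero)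
        ultimately show ?thesis
          unfolding kk_def k0_def
          by (intro cmod_mult_perturb ep1(2) ep2(2) cz cw Re_rho2_pos z w yTB)
      qed
      have mE: "emeasure lborel E = ennreal (v * (r powr (n + 1) * s powr (n + 1)))"
        unfolding E_def v_def n_def by (rule emeasure_Ebox_Times[OF d r s])
      have "(1 - 9 / 16) * cmod k0 * (m * measure lborel E) \<le> cmod (LINT y|lborel. indicator E y *\<^sub>R (complex_of_real (\<phi> y) * kk y))"
        by (rule norm_integral_ge[where m' = m']) (use mE phi kk in \<open>auto simp: m_def\<close>)
      also have "(LINT y|lborel. indicator E y *\<^sub>R (complex_of_real (\<phi> y) * kk y)) =
          (LINT y|lborel. indicator (TB e \<times> TB e) y *\<^sub>R (?K z w y * f y))"
        using E_TB by (intro Bochner_Integration.integral_cong) (auto simp: indicator_def f_def Gker_def \<phi>_def kk_def)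
      also have "\<dots> = (LINT y:(TB e \<times> TB e)|lebesgue. ?K z w y * f y)"
        by (rule Gker_integral_borel_version(2)[OF km f' f AE_I2[OF refl], symmetric])
      finally have low: "(1 - 9 / 16) * cmod k0 * (m * measure lborel E) \<le> cmod (LINT y:(TB e \<times> TB e)|lebesgue. ?K z w y * f y)" .
      have "(1 - 9 / 16) * cmod k0 * (m * measure lborel E) = \<kappa> * R * cmod k0"
        using mE v r s unfolding measure_def by (simp add: m_def \<kappa>_def R_def powr_add)
      with low have low: "\<kappa> * R * cmod k0 \<le> cmod (LINT y:(TB e \<times> TB e)|lebesgue. ?K z w y * f y)" by (simp only:)
      have k0: "cmod k0 = cmod (rho2 e z (ctr e r)) powr (-c1) * cmod (rho2 e w (ctr e s)) powr (-c2)"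
        by (simp add: k0_def norm_mult cmod_pow_kernel[OF k(1) cz] cmod_pow_kernel[OF k(2) cw])
      have "ennreal (\<kappa> * R) * (Pker e a1 0 c1 z (ctr e r) * Pker e a2 0 c2 w (ctr e s)) =
          ennreal ((rho1 e z powr a1 * rho1 e w powr a2) * (\<kappa> * R * cmod k0))"
        unfolding k0 using z w r s \<kappa> by (simp add: Pker_def ctr_in_TB R_def mult_ac flip: ennreal_mult)
      also have "\<dots> \<le> ennreal ((rho1 e z powr a1 * rho1 e w powr a2) * cmod (LINT y:(TB e \<times> TB e)|lebesgue. ?K z w y * f y))"
        by (intro ennreal_leI mult_left_mono low) auto
      also have "\<dots> = ennreal (norm (intop e a1 a2 ?K f (z, w)))"
        by (simp add: intop_def norm_mult)
      finally show ?thesis .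
    qed
    have "ennreal (\<kappa> * R) * (Nctr e be1 q1 a1 c1 r * Nctr e be2 q2 a2 c2 s) =
       Lnorm (wmeas e be2) q2 (\<lambda>w. Lnorm (wmeas e be1) q1 (\<lambda>z. (ennreal (\<kappa> * R) * Pker e a1 0 c1 z (ctr e r)) * Pker e a2 0 c2 w (ctr e s)))"
      using pos by (subst Lnorm_product) (auto simp: Lnorm_cmult Nctr_def mult.assoc)
    also have "\<dots> \<le> Lnorm (wmeas e be2) q2 (\<lambda>w. Lnorm (wmeas e be1) q1 (\<lambda>z. ennreal (norm (intop e a1 a2 ?K f (z, w)))))"
    proof (rule Lnorm_mono_AE[OF pos(4)])
      have "Lnorm (wmeas e be1) q1 (\<lambda>z. (ennreal (\<kappa> * R) * Pker e a1 0 c1 z (ctr e r)) * Pker e a2 0 c2 w (ctr e s)) \<le>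
          Lnorm (wmeas e be1) q1 (\<lambda>z. ennreal (norm (intop e a1 a2 ?K f (z, w))))" if "w \<in> TB e" for w
        using pt[OF _ that] by (intro Lnorm_mono_AE pos) (auto simp: AE_wmeas_iff mult.assoc)
      then show "AE w in wmeas e be2. Lnorm (wmeas e be1) q1 (\<lambda>z. (ennreal (\<kappa> * R) * Pker e a1 0 c1 z (ctr e r)) * Pker e a2 0 c2 w (ctr e s)) \<le>
          Lnorm (wmeas e be1) q1 (\<lambda>z. ennreal (norm (intop e a1 a2 ?K f (z, w))))"
        by (simp add: AE_wmeas_iff)
    qed
    also have "\<dots> = mixnorm e q1 q2 be1 be2 (intop e a1 a2 ?K f)"
      by (rule mixnorm_eq_Lnorm[symmetric]) (use pos in auto)
    also note up
    finally have "ennreal (1 / \<kappa>) * (ennreal (\<kappa> * R) * (Nctr e be1 q1 a1 c1 r * Nctr e be2 q2 a2 c2 s)) \<le>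
       ennreal (1 / \<kappa>) * (ennreal C1 * ennreal (K1 * K2 * (r powr ((n + 1 + al1) / p1) * s powr ((n + 1 + al2) / p2))))"
      by (rule mult_left_mono) simp
    moreover have "ennreal (1 / \<kappa>) * ennreal (\<kappa> * R) = ennreal R"
      using \<kappa> by (simp add: R_def flip: ennreal_mult)
    moreover have "ennreal (1 / \<kappa>) * (ennreal C1 * ennreal (K1 * K2 * (r powr ((n + 1 + al1) / p1) * s powr ((n + 1 + al2) / p2)))) =
       ennreal (C1 * (K1 * K2) / \<kappa> * (r powr ((n + 1 + al1) / p1) * s powr ((n + 1 + al2) / p2)))"
      using \<kappa> C1(1) K1(1) K2(1) by (simp flip: ennreal_mult)
    ultimately show "ennreal (r powr (b1 + (n + 1)) * s powr (b2 + (n + 1))) * (Nctr e be1 q1 a1 c1 r * Nctr e be2 q2 a2 c2 s)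
      \<le> ennreal (C1 * (K1 * K2) / \<kappa> * (r powr ((n + 1 + al1) / p1) * s powr ((n + 1 + al2) / p2)))"
      unfolding R_def by (simp only: mult.assoc[symmetric])
  qed
qed

section \<open>Necessity\<close>

text \<open>If x and y differ, r^(x-y) takes every positive value, in particular |C|/c + 1.
  Depending on the sign of x - y the witness r is small or large.\<close>

lemma powr_exponents_eq:
  fixes c C x y :: real
  assumes c: "0 < c" and le: "\<And>r. 0 < r \<Longrightarrow> c * r powr x \<le> C * r powr y"
  shows "x = y"
proof (rule ccontr)
  assume "x \<noteq> y"
  define A where "A = \<bar>C\<bar> / c + 1"
  have A: "0 < A" using c by (simp add: A_def add_nonneg_pos)
  define r where "r = A powr (1 / (x - y))"
  have r: "0 < r" using A by (simp add: r_def)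
  have "r powr (x - y) = A" using A \<open>x \<noteq> y\<close> by (simp add: r_def powr_powr)
  then have rx: "r powr x = A * r powr y" using r by (simp add: powr_diff field_simps)
  have "c * A * r powr y \<le> C * r powr y" using le[OF r] by (simp add: rx mult.assoc)
  then have "c * A \<le> C" using r by simp
  moreover have "c * A = \<bar>C\<bar> + c" using c by (simp add: A_def field_simps)
  ultimately show False using c by linarith
qed

section \<open>Divergence near the boundary and at infinity\<close>

lemma slab_rho2_bounded:
  fixes e :: "'n::finite"
  obtains M where "\<And>u. u \<in> slab e \<Longrightarrow> 0 < rho1 e u \<Longrightarrow> rho1 e u \<le> 1 \<Longrightarrow> cmod (rho2 e z u) \<le> M"
proof
  fix u assume u: "u \<in> slab e" "0 < rho1 e u" "rho1 e u \<le> 1"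
  have uj: "cmod (u $ j) \<le> 2" if "j \<noteq> e" for j
  proof -
    have "\<bar>Re (u $ j)\<bar> \<le> 1" "\<bar>Im (u $ j)\<bar> \<le> 1" using u(1) that by (auto simp: slab_def)
    then show ?thesis using cmod_le[of "u $ j"] by linarith
  qed
  define S where "S = (\<Sum>j\<in>UNIV - {e}. (Im (u $ j))\<^sup>2)"
  have S0: "0 \<le> S" by (simp add: S_def sum_nonneg)
  have "S \<le> (\<Sum>j\<in>UNIV - {e}. 1)"
    unfolding S_def
  proof (rule sum_mono)
    fix j assume "j \<in> UNIV - {e}"
    then have "\<bar>Im (u $ j)\<bar> \<le> 1" using u by (auto simp: slab_def)
    then show "(Im (u $ j))\<^sup>2 \<le> 1" by (simp add: abs_square_le_1)
  qed
  also have "\<dots> \<le> real CARD('n)" by simp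
  finally have S1: "S \<le> real CARD('n)" .
  have "rho1 e u = Im (u $ e) - S" by (simp add: rho1_def S_def)
  moreover have "\<bar>Re (u $ e)\<bar> \<le> 1" using u by (auto simp: slab_def)
  ultimately have ue: "cmod (u $ e) \<le> real CARD('n) + 2"
    using cmod_le[of "u $ e"] S0 S1 u by linarith
  have "cmod (rho2 e z u) = cmod ((\<Sum>j\<in>UNIV - {e}. (z $ j - cnj (u $ j))\<^sup>2) - 2 * \<i> * (z $ e - cnj (u $ e))) / 4"
    by (simp add: rho2_def norm_divide)
  also have "\<dots> \<le> (cmod (\<Sum>j\<in>UNIV - {e}. (z $ j - cnj (u $ j))\<^sup>2) + cmod (2 * \<i> * (z $ e - cnj (u $ e)))) / 4"
    by (intro divide_right_mono norm_triangle_ineq4) auto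
  also have "\<dots> \<le> ((\<Sum>j\<in>UNIV - {e}. (cmod (z $ j) + 2)\<^sup>2) + 2 * (cmod (z $ e) + (real CARD('n) + 2))) / 4"
  proof (intro divide_right_mono add_mono)
    show "cmod (\<Sum>j\<in>UNIV - {e}. (z $ j - cnj (u $ j))\<^sup>2) \<le> (\<Sum>j\<in>UNIV - {e}. (cmod (z $ j) + 2)\<^sup>2)"
    proof (rule sum_norm_le)
      fix j assume j: "j \<in> UNIV - {e}"
      have "cmod (z $ j - cnj (u $ j)) \<le> cmod (z $ j) + 2"
        using norm_triangle_ineq4[of "z $ j" "cnj (u $ j)"] uj[of j] j by simp
      then show "cmod ((z $ j - cnj (u $ j))\<^sup>2) \<le> (cmod (z $ j) + 2)\<^sup>2"
        by (simp add: norm_power power_mono)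
    qed
    have "cmod (z $ e - cnj (u $ e)) \<le> cmod (z $ e) + (real CARD('n) + 2)"
      using norm_triangle_ineq4[of "z $ e" "cnj (u $ e)"] ue by simp
    then show "cmod (2 * \<i> * (z $ e - cnj (u $ e))) \<le> 2 * (cmod (z $ e) + (real CARD('n) + 2))"
      by (simp only: norm_mult) simp
  qed simp
  finally show "cmod (rho2 e z u) \<le> ((\<Sum>j\<in>UNIV - {e}. (cmod (z $ j) + 2)\<^sup>2) + 2 * (cmod (z $ e) + (real CARD('n) + 2))) / 4" .
qed

text \<open>Borderline at 0: its integral diverges, while r^(-1) (-ln r)^(-p) is integrable there
  for p > 1.\<close>

definition logfun :: "real \<Rightarrow> real" where
  "logfun r = indicator {0<..exp (-1)} r * (inverse r * (- ln r) powr (-1))"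

lemma logfun_measurable [measurable]: "logfun \<in> borel_measurable borel"
  unfolding logfun_def by measurable

lemma logfun_nonneg: "0 \<le> logfun r"
  by (auto simp: logfun_def indicator_def)

text \<open>For fixed z, |rho(z,u)| stays between two positive constants on the part of the slab
  near the boundary, so its power cannot repair the divergence of \<open>logfun\<close>, whatever c
  is.\<close>

lemma nn_integral_slab_top:
  fixes e :: "'n::finite"
  assumes z: "z \<in> TB e"
  shows "(\<integral>\<^sup>+u. indicator (slab e) u * ennreal (logfun (rho1 e u) * cmod (rho2 e z u) powr (-c)) \<partial>lborel) = top"
proof -
  obtain M where M: "\<And>u. u \<in> slab e \<Longrightarrow> 0 < rho1 e u \<Longrightarrow> rho1 e u \<le> 1 \<Longrightarrow> cmod (rho2 e z u) \<le> M"
    using slab_rho2_bounded by blast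
  obtain V where V: "0 < V" "\<And>h. h \<in> borel_measurable borel \<Longrightarrow>
      (\<integral>\<^sup>+u. indicator (slab e) u * h (rho1 e u) \<partial>lborel) = ennreal V * (\<integral>\<^sup>+r. h r \<partial>lborel)"
    using nn_integral_slab by blast
  have z0: "0 < rho1 e z" using z by (simp add: TB_def)
  define M1 where "M1 = max M 1"
  \<comment> \<open>One bound for each sign of c, since the power is decreasing or increasing
    accordingly.\<close>
  define m where "m = min ((rho1 e z / 2) powr (-c)) (M1 powr (-c))"
  have m: "0 < m" using z0 by (simp add: m_def M1_def)
  have lower: "m \<le> cmod (rho2 e z u) powr (-c)" if u: "u \<in> slab e" "0 < rho1 e u" "rho1 e u \<le> exp (-1)" for u
  proof -
    have "rho1 e u \<le> 1" using u(3) by (rule order_trans) simp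
    then have up: "cmod (rho2 e z u) \<le> M1" using M[OF u(1,2)] by (simp add: M1_def)
    have lo: "rho1 e z / 2 \<le> cmod (rho2 e z u)"
      using rho1_le_cmod_rho2(1)[OF z, of u] u by (simp add: TB_def)
    show ?thesis
    proof (cases "0 \<le> c")
      case True
      then have "M1 powr (-c) \<le> cmod (rho2 e z u) powr (-c)"
        using up lo z0 by (intro powr_mono2') auto
      then show ?thesis by (simp add: m_def)
    next
      case False
      then have "(rho1 e z / 2) powr (-c) \<le> cmod (rho2 e z u) powr (-c)"
        using lo z0 by (intro powr_mono2) auto
      then show ?thesis by (simp add: m_def)
    qed
  qed
  have "top = ennreal V * (\<integral>\<^sup>+r. ennreal m * ennreal (logfun r) \<partial>lborel)"
  proof -
    have "(\<integral>\<^sup>+r. ennreal (logfun r) \<partial>lborel) = (\<integral>\<^sup>+r. indicator {0<..exp (-1)} r * ennreal (inverse r * (- ln r) powr (-1)) \<partial>lborel)"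
      by (intro nn_integral_cong) (auto simp: logfun_def indicator_def)
    then show ?thesis
      using V(1) m unfolding nn_integral_inverse_ln_top
      by (simp add: nn_integral_cmult ennreal_mult_top)
  qed
  also have "\<dots> = (\<integral>\<^sup>+u. indicator (slab e) u * (ennreal m * ennreal (logfun (rho1 e u))) \<partial>lborel)"
    by (rule V(2)[symmetric]) measurable
  also have "\<dots> \<le> (\<integral>\<^sup>+u. indicator (slab e) u * ennreal (logfun (rho1 e u) * cmod (rho2 e z u) powr (-c)) \<partial>lborel)"
  proof (intro nn_integral_mono)
    fix u
    have "m * logfun (rho1 e u) \<le> logfun (rho1 e u) * cmod (rho2 e z u) powr (-c)" if "u \<in> slab e"
    proof (cases "rho1 e u \<in> {0<..exp (-1)}")
      case True
      then show ?thesis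
        using lower[OF that] logfun_nonneg[of "rho1 e u"] by (simp add: mult.commute[of m] mult_left_mono)
    qed (simp add: logfun_def)
    then show "indicator (slab e) u * (ennreal m * ennreal (logfun (rho1 e u))) \<le>
        indicator (slab e) u * ennreal (logfun (rho1 e u) * cmod (rho2 e z u) powr (-c))"
      using m logfun_nonneg[of "rho1 e u"] by (auto simp: indicator_def ennreal_leI simp flip: ennreal_mult)
  qed
  finally show ?thesis by (simp add: top_unique)
qed

text \<open>Two ways to diverge. If q a + be <= -1, the weight dominates \<open>logfun\<close> near
  the boundary. If the decay fails, the boxes of sizes 4^k are disjoint and each contributes at
  least the same positive constant.\<close>

lemma Nctr_finite_imp:
  fixes e :: "'n::finite"
  assumes q: "0 < q" and fin: "Nctr e be q a c 1 < top"
  shows "-1 < q * a + be" and "real CARD('n) + 1 + (q * a + be) < c * q"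
proof -
  define t where "t = q * a + be"
  define F where "F z = ennreal (rho1 e z powr t * cmod (rho2 e (ctr e 1) z) powr (- (c * q)))" for z
  have [measurable]: "F \<in> borel_measurable borel" unfolding F_def by measurable
  have F: "(\<integral>\<^sup>+z. indicator (TB e) z * F z \<partial>lborel) < top"
    using fin q epow_Nctr[of q 1 e be a c, symmetric] by (simp add: F_def t_def)
  show "-1 < q * a + be"
  proof (rule ccontr)
    assume "\<not> -1 < q * a + be"
    then have t: "t \<le> -1" by (simp add: t_def)
    have "top = (\<integral>\<^sup>+u. indicator (slab e) u * ennreal (logfun (rho1 e u) * cmod (rho2 e (ctr e 1) u) powr (- (c * q))) \<partial>lborel)"
      by (rule nn_integral_slab_top[symmetric]) (simp add: ctr_in_TB)
    also have "\<dots> \<le> (\<integral>\<^sup>+z. indicator (TB e) z * F z \<partial>lborel)"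
    proof (rule nn_integral_mono)
      fix u
      show "indicator (slab e) u * ennreal (logfun (rho1 e u) * cmod (rho2 e (ctr e 1) u) powr (- (c * q))) \<le> indicator (TB e) u * F u"
      proof (cases "rho1 e u \<in> {0<..exp (-1)}")
        case True
        define r where "r = rho1 e u"
        have r: "0 < r" "r \<le> exp (-1)" using True by (auto simp: r_def)
        then have "ln r \<le> -1" by (metis ln_exp ln_mono)
        then have "(- ln r) powr (-1) \<le> 1" by (simp add: powr_minus field_simps)
        moreover have "r powr (-1) \<le> r powr t"
          using r t by (intro powr_mono') (auto intro: order_trans)
        ultimately have "inverse r * (- ln r) powr (-1) \<le> r powr t * 1"
          using r by (intro mult_mono) (auto simp: powr_minus)
        then have "logfun r \<le> r powr t" using r by (simp add: logfun_def)
        then show ?thesis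
          using True unfolding F_def r_def by (auto simp: indicator_def TB_def intro!: ennreal_leI mult_right_mono)
      qed (simp add: logfun_def)
    qed
    finally show False using F by simp
  qed
  show "real CARD('n) + 1 + (q * a + be) < c * q"
  proof (rule ccontr)
    assume "\<not> real CARD('n) + 1 + (q * a + be) < c * q"
    then have ex: "0 \<le> real CARD('n) + 1 + t - c * q" by (simp add: t_def)
    define d where "d = 1 / (3 * real CARD('n))"
    have d: "0 < d" "3 * real CARD('n) * d \<le> 1"
      using zero_less_card_finite[where 'a = 'n] by (auto simp: d_def)
    have n1: "1 \<le> real CARD('n)" using zero_less_card_finite[where 'a = 'n] by linarith
    have d3: "d \<le> 1 / 3" using n1 by (simp add: d_def field_simps)
    obtain K where K: "0 < K" "\<And>r s. 0 < s \<Longrightarrow> s \<le> r \<Longrightarrow> ennreal (K * r powr (real CARD('n) + 1 + t - c * q)) \<le>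
      (\<integral>\<^sup>+z. indicator (Ebox e d r) z * ennreal (rho1 e z powr t * cmod (rho2 e (ctr e s) z) powr (-(c * q))) \<partial>lborel)"
      using nn_integral_Ebox_ge[OF d] by blast
    define E where "E k = Ebox e d (4 ^ k)" for k :: nat
    have [measurable]: "E k \<in> sets borel" for k by (simp add: E_def)
    have lowk: "ennreal K \<le> (\<integral>\<^sup>+z. indicator (E k) z * F z \<partial>lborel)" for k
    proof -
      have "K * 1 \<le> K * (4 ^ k) powr (real CARD('n) + 1 + t - c * q)"
        using K(1) ex by (intro mult_left_mono ge_one_powr_ge_zero) auto
      then have "ennreal K \<le> ennreal (K * (4 ^ k) powr (real CARD('n) + 1 + t - c * q))" by (intro ennreal_leI) simp
      also have "\<dots> \<le> (\<integral>\<^sup>+z. indicator (E k) z * F z \<partial>lborel)"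
        unfolding E_def F_def by (rule K(2)) auto
      finally show ?thesis .
    qed
    \<comment> \<open>d <= 1/3 confines Im z_n to the interval from 4^k / 2 to 2 4^k, and for ratio
      4 these open intervals are disjoint.\<close>
    have disj: "k = l" if "z \<in> E k" "z \<in> E l" for k l z
    proof -
      have *: "4 ^ k / 2 < Im (z $ e) \<and> Im (z $ e) < 2 * 4 ^ k" if "z \<in> E k" for k
      proof -
        have "\<bar>Im (z $ e) - 4 ^ k\<bar> \<le> d * 4 ^ k" using that by (simp add: E_def mem_Ebox)
        also have "\<dots> \<le> 1 / 3 * 4 ^ k" using d3 by (intro mult_right_mono) auto
        finally have "\<bar>Im (z $ e) - 4 ^ k\<bar> \<le> 1 / 3 * 4 ^ k" .
        moreover have "0 < (4::real) ^ k" by simp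
        ultimately show ?thesis by linarith
      qed
      have "\<not> k < l" if "z \<in> E k" "z \<in> E l" for k l
      proof
        assume "k < l"
        then have "(4::real) ^ Suc k \<le> 4 ^ l" by (intro power_increasing) auto
        then show False using *[OF that(1)] *[OF that(2)] by simp
      qed
      then show ?thesis using that by (meson linorder_neqE_nat)
    qed
    have "ennreal (real m * K) \<le> (\<integral>\<^sup>+z. indicator (TB e) z * F z \<partial>lborel)" for m :: nat
    proof -
      have "ennreal (real m * K) = (\<Sum>k<m. ennreal K)" using K(1) by (simp add: ennreal_mult ennreal_of_nat_eq_real_of_nat)
      also have "\<dots> \<le> (\<Sum>k<m. \<integral>\<^sup>+z. indicator (E k) z * F z \<partial>lborel)" by (intro sum_mono lowk)
      also have "\<dots> = (\<integral>\<^sup>+z. (\<Sum>k<m. indicator (E k) z * F z) \<partial>lborel)"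
        by (rule nn_integral_sum[symmetric]) measurable
      also have "\<dots> \<le> (\<integral>\<^sup>+z. indicator (TB e) z * F z \<partial>lborel)"
      proof (rule nn_integral_mono)
        fix z
        have "(\<Sum>k<m. indicator (E k) z :: ennreal) \<le> indicator (TB e) z"
        proof (cases "\<exists>k<m. z \<in> E k")
          case True
          then obtain k where k: "k < m" "z \<in> E k" by blast
          have "(\<Sum>j<m. indicator (E j) z :: ennreal) = (\<Sum>j<m. if j = k then 1 else 0)"
            using k disj by (intro sum.cong) (auto simp: indicator_def)
          moreover have "z \<in> TB e" using Ebox_rho1(3)[OF d _ k(2)[unfolded E_def]] by simp
          ultimately show ?thesis using k by simp
        qed (auto intro!: order_trans[OF eq_refl[OF sum.neutral]])
        then show "(\<Sum>k<m. indicator (E k) z * F z) \<le> indicator (TB e) z * F z"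
          unfolding sum_distrib_right[symmetric] by (rule mult_right_mono) simp
      qed
      finally show ?thesis .
    qed
    note big = this
    obtain I where I: "(\<integral>\<^sup>+z. indicator (TB e) z * F z \<partial>lborel) = ennreal I" "0 \<le> I"
      using F by (cases "\<integral>\<^sup>+z. indicator (TB e) z * F z \<partial>lborel" rule: ennreal_cases) auto
    obtain m :: nat where "I / K < real m" using reals_Archimedean2 by blast
    then have "I < real m * K" using K(1) by (simp add: field_simps)
    then show False using big[of m] I by (simp add: ennreal_le_iff)
  qed
qed

text \<open>If \<open>p\<^sub>1 (b\<^sub>1 + 1) \<le> \<alpha>\<^sub>1 + 1\<close>, then near the boundary \<open>\<rho>\<^bsup>-b\<^sub>1-1\<^esup> / |ln \<rho>|\<close> lies in
  \<open>L\<^bsup>p\<^sub>1\<^esup>\<^bsub>\<alpha>\<^sub>1\<^esub>\<close> since \<open>p\<^sub>1 > 1\<close>, but its product with \<open>\<rho>\<^bsup>b\<^sub>1\<^esup>\<close> is not integrable.\<close>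

lemma bounded_op_imp_integrability:
  fixes e :: "'n::finite" and p1 p2 q1 q2 a1 a2 b1 b2 c1 c2 al1 al2 be1 be2 :: real
  assumes k: "pow_kernel c1 k1" "pow_kernel c2 k2" and p: "1 < p1" "0 < p2"
    and bd: "bounded_op e a1 a2 (Gker e b1 b2 k1 k2) p1 p2 al1 al2 q1 q2 be1 be2"
  shows "al1 + 1 < p1 * (b1 + 1)"
proof (rule ccontr)
  assume "\<not> al1 + 1 < p1 * (b1 + 1)"
  then have ex: "-1 \<le> al1 - p1 * (b1 + 1)" by simp
  define d where "d = 1 / (3 * real CARD('n))"
  have d: "0 < d" "3 * real CARD('n) * d \<le> 1"
    using zero_less_card_finite[where 'a = 'n] by (auto simp: d_def)
  note km = pow_kernel_measurable[OF k(1)] pow_kernel_measurable[OF k(2)]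
  let ?K = "Gker e b1 b2 k1 k2"
  define E where "E = Ebox e d 1"
  have [measurable]: "E \<in> sets borel" by (simp add: E_def)
  have E_TB: "E \<subseteq> TB e" using Ebox_rho1(3)[OF d, of 1 _ e] by (auto simp: E_def)
  have E_pos: "emeasure lborel E > 0" using d by (simp add: E_def emeasure_Ebox)
  \<comment> \<open>Multiplied by rho^b1 this is \<open>logfun\<close>, so the u-integral will
    diverge for every z.\<close>
  define \<phi> where "\<phi> r = logfun r * r powr (-b1)" for r
  have \<phi>0: "0 \<le> \<phi> r" for r by (simp add: \<phi>_def logfun_nonneg)
  have [measurable]: "\<phi> \<in> borel_measurable borel" unfolding \<phi>_def by measurable
  define f where "f x = complex_of_real (indicator (slab e) (fst x) * \<phi> (rho1 e (fst x)) * indicator E (snd x))" for x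
  have [measurable]: "(\<lambda>x :: (complex^'n) \<times> (complex^'n). fst x) \<in> borel_measurable borel"
     "(\<lambda>x :: (complex^'n) \<times> (complex^'n). snd x) \<in> borel_measurable borel"
    by (auto simp: borel_prod[symmetric])
  have f [measurable]: "f \<in> borel_measurable borel" unfolding f_def by measurable
  have f': "f \<in> borel_measurable lebesgue" using f by (intro measurable_completion) simp
  define g where "g u = indicator (slab e) u * ennreal (\<phi> (rho1 e u))" for u
  have [measurable]: "g \<in> borel_measurable borel" unfolding g_def by measurable
  have norm_f: "ennreal (norm (f (u, \<eta>))) = g u * indicator E \<eta>" for u \<eta>
    using \<phi>0 by (auto simp: f_def g_def indicator_def)
  have g_fin: "Lnorm (wmeas e al1) p1 g < top"
  proof -
    obtain V where V: "0 < V" "\<And>h. h \<in> borel_measurable borel \<Longrightarrow>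
        (\<integral>\<^sup>+u. indicator (slab e) u * h (rho1 e u) \<partial>lborel) = ennreal V * (\<integral>\<^sup>+r. h r \<partial>lborel)"
      using nn_integral_slab by blast
    define h where "h r = indicator {0<..exp (-1)} r * ennreal (inverse r * (- ln r) powr (-p1))" for r
    have [measurable]: "h \<in> borel_measurable borel" unfolding h_def by measurable
    have pt: "ennreal (r powr al1) * ennreal (\<phi> r powr p1) \<le> h r" for r
    proof (cases "r \<in> {0<..exp (-1)}")
      case True
      then have r: "0 < r" "r \<le> exp (-1)" by auto
      have r1: "r \<le> 1" using r(2) by (rule order_trans) simp
      have \<phi>_eq: "\<phi> r = r powr (-(b1 + 1)) * (- ln r) powr (-1)"
      proof -
        have "r powr (- (b1 + 1)) = inverse r * r powr (- b1)"
          unfolding minus_add_distrib powr_add using r by (simp add: powr_minus)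
        then show ?thesis using r by (simp add: \<phi>_def logfun_def)
      qed
      have "r powr al1 * \<phi> r powr p1 = r powr (al1 - p1 * (b1 + 1)) * (- ln r) powr (-p1)"
      proof -
        have ex': "al1 - p1 * (b1 + 1) = al1 + - (b1 + 1) * p1" "- p1 = - 1 * p1" by (simp_all add: algebra_simps)
        show ?thesis
          unfolding ex' powr_add \<phi>_eq by (simp only: powr_mult powr_powr powr_ge_zero mult.assoc)
      qed
      \<comment> \<open>The negated inequality enters here: the exponent of r is at least -1, and r
        <= 1.\<close>
      also have "\<dots> \<le> inverse r * (- ln r) powr (-p1)"
      proof (rule mult_right_mono)
        have "r powr (al1 - p1 * (b1 + 1)) \<le> r powr (-1)"
          using r r1 ex by (intro powr_mono') auto
        then show "r powr (al1 - p1 * (b1 + 1)) \<le> inverse r" using r by (simp add: powr_minus)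
      qed simp
      finally show ?thesis using True by (simp add: h_def ennreal_leI flip: ennreal_mult)
    qed (simp add: \<phi>_def logfun_def)
    have "(\<integral>\<^sup>+u. epow (g u) p1 \<partial>wmeas e al1) \<le> (\<integral>\<^sup>+u. indicator (slab e) u * h (rho1 e u) \<partial>lborel)"
      by (subst nn_integral_wmeas, measurable)
        (auto intro!: nn_integral_mono simp: g_def indicator_def epow_ennreal \<phi>0 pt)
    also have "\<dots> = ennreal V * (\<integral>\<^sup>+r. h r \<partial>lborel)" by (rule V) measurable
    also have "\<dots> < top"
      using nn_integral_inverse_ln_powr_finite[OF p(1)] by (simp add: h_def ennreal_mult_less_top)
    finally show ?thesis by (simp add: Lnorm_def)
  qed
  have "mixnorm e p1 p2 al1 al2 f = Lnorm (wmeas e al1) p1 g * Lnorm (wmeas e al2) p2 (indicator E)"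
    using p by (subst mixnorm_eq_Lnorm) (auto simp: norm_f intro!: Lnorm_product)
  also have "\<dots> < top"
  proof -
    obtain K where "\<And>r. 0 < r \<Longrightarrow> Lnorm (wmeas e al2) p2 (indicator (Ebox e d r)) \<le> ennreal (K * r powr ((real CARD('n) + 1 + al2) / p2))"
      using Lnorm_indicator_Ebox_le[OF d p(2)] by blast
    from this[of 1] have "Lnorm (wmeas e al2) p2 (indicator E) < top"
      by (auto simp: E_def intro: le_less_trans)
    then show ?thesis using g_fin by (simp add: ennreal_mult_less_top)
  qed
  finally have "f \<in> Lspace e p1 p2 al1 al2" using f' by (simp add: Lspace_def)
  with bd have "AE x in lebesgue. x \<in> TB e \<times> TB e \<longrightarrow> set_integrable lebesgue (TB e \<times> TB e) (\<lambda>y. ?K (fst x) (snd x) y * f y)"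
    unfolding bounded_op_def by blast
  then have AE1: "AE x in lborel. x \<in> TB e \<times> TB e \<longrightarrow> set_integrable lebesgue (TB e \<times> TB e) (\<lambda>y. ?K (fst x) (snd x) y * f y)"
    by (simp only: AE_completion_iff)
  \<comment> \<open>Convergence is known only almost everywhere; the subset
    \<open>E \<times> E\<close> of the domain has positive measure and provides an actual
    point.\<close>
  obtain x where x: "x \<in> TB e \<times> TB e" "set_integrable lebesgue (TB e \<times> TB e) (\<lambda>y. ?K (fst x) (snd x) y * f y)"
  proof (rule ccontr)
    assume "\<not> thesis"
    then have none: "\<not> set_integrable lebesgue (TB e \<times> TB e) (\<lambda>y. ?K (fst x) (snd x) y * f y)" if "x \<in> TB e \<times> TB e" for x
      using that \<open>\<And>x. x \<in> TB e \<times> TB e \<Longrightarrow> set_integrable lebesgue (TB e \<times> TB e) (\<lambda>y. ?K (fst x) (snd x) y * f y) \<Longrightarrow> thesis\<close> by blast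
    have "AE x in lborel. x \<notin> E \<times> E"
      using AE1 by eventually_elim (use none E_TB in blast)
    moreover have "E \<times> E \<in> sets lborel" by (simp add: E_def)
    ultimately have "E \<times> E \<in> null_sets lborel" by (simp add: AE_iff_null_sets)
    then have "emeasure lborel (E \<times> E) = 0" by auto
    then show False using d by (simp add: E_def emeasure_Ebox_Times)
  qed
  define z where "z = fst x"
  define w where "w = snd x"
  have zw: "z \<in> TB e" "w \<in> TB e" using x(1) by (auto simp: z_def w_def)
  have "integrable lborel (\<lambda>y. indicator (TB e \<times> TB e) y *\<^sub>R (?K z w y * f y))"
    using x(2) unfolding z_def w_def Gker_integral_borel_version(1)[OF km f' f AE_I2[OF refl]] .
  then have "(\<integral>\<^sup>+y. ennreal (norm (indicator (TB e \<times> TB e) y *\<^sub>R (?K z w y * f y))) \<partial>lborel) < top"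
    by (simp add: integrable_iff_bounded)
  then have "ennreal (rho1 e z powr 0 * rho1 e w powr 0) *
     (\<integral>\<^sup>+y. ennreal (norm (indicator (TB e \<times> TB e) y *\<^sub>R (?K z w y * f y))) \<partial>lborel) < top"
    by (simp add: ennreal_mult_less_top)
  then have fin: "(\<integral>\<^sup>+\<eta>. Pker e 0 b2 c2 w \<eta> * (\<integral>\<^sup>+u. Pker e 0 b1 c1 z u * ennreal (norm (f (u, \<eta>))) \<partial>lborel) \<partial>lborel) < top"
    unfolding nn_integral_Gker[OF k zw f, of 0 0 b1 b2] .
  define I0 where "I0 = (\<integral>\<^sup>+u. Pker e 0 b1 c1 z u * g u \<partial>lborel)"
  have "top = (\<integral>\<^sup>+u. indicator (slab e) u * ennreal (logfun (rho1 e u) * cmod (rho2 e z u) powr (-c1)) \<partial>lborel)"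
    by (rule nn_integral_slab_top[OF zw(1), symmetric])
  also have "\<dots> \<le> I0"
    unfolding I0_def
  proof (rule nn_integral_mono)
    fix u
    show "indicator (slab e) u * ennreal (logfun (rho1 e u) * cmod (rho2 e z u) powr (-c1)) \<le> Pker e 0 b1 c1 z u * g u"
    proof (cases "rho1 e u \<in> {0<..exp (-1)} \<and> u \<in> slab e")
      case True
      then have u: "0 < rho1 e u" "u \<in> TB e" by (auto simp: TB_def)
      have "rho1 e u powr b1 * \<phi> (rho1 e u) = logfun (rho1 e u)"
        using u by (simp add: \<phi>_def powr_minus field_simps)
      then have l: "logfun (rho1 e u) * cmod (rho2 e z u) powr (-c1) = rho1 e u powr b1 * cmod (rho2 e z u) powr (-c1) * \<phi> (rho1 e u)"
        by (metis mult.assoc mult.commute)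
      have P: "Pker e 0 b1 c1 z u = ennreal (rho1 e u powr b1 * cmod (rho2 e z u) powr (-c1))"
        using u zw(1) by (simp add: Pker_def TB_def)
      have G: "g u = ennreal (\<phi> (rho1 e u))" using True by (simp add: g_def)
      have "Pker e 0 b1 c1 z u * g u = ennreal (logfun (rho1 e u) * cmod (rho2 e z u) powr (-c1))"
        unfolding l P G by (rule ennreal_mult[symmetric]) (auto simp: \<phi>0)
      then show ?thesis using True by simp
    qed (auto simp: logfun_def indicator_def)
  qed
  finally have I0: "I0 = top" by (simp add: top_unique)
  have "(\<integral>\<^sup>+\<eta>. Pker e 0 b2 c2 w \<eta> * (\<integral>\<^sup>+u. Pker e 0 b1 c1 z u * ennreal (norm (f (u, \<eta>))) \<partial>lborel) \<partial>lborel) =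
      (\<integral>\<^sup>+\<eta>. I0 * (Pker e 0 b2 c2 w \<eta> * indicator E \<eta>) \<partial>lborel)"
  proof (rule nn_integral_cong)
    fix \<eta>
    have "(\<integral>\<^sup>+u. Pker e 0 b1 c1 z u * ennreal (norm (f (u, \<eta>))) \<partial>lborel) = I0 * indicator E \<eta>"
      unfolding norm_f mult.assoc[symmetric] I0_def by (intro nn_integral_multc) measurable
    then show "Pker e 0 b2 c2 w \<eta> * (\<integral>\<^sup>+u. Pker e 0 b1 c1 z u * ennreal (norm (f (u, \<eta>))) \<partial>lborel) = I0 * (Pker e 0 b2 c2 w \<eta> * indicator E \<eta>)"
      by (simp add: mult_ac)
  qed
  also have "\<dots> = I0 * (\<integral>\<^sup>+\<eta>. Pker e 0 b2 c2 w \<eta> * indicator E \<eta> \<partial>lborel)"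
    by (intro nn_integral_cmult) measurable
  \<comment> \<open>As \<open>I0\<close> is \<open>top\<close>, finiteness forces the eta-integral
    to be 0, contradicting positivity of the kernel on \<open>E\<close>.\<close>
  finally have "I0 * (\<integral>\<^sup>+\<eta>. Pker e 0 b2 c2 w \<eta> * indicator E \<eta> \<partial>lborel) < top" using fin by simp
  then have "(\<integral>\<^sup>+\<eta>. Pker e 0 b2 c2 w \<eta> * indicator E \<eta> \<partial>lborel) = 0"
    unfolding I0 by (auto simp: ennreal_top_mult split: if_splits)
  then have "AE \<eta> in lborel. Pker e 0 b2 c2 w \<eta> * indicator E \<eta> = 0"
    by (subst (asm) nn_integral_0_iff_AE) auto
  then have "AE \<eta> in lborel. \<eta> \<notin> E"
  proof eventually_elim
    case (elim \<eta>)
    show ?case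
    proof
      assume "\<eta> \<in> E"
      moreover from this have "\<eta> \<in> TB e" using E_TB by auto
      moreover have "0 < cmod (rho2 e w \<eta>)" by (rule rho1_le_cmod_rho2(3)[OF zw(2) \<open>\<eta> \<in> TB e\<close>])
      ultimately show False using elim zw(2) by (auto simp: Pker_def TB_def)
    qed
  qed
  then have "E \<in> null_sets lborel" by (simp add: AE_iff_null_sets)
  then show False using E_pos by auto
qed

theorem bounded_op_Gker_iff:
  fixes e :: "'n::finite" and p1 q1 q2 a1 a2 b1 b2 c1 c2 al1 al2 be1 be2 :: real
  defines "n \<equiv> real CARD('n)"
  assumes k: "pow_kernel c1 k1" "pow_kernel c2 k2" and p: "1 < p1" "p1 \<le> q1" "1 \<le> q2"
  shows "bounded_op e a1 a2 (Gker e b1 b2 k1 k2) p1 1 al1 al2 q1 q2 be1 be2 \<longleftrightarrow>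
     al1 + 1 < p1 * (b1 + 1) \<and> al2 < b2 \<and> - q1 * a1 < be1 + 1 \<and> - q2 * a2 < be2 + 1
     \<and> c1 = n + 1 + a1 + b1 + ((n + 1 + be1) / q1 - (n + 1 + al1) / p1)
     \<and> c2 = n + 1 + a2 + b2 + ((n + 1 + be2) / q2 - (n + 1 + al2))"
proof
  assume bd: "bounded_op e a1 a2 (Gker e b1 b2 k1 k2) p1 1 al1 al2 q1 q2 be1 be2"
  have pos: "0 < p1" "(0::real) < 1" "0 < q1" "0 < q2" using p by auto
  define d where "d = 1 / (3 * real CARD('n))"
  have d: "0 < d" "3 * real CARD('n) * d \<le> 1"
    using zero_less_card_finite[where 'a = 'n] by (auto simp: d_def)
  obtain C where C: "0 < C" "\<And>r s. 0 < r \<Longrightarrow> 0 < s \<Longrightarrow>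
    ennreal (r powr (b1 + (n + 1)) * s powr (b2 + (n + 1))) * (Nctr e be1 q1 a1 c1 r * Nctr e be2 q2 a2 c2 s)
      \<le> ennreal (C * (r powr ((n + 1 + al1) / p1) * s powr ((n + 1 + al2) / 1)))"
    using bounded_op_test_inequality[OF k pos bd] unfolding n_def by blast
  obtain K1 where K1: "0 < K1" "\<And>r. 0 < r \<Longrightarrow> ennreal (K1 * r powr (a1 - c1 + (n + 1 + be1) / q1)) \<le> Nctr e be1 q1 a1 c1 r"
    using Nctr_ge[OF d pos(3)] unfolding n_def by blast
  obtain K2 where K2: "0 < K2" "\<And>r. 0 < r \<Longrightarrow> ennreal (K2 * r powr (a2 - c2 + (n + 1 + be2) / q2)) \<le> Nctr e be2 q2 a2 c2 r"
    using Nctr_ge[OF d pos(4)] unfolding n_def by blast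
  define A1 where "A1 = a1 - c1 + (n + 1 + be1) / q1"
  define A2 where "A2 = a2 - c2 + (n + 1 + be2) / q2"
  have main: "(r powr (b1 + (n + 1)) * s powr (b2 + (n + 1))) * ((K1 * r powr A1) * (K2 * s powr A2)) \<le>
      C * (r powr ((n + 1 + al1) / p1) * s powr (n + 1 + al2))" if "0 < r" "0 < s" for r s
  proof -
    have "ennreal ((r powr (b1 + (n + 1)) * s powr (b2 + (n + 1))) * ((K1 * r powr A1) * (K2 * s powr A2))) =
        ennreal (r powr (b1 + (n + 1)) * s powr (b2 + (n + 1))) * (ennreal (K1 * r powr A1) * ennreal (K2 * s powr A2))"
      using K1(1) K2(1) by (simp flip: ennreal_mult)
    also have "\<dots> \<le> ennreal (r powr (b1 + (n + 1)) * s powr (b2 + (n + 1))) * (Nctr e be1 q1 a1 c1 r * Nctr e be2 q2 a2 c2 s)"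
      unfolding A1_def A2_def using that by (intro mult_left_mono mult_mono K1 K2) auto
    also have "\<dots> \<le> ennreal (C * (r powr ((n + 1 + al1) / p1) * s powr (n + 1 + al2)))"
      using C(2)[OF that] by simp
    finally show ?thesis using C(1) by (subst (asm) ennreal_le_iff) auto
  qed
  have "(b1 + (n + 1)) + A1 = (n + 1 + al1) / p1"
  proof (rule powr_exponents_eq[where c = "K1 * K2" and C = C])
    fix r :: real assume "0 < r"
    then show "K1 * K2 * r powr (b1 + (n + 1) + A1) \<le> C * r powr ((n + 1 + al1) / p1)"
      using main[of r 1] by (simp add: powr_add mult_ac)
  qed (use K1 K2 in simp)
  then have c1: "c1 = n + 1 + a1 + b1 + ((n + 1 + be1) / q1 - (n + 1 + al1) / p1)" unfolding A1_def by linarith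
  have "(b2 + (n + 1)) + A2 = n + 1 + al2"
  proof (rule powr_exponents_eq[where c = "K1 * K2" and C = C])
    fix r :: real assume "0 < r"
    then show "K1 * K2 * r powr (b2 + (n + 1) + A2) \<le> C * r powr (n + 1 + al2)"
      using main[of 1 r] by (simp add: powr_add mult_ac)
  qed (use K1 K2 in simp)
  then have c2: "c2 = n + 1 + a2 + b2 + ((n + 1 + be2) / q2 - (n + 1 + al2))" unfolding A2_def by linarith
  have "Nctr e be1 q1 a1 c1 1 * Nctr e be2 q2 a2 c2 1 \<le> ennreal C" using C(2)[of 1 1] by simp
  then have "Nctr e be1 q1 a1 c1 1 * Nctr e be2 q2 a2 c2 1 < top" by (rule le_less_trans) simp
  \<comment> \<open>A product containing \<open>top\<close> is finite when the other factor is 0, so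
    both factors are first seen to be positive.\<close>
  moreover have "Nctr e be1 q1 a1 c1 1 > 0" "Nctr e be2 q2 a2 c2 1 > 0"
    using K1(1) K1(2)[of 1] K2(1) K2(2)[of 1] by (auto intro: less_le_trans[rotated])
  ultimately have fin: "Nctr e be1 q1 a1 c1 1 < top" "Nctr e be2 q2 a2 c2 1 < top"
    by (auto simp: ennreal_mult_less_top)
  note f1 = Nctr_finite_imp[OF pos(3) fin(1), folded n_def] and f2 = Nctr_finite_imp[OF pos(4) fin(2), folded n_def]
  \<comment> \<open>The decay condition becomes al2 < b2 because the source exponent in this
    variable is 1.\<close>
  have "c2 * q2 = n + 1 + (q2 * a2 + be2) + (b2 - al2) * q2" using pos by (simp add: c2 field_simps)
  then have "0 < (b2 - al2) * q2" using f2(2) by simp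
  then have "al2 < b2" using pos by (simp add: zero_less_mult_iff)
  then show "al1 + 1 < p1 * (b1 + 1) \<and> al2 < b2 \<and> - q1 * a1 < be1 + 1 \<and> - q2 * a2 < be2 + 1
     \<and> c1 = n + 1 + a1 + b1 + ((n + 1 + be1) / q1 - (n + 1 + al1) / p1)
     \<and> c2 = n + 1 + a2 + b2 + ((n + 1 + be2) / q2 - (n + 1 + al2))"
    using c1 c2 f1(1) f2(1) bounded_op_imp_integrability[OF k p(1) pos(2) bd] by (intro conjI) (assumption | linarith)+
next
  assume "al1 + 1 < p1 * (b1 + 1) \<and> al2 < b2 \<and> - q1 * a1 < be1 + 1 \<and> - q2 * a2 < be2 + 1
     \<and> c1 = n + 1 + a1 + b1 + ((n + 1 + be1) / q1 - (n + 1 + al1) / p1)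
     \<and> c2 = n + 1 + a2 + b2 + ((n + 1 + be2) / q2 - (n + 1 + al2))"
  then show "bounded_op e a1 a2 (Gker e b1 b2 k1 k2) p1 1 al1 al2 q1 q2 be1 be2"
    unfolding n_def by (elim conjE) (rule bounded_op_Gker[OF k p])
qed

section \<open>The kernels of \<open>S\<close> and \<open>T\<close>\<close>

text \<open>By homogeneity, slow variation reduces to continuity of t^(-c) at t = 1, where t =
  |x|/|y|.\<close>

lemma pow_kernel_abs: "pow_kernel c (\<lambda>x. complex_of_real (1 / cmod x powr c))"
  unfolding pow_kernel_def
proof (intro conjI)
  show "(\<lambda>x. complex_of_real (1 / cmod x powr c)) \<in> borel_measurable borel" by measurable
  show "\<forall>x. 0 < Re x \<longrightarrow> cmod (complex_of_real (1 / cmod x powr c)) = cmod x powr (-c)"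
    by (simp add: norm_divide powr_minus_divide)
  have "isCont (\<lambda>t::real. t powr (-c)) 1" by (intro continuous_intros) auto
  then obtain \<delta> where \<delta>: "0 < \<delta>" "\<And>t. dist t 1 < \<delta> \<Longrightarrow> dist (t powr (-c)) (1 powr (-c)) < 1 / 4"
    unfolding continuous_at_eps_delta by (metis zero_less_divide_1_iff zero_less_numeral)
  show "\<exists>eps>0. \<forall>x y. 0 < Re x \<longrightarrow> 0 < Re y \<longrightarrow> cmod (x - y) \<le> eps * cmod y \<longrightarrow>
     cmod (complex_of_real (1 / cmod x powr c) - complex_of_real (1 / cmod y powr c)) \<le> cmod (complex_of_real (1 / cmod y powr c)) / 4"
  proof (intro exI[of _ "\<delta> / 2"] conjI allI impI)
    show "0 < \<delta> / 2" using \<delta> by simp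
    fix x y assume "0 < Re x" "0 < Re y" and le: "cmod (x - y) \<le> \<delta> / 2 * cmod y"
    then have y: "0 < cmod y" and x: "0 < cmod x" by auto
    have "\<bar>cmod x - cmod y\<bar> \<le> \<delta> / 2 * cmod y" using le norm_triangle_ineq3[of x y] by linarith
    then have "\<bar>cmod x - cmod y\<bar> / cmod y \<le> \<delta> / 2" using y by (simp add: field_simps)
    moreover have "cmod x / cmod y - 1 = (cmod x - cmod y) / cmod y"
      using y by (simp add: diff_divide_distrib)
    then have "\<bar>cmod x - cmod y\<bar> / cmod y = \<bar>cmod x / cmod y - 1\<bar>"
      by (simp only: abs_divide abs_norm_cancel)
    ultimately have "dist (cmod x / cmod y) 1 < \<delta>" using \<delta>(1) by (simp add: dist_real_def)
    then have "\<bar>(cmod x / cmod y) powr (-c) - 1\<bar> < 1 / 4" using \<delta>(2) by (simp add: dist_real_def)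
    then have "cmod y powr (-c) * \<bar>(cmod x / cmod y) powr (-c) - 1\<bar> \<le> cmod y powr (-c) * (1 / 4)"
      by (intro mult_left_mono) auto
    also have "cmod y powr (-c) * \<bar>(cmod x / cmod y) powr (-c) - 1\<bar> = \<bar>cmod y powr (-c) * ((cmod x / cmod y) powr (-c) - 1)\<bar>"
      by (simp add: abs_mult)
    also have "cmod y powr (-c) * ((cmod x / cmod y) powr (-c) - 1) = cmod x powr (-c) - cmod y powr (-c)"
      using x y by (simp add: powr_divide field_simps)
    finally show "cmod (complex_of_real (1 / cmod x powr c) - complex_of_real (1 / cmod y powr c)) \<le> cmod (complex_of_real (1 / cmod y powr c)) / 4"
      unfolding powr_minus_divide[symmetric] of_real_diff[symmetric] norm_of_real by simp
  qed
qed

text \<open>The arguments of x/y and y are below pi/2 in modulus, so their sum stays strictly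
  between -pi and pi and the principal logarithm is additive.\<close>

lemma Re_pos_powr_divide:
  assumes "0 < Re x" "0 < Re y" "0 < Re (x / y)"
  shows "x powr a = (x / y) powr a * y powr a"
proof -
  have nz: "x \<noteq> 0" "y \<noteq> 0" "x / y \<noteq> 0" using assms by auto
  have "\<bar>Im (Ln y)\<bar> < pi / 2" "\<bar>Im (Ln (x / y))\<bar> < pi / 2"
    using assms nz Re_Ln_pos_lt[of y] Re_Ln_pos_lt[of "x / y"] by blast+
  then have "Ln (x / y * y) = Ln (x / y) + Ln y"
    using nz by (intro Ln_times_simple) auto
  then show ?thesis using nz by (simp add: powr_def distrib_left exp_add)
qed

text \<open>The same reduction to t near 1, now with t = x/y complex; keeping t in the right
  half-plane makes the principal branch multiplicative.\<close>

lemma pow_kernel_powr: "pow_kernel c (\<lambda>x. 1 / x powr complex_of_real c)"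
  unfolding pow_kernel_def
proof (intro conjI)
  show "(\<lambda>x. 1 / x powr complex_of_real c) \<in> borel_measurable borel"
  proof -
    have "(\<lambda>x. 1 / (if x = 0 then 0 else exp (complex_of_real c * Ln x))) \<in> borel_measurable borel"
      by measurable
    then show ?thesis by (simp add: powr_def)
  qed
  have norm_k: "cmod (1 / x powr complex_of_real c) = cmod x powr (-c)" for x
    by (simp add: norm_divide norm_powr_real_powr' powr_minus_divide)
  then show "\<forall>x. 0 < Re x \<longrightarrow> cmod (1 / x powr complex_of_real c) = cmod x powr (-c)" by simp
  have inv: "1 / x powr complex_of_real c = x powr (- complex_of_real c)" for x
    by (simp add: powr_minus_divide)
  have "isCont (\<lambda>t::complex. t powr (- complex_of_real c)) 1"
    by (intro continuous_intros) (auto simp: complex_nonpos_Reals_iff)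
  then obtain \<delta> where \<delta>: "0 < \<delta>" "\<And>t. dist t 1 < \<delta> \<Longrightarrow> dist (t powr (- complex_of_real c)) (1 powr (- complex_of_real c)) < 1 / 4"
    unfolding continuous_at_eps_delta by (metis zero_less_divide_1_iff zero_less_numeral)
  show "\<exists>eps>0. \<forall>x y. 0 < Re x \<longrightarrow> 0 < Re y \<longrightarrow> cmod (x - y) \<le> eps * cmod y \<longrightarrow>
     cmod (1 / x powr complex_of_real c - 1 / y powr complex_of_real c) \<le> cmod (1 / y powr complex_of_real c) / 4"
  \<comment> \<open>The bound 1/2 keeps Re (x / y) at least 1/2, hence positive.\<close>
  proof (intro exI[of _ "min (\<delta> / 2) (1 / 2)"] conjI allI impI)
    show "0 < min (\<delta> / 2) (1 / 2)" using \<delta> by simp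
    fix x y assume xy: "0 < Re x" "0 < Re y" and le: "cmod (x - y) \<le> min (\<delta> / 2) (1 / 2) * cmod y"
    then have y: "0 < cmod y" by auto
    then have "x / y - 1 = (x - y) / y" by (simp add: diff_divide_distrib)
    then have "cmod (x / y - 1) = cmod (x - y) / cmod y" by (simp only: norm_divide)
    also have "\<dots> \<le> min (\<delta> / 2) (1 / 2)" using le y by (simp only: pos_divide_le_eq)
    finally have "cmod (x / y - 1) \<le> min (\<delta> / 2) (1 / 2)" .
    then have t: "cmod (x / y - 1) < \<delta>" "cmod (x / y - 1) \<le> 1 / 2" using \<delta>(1) by auto
    have "0 < Re (x / y)" using t(2) abs_Re_le_cmod[of "x / y - 1"] by simp
    note eq = Re_pos_powr_divide[OF xy this]
    have "cmod ((x / y) powr (- complex_of_real c) - 1) \<le> 1 / 4"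
      using \<delta>(2)[of "x / y"] t(1) by (simp add: dist_norm)
    then have "cmod ((x / y) powr (- complex_of_real c) - 1) * cmod (y powr (- complex_of_real c)) \<le> 1 / 4 * cmod (y powr (- complex_of_real c))"
      by (intro mult_right_mono) auto
    also have "cmod ((x / y) powr (- complex_of_real c) - 1) * cmod (y powr (- complex_of_real c)) = cmod (x powr (- complex_of_real c) - y powr (- complex_of_real c))"
      unfolding norm_mult[symmetric] by (simp add: eq[of "- complex_of_real c"] left_diff_distrib)
    finally show "cmod (1 / x powr complex_of_real c - 1 / y powr complex_of_real c) \<le> cmod (1 / y powr complex_of_real c) / 4"
      unfolding inv by simp
  qed
qed

lemma Skernel_eq_Gker:
  "Skernel e b1 b2 c1 c2 = Gker e b1 b2 (\<lambda>x. complex_of_real (1 / cmod x powr c1)) (\<lambda>x. complex_of_real (1 / cmod x powr c2))"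
  by (intro ext) (simp add: Skernel_def Gker_def)

lemma Tkernel_eq_Gker:
  "Tkernel e b1 b2 c1 c2 = Gker e b1 b2 (\<lambda>x. 1 / x powr complex_of_real c1) (\<lambda>x. 1 / x powr complex_of_real c2)"
  by (intro ext) (simp add: Tkernel_def Gker_def)

theorem theorem6p3:
  fixes e :: "'n::finite"
    and p1 q1 q2 a1 a2 b1 b2 c1 c2 al1 al2 be1 be2 :: real
  assumes "1 < p1" and "p1 \<le> min q1 q2"
    and "al1 > -1" and "al2 > -1" and "be1 > -1" and "be2 > -1"
  defines "n \<equiv> real CARD('n)"
  shows "(bounded_op e a1 a2 (Skernel e b1 b2 c1 c2) p1 1 al1 al2 q1 q2 be1 be2
            \<longleftrightarrow> bounded_op e a1 a2 (Tkernel e b1 b2 c1 c2) p1 1 al1 al2 q1 q2 be1 be2)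
       \<and> (bounded_op e a1 a2 (Tkernel e b1 b2 c1 c2) p1 1 al1 al2 q1 q2 be1 be2
            \<longleftrightarrow> (al1 + 1 < p1 * (b1 + 1) \<and> al2 < b2
                 \<and> - q1 * a1 < be1 + 1 \<and> - q2 * a2 < be2 + 1
                 \<and> c1 = n + 1 + a1 + b1 + ((n + 1 + be1) / q1 - (n + 1 + al1) / p1)
                 \<and> c2 = n + 1 + a2 + b2 + ((n + 1 + be2) / q2 - (n + 1 + al2))))"
proof -
  have p: "1 < p1" "p1 \<le> q1" "1 \<le> q2" using assms(1,2) by auto
  \<comment> \<open>Both operators reduce to the same arithmetic condition, which does not involve
    the phase of the kernel.\<close>
  show ?thesis
    unfolding Skernel_eq_Gker Tkernel_eq_Gker n_def
      bounded_op_Gker_iff[OF pow_kernel_abs pow_kernel_abs p] bounded_op_Gker_iff[OF pow_kernel_powr pow_kernel_powr p]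
    by blast
qed

end
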